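(* Let $X$ be a quasi-projective complex manifold, $f$ a non-invertible holomorphic function on $X$ with $\mathcal M=(\mathcal O_X)_f\neq0$, and $\alpha\in\mathbb C$. Let $-\beta$ be the smallest and $-\gamma$ the largest root of $b_f(s)$ in $-\alpha+\mathbb Z$. Then $$n_\alpha=\operatorname{mult}_{s=-\beta/k}\,b_{f^k}(s)\qquad\text{for all integers }k\ge\beta-\gamma+1.$$
   Context: For a holomorphic function $g$ on $X$, $b_g(s)$ is the Bernstein–Sato polynomial: the monic polynomial of minimal degree with $P(s)\cdot g^{s+1}=b_g(s)g^s$ for some $P(s)\in\mathcal D_X[s]$. $\operatorname{mult}_{s=c}$ denotes the multiplicity of $c$ as a root. (It is implicit that $b_f(s)$ has a root in $-\alpha+\mathbb Z$.) Let $\iota:X\to X\times\mathbb C_t$ be the graph embedding of $f$, $\iota_+\mathcal M=\sum_{j\ge0}\mathcal M\otimes\partial_t^j$, and $s=-\partial_tt$. $V^\bullet\iota_+\mathcal M$ is the Kashiwara–Malgrange $V$-filtration along $\{t=0\}$ (decreasing), normalized so that $s+\alpha$ is nilpotent on $\mathrm{gr}_V^\alpha\iota_+\mathcal M$. The nilpotency index $n_\alpha$ is the smallest integer $n\ge0$ such that $(s+\alpha)^n\cdot\mathrm{gr}_V^\alpha\iota_+\mathcal M=0$; it coincides with the nilpotency index of the logarithm of (the unipotent part of) monodromy on the nearby cycles $\psi_{f,e^{-2\pi i\alpha}}\mathbb Q$. *)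

theory Defs
  imports "HOL-Analysis.Analysis" "HOL-Computational_Algebra.Polynomial"
begin

section \<open>Quasi-projective complex manifolds\<close>

definition holomorphic_Cn :: "((complex^'n) \<Rightarrow> complex) \<Rightarrow> (complex^'n) set \<Rightarrow> bool" where
  "holomorphic_Cn G B \<longleftrightarrow>
     (\<forall>x\<in>B. \<exists>D. (G has_derivative D) (at x) \<and> (\<forall>c v. D (c *s v) = c * D v))"

definition complex_submanifold :: "(complex^'n) set \<Rightarrow> bool" where
  "complex_submanifold S \<longleftrightarrow>
     (\<forall>p\<in>S. \<exists>B B' (\<Phi> :: complex^'n \<Rightarrow> complex^'n) \<Psi> (L :: (complex^'n) set). open B \<and> p \<in> B \<and> open B' \<and>
        \<Phi> ` B = B' \<and> \<Psi> ` B' = B \<and> (\<forall>x\<in>B. \<Psi> (\<Phi> x) = x) \<and>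
        (\<forall>i. holomorphic_Cn (\<lambda>x. \<Phi> x $ i) B) \<and> (\<forall>i. holomorphic_Cn (\<lambda>y. \<Psi> y $ i) B') \<and>
        vec.subspace L \<and> \<Phi> ` (B \<inter> S) = B' \<inter> L)"

text \<open>Points of projective space are lines through the origin of \<open>complex^'n\<close>, so that the
  projective dimension is \<open>CARD('n) - 1\<close>.  For a set \<open>U\<close> of lines, \<open>pcone U\<close> is the punctured
  affine cone over \<open>U\<close>, that is, the preimage of \<open>U\<close> under \<open>cline\<close>.\<close>

type_synonym 'n point = "(complex^'n) set"

definition cline :: "complex^'n \<Rightarrow> 'n point" where
  "cline v = range (\<lambda>c. c *s v)"

definition proj_space :: "'n::finite point set" where
  "proj_space = cline ` (- {0})"

definition pcone :: "'n point set \<Rightarrow> (complex^'n) set" where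
  "pcone U = \<Union>U - {0}"

definition proj_topology :: "'n::finite point topology" where
  "proj_topology = topology (\<lambda>U. U \<subseteq> proj_space \<and> open (pcone U))"

inductive_set polynomial_functions :: "((complex^'n) \<Rightarrow> complex) set" where
  const: "(\<lambda>_. c) \<in> polynomial_functions"
| coord: "(\<lambda>v. v $ i) \<in> polynomial_functions"
| add: "F \<in> polynomial_functions \<Longrightarrow> G \<in> polynomial_functions \<Longrightarrow> (\<lambda>v. F v + G v) \<in> polynomial_functions"
| mult: "F \<in> polynomial_functions \<Longrightarrow> G \<in> polynomial_functions \<Longrightarrow> (\<lambda>v. F v * G v) \<in> polynomial_functions"

definition homogeneous_polynomials :: "((complex^'n) \<Rightarrow> complex) set" where
  "homogeneous_polynomials =
     {F \<in> polynomial_functions. \<exists>d. \<forall>c v. F (c *s v) = c ^ d * F v}"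

definition zariski_closed :: "'n::finite point set \<Rightarrow> bool" where
  "zariski_closed Z \<longleftrightarrow>
     (\<exists>S \<subseteq> homogeneous_polynomials. Z = {L \<in> proj_space. \<forall>F\<in>S. \<forall>v\<in>L. F v = 0})"

text \<open>The set of \<open>v \<in> pcone X\<close> with \<open>v $ i = 1\<close> is \<open>X\<close> in the \<open>i\<close>-th standard affine chart.
  Neither connectedness nor equidimensionality is required.\<close>

definition quasi_projective_manifold :: "'n::finite point set \<Rightarrow> bool" where
  "quasi_projective_manifold X \<longleftrightarrow>
     (\<exists>A B. zariski_closed A \<and> zariski_closed B \<and> X = A - B) \<and>
     (\<forall>i. complex_submanifold {v \<in> pcone X. v $ i = 1})"

definition open_in :: "'n::finite point set \<Rightarrow> 'n point set \<Rightarrow> bool" where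
  "open_in X U \<longleftrightarrow> openin (subtopology proj_topology X) U"

definition restr :: "'n point set \<Rightarrow> ('n point \<Rightarrow> complex) \<Rightarrow> 'n point \<Rightarrow> complex" where
  "restr U g = (\<lambda>p. if p \<in> U then g p else 0)"

text \<open>The structure sheaf.  A section over \<open>U\<close> is a function extended by \<open>0\<close> outside \<open>U\<close>
  (so that equality of sections is equality of functions), locally induced by a holomorphic
  function of the homogeneous coordinates.\<close>

definition hol :: "'n::finite point set \<Rightarrow> ('n point \<Rightarrow> complex) set" where
  "hol U = {g. (\<forall>p. p \<notin> U \<longrightarrow> g p = 0) \<and>
     (\<forall>v\<in>pcone U. \<exists>B G. open B \<and> v \<in> B \<and> holomorphic_Cn G B \<and>
        (\<forall>w\<in>B \<inter> pcone U. g (cline w) = G w))}"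

text \<open>Sections over \<open>U\<close> of the sheaf of \<open>\<complex>\<close>-linear derivations of the structure sheaf, i.e.
  holomorphic vector fields; \<open>\<xi> W\<close> is the action on functions on the open subset \<open>W\<close> of \<open>U\<close>.\<close>

definition vector_fields ::
  "'n::finite point set \<Rightarrow> 'n point set \<Rightarrow>
   ('n point set \<Rightarrow> ('n point \<Rightarrow> complex) \<Rightarrow> ('n point \<Rightarrow> complex)) set" where
  "vector_fields X U = {\<xi>. \<forall>W. open_in X W \<and> W \<subseteq> U \<longrightarrow>
     (\<forall>g\<in>hol W. \<xi> W g \<in> hol W) \<and>
     (\<forall>g\<in>hol W. \<forall>h\<in>hol W. \<xi> W (\<lambda>p. g p + h p) = (\<lambda>p. \<xi> W g p + \<xi> W h p)) \<and>
     (\<forall>c. \<forall>g\<in>hol W. \<xi> W (\<lambda>p. c * g p) = (\<lambda>p. c * \<xi> W g p)) \<and>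
     (\<forall>g\<in>hol W. \<forall>h\<in>hol W. \<xi> W (\<lambda>p. g p * h p) = (\<lambda>p. \<xi> W g p * h p + g p * \<xi> W h p)) \<and>
     (\<forall>W'. open_in X W' \<and> W' \<subseteq> W \<longrightarrow> (\<forall>g\<in>hol W. \<xi> W' (restr W' g) = restr W' (\<xi> W g)))}"


section \<open>The localization and differential operators\<close>

definition nonvan :: "('n point \<Rightarrow> complex) \<Rightarrow> 'n point set \<Rightarrow> 'n point set" where
  "nonvan f U = {p \<in> U. f p \<noteq> 0}"

text \<open>Sections over \<open>U\<close> of \<open>\<M> = (\<O>\<^sub>X)\<^sub>f\<close>: functions on \<open>nonvan f U\<close>, extended by \<open>0\<close>, that locally
  on \<open>U\<close> are of the form \<open>g / f^m\<close> with \<open>g\<close> holomorphic.  An element of the localization is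
  determined by its values where \<open>f \<noteq> 0\<close>, also if \<open>f\<close> vanishes on some component of \<open>X\<close> (the
  localization is then zero there).  A vector field \<open>\<xi>\<close> over \<open>U\<close> acts on sections over \<open>U\<close> by
  \<open>\<xi> (nonvan f U)\<close>.\<close>

definition localization ::
  "'n::finite point set \<Rightarrow> ('n point \<Rightarrow> complex) \<Rightarrow> 'n point set \<Rightarrow> ('n point \<Rightarrow> complex) set" where
  "localization X f U = {h. (\<forall>p. p \<notin> nonvan f U \<longrightarrow> h p = 0) \<and>
     (\<forall>p\<in>U. \<exists>W m. \<exists>g\<in>hol W. open_in X W \<and> p \<in> W \<and> W \<subseteq> U \<and>
        (\<forall>q\<in>nonvan f W. h q = g q / f q ^ m))}"

text \<open>A sequence \<open>u\<close> stands for \<open>\<Sum>j. u j s\<^sup>j f\<^sup>s\<close> or for \<open>\<Sum>j. u j \<otimes> \<partial>\<^sub>t\<^sup>j\<close>.\<close>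

type_synonym 'n seq = "nat \<Rightarrow> 'n point \<Rightarrow> complex"

definition shift :: "'n seq \<Rightarrow> 'n seq" where
  "shift u = (\<lambda>j p. if j = 0 then 0 else u (j - 1) p)"

definition restr_seq :: "'n point set \<Rightarrow> 'n seq \<Rightarrow> 'n seq" where
  "restr_seq U u = (\<lambda>j. restr U (u j))"

definition mult_op :: "('n point \<Rightarrow> complex) \<Rightarrow> 'n seq \<Rightarrow> 'n seq" where
  "mult_op g u = (\<lambda>j p. g p * u j p)"

text \<open>\<open>\<D>\<^sub>X\<close> is generated by functions and vector fields.  Algebras of differential operators are
  represented by their images in the operators on the module they act on.\<close>

inductive_set generated_algebra :: "('n seq \<Rightarrow> 'n seq) set \<Rightarrow> ('n seq \<Rightarrow> 'n seq) set"
  for G :: "('n seq \<Rightarrow> 'n seq) set" where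
  gen: "P \<in> G \<Longrightarrow> P \<in> generated_algebra G"
| add: "P \<in> generated_algebra G \<Longrightarrow> Q \<in> generated_algebra G \<Longrightarrow>
        (\<lambda>u j p. P u j p + Q u j p) \<in> generated_algebra G"
| comp: "P \<in> generated_algebra G \<Longrightarrow> Q \<in> generated_algebra G \<Longrightarrow> P \<circ> Q \<in> generated_algebra G"


section \<open>Bernstein-Sato polynomials\<close>

text \<open>\<open>\<xi> (h s\<^sup>j f\<^sup>s) = \<xi>(h) s\<^sup>j f\<^sup>s + h \<xi>(f) / f s\<^sup>j\<^sup>+\<^sup>1 f\<^sup>s\<close>, and \<open>s\<close> acts by \<open>shift\<close>.\<close>

definition vf_fs ::
  "('n point \<Rightarrow> complex) \<Rightarrow> 'n point set \<Rightarrow>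
   ('n point set \<Rightarrow> ('n point \<Rightarrow> complex) \<Rightarrow> ('n point \<Rightarrow> complex)) \<Rightarrow> 'n seq \<Rightarrow> 'n seq" where
  "vf_fs f U \<xi> u = (\<lambda>j p. \<xi> (nonvan f U) (u j) p + \<xi> U (restr U f) p / f p * shift u j p)"

text \<open>\<open>\<D>\<^sub>X[s]\<close> over \<open>U\<close>, acting on \<open>\<M>[s] f\<^sup>s\<close>.\<close>

definition D_s ::
  "'n::finite point set \<Rightarrow> ('n point \<Rightarrow> complex) \<Rightarrow> 'n point set \<Rightarrow> ('n seq \<Rightarrow> 'n seq) set" where
  "D_s X f U = generated_algebra (mult_op ` hol U \<union> vf_fs f U ` vector_fields X U \<union> {shift})"

text \<open>\<open>q(s) g f\<^sup>s\<close> for a polynomial \<open>q\<close> with constant coefficients and a function \<open>g\<close>.\<close>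

definition poly_fs ::
  "('n point \<Rightarrow> complex) \<Rightarrow> 'n point set \<Rightarrow> complex poly \<Rightarrow> ('n point \<Rightarrow> complex) \<Rightarrow> 'n seq" where
  "poly_fs f U q g = (\<lambda>j. restr (nonvan f U) (\<lambda>p. coeff q j * g p))"

text \<open>\<open>P(s) f\<^sup>s\<^sup>+\<^sup>1 = b(s) f\<^sup>s\<close> is an equation of sections of a sheaf, with \<open>P(s)\<close> existing locally
  on \<open>X\<close>; thus \<open>b\<close> is a multiple of all local Bernstein-Sato polynomials.\<close>

definition bs_equation :: "'n::finite point set \<Rightarrow> ('n point \<Rightarrow> complex) \<Rightarrow> complex poly \<Rightarrow> bool" where
  "bs_equation X f b \<longleftrightarrow>
     (\<forall>p\<in>X. \<exists>U. open_in X U \<and> p \<in> U \<and>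
        (\<exists>P\<in>D_s X f U. P (poly_fs f U 1 f) = poly_fs f U b (\<lambda>_. 1)))"

definition is_bernstein_sato ::
  "'n::finite point set \<Rightarrow> ('n point \<Rightarrow> complex) \<Rightarrow> complex poly \<Rightarrow> bool" where
  "is_bernstein_sato X f b \<longleftrightarrow>
     lead_coeff b = 1 \<and> bs_equation X f b \<and>
     (\<forall>c. lead_coeff c = 1 \<and> bs_equation X f c \<longrightarrow> degree b \<le> degree c)"

text \<open>The value \<open>0\<close> signals that there is no Bernstein-Sato polynomial (possible if \<open>f\<close> is
  transcendental and \<open>X\<close> is not compact).  Every complex number is then a root, so there is no
  smallest root in a class modulo \<open>\<int>\<close>.\<close>

definition bernstein_sato ::
  "'n::finite point set \<Rightarrow> ('n point \<Rightarrow> complex) \<Rightarrow> complex poly" where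
  "bernstein_sato X f =
     (if \<exists>b. is_bernstein_sato X f b then THE b. is_bernstein_sato X f b else 0)"


section \<open>The graph embedding and the V-filtration\<close>

text \<open>Sections over \<open>U\<close> of \<open>\<iota>\<^sub>+\<M>\<close>, which is supported on the graph of \<open>f\<close> and regarded as a sheaf
  on \<open>X\<close>.\<close>

definition graph_module ::
  "'n::finite point set \<Rightarrow> ('n point \<Rightarrow> complex) \<Rightarrow> 'n point set \<Rightarrow> 'n seq set" where
  "graph_module X f U = {u. (\<forall>j. u j \<in> localization X f U) \<and>
     (\<forall>p\<in>U. \<exists>W N. open_in X W \<and> p \<in> W \<and> (\<forall>j\<ge>N. \<forall>q\<in>W. u j q = 0))}"

text \<open>\<open>t (m \<otimes> \<partial>\<^sub>t\<^sup>j) = f m \<otimes> \<partial>\<^sub>t\<^sup>j - j m \<otimes> \<partial>\<^sub>t\<^sup>j\<^sup>-\<^sup>1\<close> and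
  \<open>\<xi> (m \<otimes> \<partial>\<^sub>t\<^sup>j) = \<xi>(m) \<otimes> \<partial>\<^sub>t\<^sup>j - \<xi>(f) m \<otimes> \<partial>\<^sub>t\<^sup>j\<^sup>+\<^sup>1\<close>.\<close>

definition t_op :: "('n point \<Rightarrow> complex) \<Rightarrow> 'n seq \<Rightarrow> 'n seq" where
  "t_op f u = (\<lambda>j p. f p * u j p - of_nat (Suc j) * u (Suc j) p)"

definition dt_op :: "'n seq \<Rightarrow> 'n seq" where
  "dt_op = shift"

definition s_op :: "('n point \<Rightarrow> complex) \<Rightarrow> 'n seq \<Rightarrow> 'n seq" where
  "s_op f u = (\<lambda>j p. - dt_op (t_op f u) j p)"

definition vf_graph ::
  "('n point \<Rightarrow> complex) \<Rightarrow> 'n point set \<Rightarrow>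
   ('n point set \<Rightarrow> ('n point \<Rightarrow> complex) \<Rightarrow> ('n point \<Rightarrow> complex)) \<Rightarrow> 'n seq \<Rightarrow> 'n seq" where
  "vf_graph f U \<xi> u = (\<lambda>j p. \<xi> (nonvan f U) (u j) p - \<xi> U (restr U f) p * shift u j p)"

definition s_plus :: "('n point \<Rightarrow> complex) \<Rightarrow> complex \<Rightarrow> 'n seq \<Rightarrow> 'n seq" where
  "s_plus f a u = (\<lambda>j p. s_op f u j p + a * u j p)"

text \<open>\<open>V\<^sup>0\<D>\<close> of \<open>X \<times> \<complex>\<close> is generated by holomorphic functions of \<open>(x, t)\<close>, vector fields on \<open>X\<close> and
  \<open>\<partial>\<^sub>t t\<close>.  As \<open>t - f\<close> acts locally nilpotently, Taylor expansion in \<open>t - f\<close> shows that on each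
  section a holomorphic function of \<open>(x, t)\<close> acts locally as a polynomial in \<open>t\<close> over \<open>\<O>\<^sub>X\<close>, so
  functions on \<open>X\<close> together with \<open>t\<close> generate the same submodules.\<close>

definition V0_D ::
  "'n::finite point set \<Rightarrow> ('n point \<Rightarrow> complex) \<Rightarrow> 'n point set \<Rightarrow> ('n seq \<Rightarrow> 'n seq) set" where
  "V0_D X f U = generated_algebra
     (mult_op ` hol U \<union> vf_graph f U ` vector_fields X U \<union> {t_op f, s_op f})"

definition V0_submodule ::
  "'n::finite point set \<Rightarrow> ('n point \<Rightarrow> complex) \<Rightarrow> ('n point set \<Rightarrow> 'n seq set) \<Rightarrow> bool" where
  "V0_submodule X f F \<longleftrightarrow> (\<forall>U. open_in X U \<longrightarrow>
     F U \<subseteq> graph_module X f U \<and>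
     (\<lambda>_ _. 0) \<in> F U \<and>
     (\<forall>u\<in>F U. \<forall>v\<in>F U. (\<lambda>j p. u j p + v j p) \<in> F U) \<and>
     (\<forall>P\<in>V0_D X f U. \<forall>u\<in>F U. P u \<in> F U) \<and>
     (\<forall>W. open_in X W \<and> W \<subseteq> U \<longrightarrow> (\<forall>u\<in>F U. restr_seq W u \<in> F W)) \<and>
     (\<forall>u\<in>graph_module X f U.
        (\<forall>p\<in>U. \<exists>W. open_in X W \<and> p \<in> W \<and> W \<subseteq> U \<and> restr_seq W u \<in> F W) \<longrightarrow> u \<in> F U))"

inductive_set V0_span ::
  "'n::finite point set \<Rightarrow> ('n point \<Rightarrow> complex) \<Rightarrow> 'n point set \<Rightarrow> 'n seq set \<Rightarrow> 'n seq set"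
  for X f U G where
  zero: "(\<lambda>_ _. 0) \<in> V0_span X f U G"
| add: "P \<in> V0_D X f U \<Longrightarrow> g \<in> G \<Longrightarrow> u \<in> V0_span X f U G \<Longrightarrow>
        (\<lambda>j p. P g j p + u j p) \<in> V0_span X f U G"

text \<open>For \<open>V\<^sup>0\<D>\<close>-submodules of the coherent \<open>\<D>\<close>-module \<open>\<iota>\<^sub>+\<M>\<close>, coherence over \<open>V\<^sup>0\<D>\<close> is local
  finite generation.\<close>

definition V0_coherent ::
  "'n::finite point set \<Rightarrow> ('n point \<Rightarrow> complex) \<Rightarrow> ('n point set \<Rightarrow> 'n seq set) \<Rightarrow> bool" where
  "V0_coherent X f F \<longleftrightarrow>
     (\<forall>p\<in>X. \<exists>W G. open_in X W \<and> p \<in> W \<and> finite G \<and> G \<subseteq> F W \<and>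
        (\<forall>U u q. open_in X U \<and> U \<subseteq> W \<and> u \<in> F U \<and> q \<in> U \<longrightarrow>
           (\<exists>U'. open_in X U' \<and> q \<in> U' \<and> U' \<subseteq> U \<and>
              restr_seq U' u \<in> V0_span X f U' (restr_seq U' ` G))))"

definition V_greater ::
  "'n::finite point set \<Rightarrow> (rat \<Rightarrow> 'n point set \<Rightarrow> 'n seq set) \<Rightarrow> rat \<Rightarrow> 'n point set \<Rightarrow> 'n seq set" where
  "V_greater X V a U = {u \<in> V a U. \<forall>p\<in>U. \<exists>W b. open_in X W \<and> p \<in> W \<and> W \<subseteq> U \<and> a < b \<and>
     restr_seq W u \<in> V b W}"

text \<open>The conditions characterizing the Kashiwara-Malgrange filtration of \<open>\<iota>\<^sub>+\<M>\<close> along \<open>t = 0\<close>, which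
  is indexed by \<open>\<rat>\<close>.  In order: coherent \<open>V\<^sup>0\<D>\<close>-submodules; decreasing; exhaustive; discretely
  indexed and left-continuous; the conditions on \<open>t\<close> and \<open>\<partial>\<^sub>t\<close>; nilpotency of \<open>s + a\<close> on the
  \<open>a\<close>-th graded piece.\<close>

definition kashiwara_malgrange ::
  "'n::finite point set \<Rightarrow> ('n point \<Rightarrow> complex) \<Rightarrow> (rat \<Rightarrow> 'n point set \<Rightarrow> 'n seq set) \<Rightarrow> bool" where
  "kashiwara_malgrange X f V \<longleftrightarrow>
     (\<forall>a. V0_submodule X f (V a) \<and> V0_coherent X f (V a)) \<and>
     (\<forall>a b U. a \<le> b \<and> open_in X U \<longrightarrow> V b U \<subseteq> V a U) \<and>
     (\<forall>U u p. open_in X U \<and> u \<in> graph_module X f U \<and> p \<in> U \<longrightarrow>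
        (\<exists>W a. open_in X W \<and> p \<in> W \<and> W \<subseteq> U \<and> restr_seq W u \<in> V a W)) \<and>
     (\<forall>p\<in>X. \<exists>W. \<exists>r::nat. open_in X W \<and> p \<in> W \<and> r > 0 \<and>
        (\<forall>i::int. \<forall>a U. of_int i / of_nat r < a \<and> a \<le> of_int (i + 1) / of_nat r \<and>
           open_in X U \<and> U \<subseteq> W \<longrightarrow> V a U = V (of_int (i + 1) / of_nat r) U)) \<and>
     (\<forall>a U. open_in X U \<longrightarrow> t_op f ` V a U \<subseteq> V (a + 1) U) \<and>
     (\<forall>a U. a > 0 \<and> open_in X U \<longrightarrow> t_op f ` V a U = V (a + 1) U) \<and>
     (\<forall>a U. open_in X U \<longrightarrow> dt_op ` V a U \<subseteq> V (a - 1) U) \<and>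
     (\<forall>a. \<forall>p\<in>X. \<exists>W n. open_in X W \<and> p \<in> W \<and>
        (\<forall>U. open_in X U \<and> U \<subseteq> W \<longrightarrow>
           (\<forall>u\<in>V a U. (s_plus f (of_rat a) ^^ n) u \<in> V_greater X V a U)))"

text \<open>The least \<open>n\<close> such that \<open>(s + \<alpha>)\<^sup>n\<close> annihilates the \<open>\<alpha>\<close>-th graded piece, which is zero for
  \<open>\<alpha> \<notin> \<rat>\<close>.\<close>

definition nilpotency_index ::
  "'n::finite point set \<Rightarrow> ('n point \<Rightarrow> complex) \<Rightarrow> (rat \<Rightarrow> 'n point set \<Rightarrow> 'n seq set) \<Rightarrow>
   complex \<Rightarrow> nat" where
  "nilpotency_index X f V \<alpha> = (LEAST n. \<forall>a U. of_rat a = \<alpha> \<and> open_in X U \<longrightarrow>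
     (\<forall>u\<in>V a U. (s_plus f \<alpha> ^^ n) u \<in> V_greater X V a U))"


section \<open>Well-definedness of the topology\<close>

lemma cline_eqI:
  assumes "v \<in> cline w" "v \<noteq> 0" shows "cline v = cline w"
proof -
  obtain c where c: "v = c *s w" using assms(1) by (auto simp: cline_def)
  have "c \<noteq> 0" using c assms(2) by auto
  then have "d *s w = (d / c) *s v" for d by (simp add: c)
  then have "cline w \<subseteq> cline v" by (auto simp: cline_def)
  moreover have "cline v \<subseteq> cline w" by (auto simp: cline_def c)
  ultimately show ?thesis by blast
qed

lemma pcone_iff:
  assumes "U \<subseteq> proj_space"
  shows "v \<in> pcone U \<longleftrightarrow> v \<noteq> 0 \<and> cline v \<in> U"
proof
  assume "v \<in> pcone U"
  then obtain L where L: "v \<noteq> 0" "L \<in> U" "v \<in> L" by (auto simp: pcone_def)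
  obtain w where "L = cline w" using L assms by (auto simp: proj_space_def)
  then show "v \<noteq> 0 \<and> cline v \<in> U" using L cline_eqI by metis
next
  assume "v \<noteq> 0 \<and> cline v \<in> U"
  moreover have "v \<in> cline v" unfolding cline_def by (metis rangeI vector_smult_lid)
  ultimately show "v \<in> pcone U" by (auto simp: pcone_def)
qed

lemma openin_proj_topology:
  "openin proj_topology (U :: 'n::finite point set) \<longleftrightarrow> U \<subseteq> proj_space \<and> open (pcone U)"
proof -
  have "istopology (\<lambda>U :: 'n point set. U \<subseteq> proj_space \<and> open (pcone U))"
    unfolding istopology_def
  proof (rule conjI; intro allI impI)
    fix S T :: "'n point set"
    assume S: "S \<subseteq> proj_space \<and> open (pcone S)" and T: "T \<subseteq> proj_space \<and> open (pcone T)"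
    have I: "S \<inter> T \<subseteq> proj_space" using S by blast
    have "pcone (S \<inter> T) = pcone S \<inter> pcone T"
      using pcone_iff[OF I] S T by (auto simp: pcone_iff)
    then show "S \<inter> T \<subseteq> proj_space \<and> open (pcone (S \<inter> T))" using S T I by auto
  next
    fix K :: "'n point set set"
    assume K: "\<forall>S\<in>K. S \<subseteq> proj_space \<and> open (pcone S)"
    have "pcone (\<Union>K) = (\<Union>S\<in>K. pcone S)" by (auto simp: pcone_def)
    then show "\<Union>K \<subseteq> proj_space \<and> open (pcone (\<Union>K))" using K by auto
  qed
  then show ?thesis by (simp add: proj_topology_def topology_inverse')
qed

end

theory Submission
  imports Defs
begin

text \<open>Identify \<open>\<M>[s] f\<^sup>s\<close> with the graph module through \<open>s = - \<partial>\<^sub>t t\<close> and put \<open>N\<^sub>i = \<D>\<^sub>X[s] f\<^sup>s\<^sup>+\<^sup>i\<close> for \<open>i \<in> \<int>\<close>.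
Since \<open>t f\<^sup>s\<^sup>+\<^sup>i = f\<^sup>s\<^sup>+\<^sup>i\<^sup>+\<^sup>1\<close> and \<open>t q(s) = q(s + 1) t\<close>, the operator \<open>t\<close> carries \<open>N\<^sub>i\<close> bijectively to \<open>N\<^sub>i\<^sub>+\<^sub>1\<close>; the
\<open>N\<^sub>i\<close> decrease, and every section of the graph module lies locally in some \<open>N\<^sub>i\<close>.  The polynomial \<open>b\<^sub>f\<close> is
the minimal polynomial of \<open>s\<close> on \<open>N\<^sub>0 / N\<^sub>1\<close>, and \<open>B(s) = b(s / k)\<close>, where \<open>b\<close> is the Bernstein-Sato polynomial
of \<open>f\<^sup>k\<close>, is up to a constant the minimal polynomial of \<open>s\<close> on \<open>N\<^sub>0 / N\<^sub>k\<close> (\<open>bs_equation_iff_N_germ\<close>).  Write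
\<open>\<alpha> = \<beta> + i\<close>, let \<open>m\<close> be the multiplicity of \<open>-\<beta>\<close> in \<open>B\<close> and \<open>n\<close> the nilpotency index of \<open>s + \<alpha>\<close> on the
\<open>\<alpha>\<close>-th graded piece of \<open>V\<close>.

\<open>n \<le> m\<close> (\<open>annihilates_order\<close>).  The polynomial \<open>b\<^sub>f(s + l)\<close> carries \<open>N\<^sub>l\<close> into \<open>N\<^sub>l\<^sub>+\<^sub>1\<close> and vanishes at \<open>-\<alpha>\<close> only
if \<open>-\<beta> \<le> l - \<alpha> \<le> -\<gamma>\<close>, which fails for \<open>l < i\<close>, and for \<open>l \<ge> i + k\<close> because \<open>k \<ge> \<beta> - \<gamma> + 1\<close>.  A section \<open>u\<close>
of \<open>V\<^sup>\<alpha>\<close> lies in some \<open>N\<^sub>-\<^sub>J\<close>; a product \<open>Q\<close> of such factors moves it to \<open>N\<^sub>i\<close>, then \<open>B(s + i)\<close> moves it to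
\<open>N\<^sub>i\<^sub>+\<^sub>k\<close>, and a second product \<open>Q'\<close> moves it to an \<open>N\<^sub>L\<close> inside \<open>V\<^sup>>\<^sup>\<alpha>\<close>.  Thus \<open>Q'(s) B(s + i) Q(s)\<close>, whose
multiplicity at \<open>-\<alpha>\<close> is \<open>m\<close>, carries \<open>u\<close> into \<open>V\<^sup>>\<^sup>\<alpha>\<close>.  As \<open>s + \<alpha>\<close> is nilpotent on the graded piece, the
factors that do not vanish at \<open>-\<alpha>\<close> can be cancelled, so \<open>(s + \<alpha>)\<^sup>m\<close> already does.

\<open>m \<le> n\<close> (\<open>order_le_annihilates\<close>).  Near a point, \<open>f\<^sup>s\<^sup>+\<^sup>i\<close> lies in some \<open>V\<^sup>c\<close>.  Multiplying by a power of \<open>s + a\<close>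
for each jump \<open>a\<close> of \<open>V\<close> pushes it arbitrarily deep into \<open>V\<close>, and \<open>s + \<alpha>\<close> is used at most \<open>n\<close> times.  Deep
steps of \<open>V\<close> lie in \<open>N\<^sub>i\<^sub>+\<^sub>k\<close>: the generators of the coherent module \<open>V\<^sup>1\<close> lie in some \<open>N\<^sub>-\<^sub>J\<close>, and
\<open>V\<^sup>a\<^sup>+\<^sup>1 = t V\<^sup>a\<close> for \<open>a > 0\<close> (\<open>V_deep_in_N\<close>).  Conjugation by \<open>t\<^sup>i\<close> gives \<open>D\<close> with \<open>D(s) N\<^sub>0 \<subseteq> N\<^sub>k\<close> near the
point, whose multiplicity at \<open>-\<beta>\<close> is at most \<open>n\<close>.  Although \<open>D\<close> depends on the point, the ideal of all
such polynomials contains \<open>D\<close> and \<open>B = (s + \<beta>)\<^sup>m c(s)\<close>, so if \<open>m\<close> exceeded \<open>n\<close> it would contain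
\<open>(s + \<beta>)\<^sup>n c(s)\<close> at every point, against the minimality of \<open>B\<close>.

All of this happens at the level of germs.  Sections are functions extended by \<open>0\<close>, so a germ is represented
by an arbitrary sequence of functions, of which only restrictions to small open sets matter; the operators
\<open>s\<close>, \<open>t\<close> and \<open>q(s)\<close> act pointwise and commute with restriction.\<close>

section \<open>Holomorphic functions\<close>

lemma open_in_iff: "open_in X U \<longleftrightarrow> (\<exists>T. T \<subseteq> proj_space \<and> open (pcone T) \<and> U = T \<inter> X)"
  by (simp add: open_in_def openin_subtopology openin_proj_topology conj_assoc)

lemma open_in_subset: "open_in X U \<Longrightarrow> U \<subseteq> X"
  by (auto simp: open_in_iff)

lemma open_in_Int: "open_in X U \<Longrightarrow> open_in X W \<Longrightarrow> open_in X (U \<inter> W)"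
  by (simp add: open_in_def openin_Int)

lemma open_in_self:
  assumes "X \<subseteq> proj_space"
  shows "open_in X X"
proof -
  have "pcone (proj_space :: 'a point set) = - {0}"
    by (auto simp: pcone_iff) (auto simp: proj_space_def)
  then show ?thesis
    unfolding open_in_iff using assms by (intro exI[of _ proj_space]) (auto simp: open_Compl)
qed

lemma pcone_mono: "U \<subseteq> W \<Longrightarrow> pcone U \<subseteq> pcone W"
  by (auto simp: pcone_def)

lemma cline_scale: "c \<noteq> 0 \<Longrightarrow> cline (c *s v) = cline v"
  by (cases "v = 0") (use cline_eqI[of "c *s v" v] in \<open>auto simp: cline_def\<close>)

lemma holomorphic_Cn_subset: "holomorphic_Cn G B \<Longrightarrow> B' \<subseteq> B \<Longrightarrow> holomorphic_Cn G B'"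
  by (auto simp: holomorphic_Cn_def)

lemma holomorphic_Cn_const: "holomorphic_Cn (\<lambda>_. c) B"
  by (auto simp: holomorphic_Cn_def intro!: exI[of _ "\<lambda>_. 0"])

lemma holomorphic_Cn_add:
  assumes "holomorphic_Cn F B" "holomorphic_Cn G B"
  shows "holomorphic_Cn (\<lambda>x. F x + G x) B"
  unfolding holomorphic_Cn_def
proof
  fix x assume "x \<in> B"
  then obtain D E where "(F has_derivative D) (at x)" "\<forall>c v. D (c *s v) = c * D v"
    "(G has_derivative E) (at x)" "\<forall>c v. E (c *s v) = c * E v"
    using assms by (auto simp: holomorphic_Cn_def) metis
  then show "\<exists>D. ((\<lambda>x. F x + G x) has_derivative D) (at x) \<and> (\<forall>c v. D (c *s v) = c * D v)"
    by (intro exI[of _ "\<lambda>h. D h + E h"]) (auto intro: has_derivative_add simp: algebra_simps)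
qed

lemma holomorphic_Cn_mult:
  assumes "holomorphic_Cn F B" "holomorphic_Cn G B"
  shows "holomorphic_Cn (\<lambda>x. F x * G x) B"
  unfolding holomorphic_Cn_def
proof
  fix x assume "x \<in> B"
  then obtain D E where "(F has_derivative D) (at x)" "\<forall>c v. D (c *s v) = c * D v"
    "(G has_derivative E) (at x)" "\<forall>c v. E (c *s v) = c * E v"
    using assms by (auto simp: holomorphic_Cn_def) metis
  then show "\<exists>D. ((\<lambda>x. F x * G x) has_derivative D) (at x) \<and> (\<forall>c v. D (c *s v) = c * D v)"
    by (intro exI[of _ "\<lambda>h. F x * E h + D h * G x"])
      (auto simp: algebra_simps intro: has_derivative_eq_rhs[OF has_derivative_mult])
qed

lemma holomorphic_Cn_inverse:
  assumes "holomorphic_Cn G B" "\<forall>x\<in>B. G x \<noteq> 0"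
  shows "holomorphic_Cn (\<lambda>x. inverse (G x)) B"
  unfolding holomorphic_Cn_def
proof
  fix x assume x: "x \<in> B"
  then obtain D where D: "(G has_derivative D) (at x)" "\<forall>c v. D (c *s v) = c * D v"
    using assms by (auto simp: holomorphic_Cn_def)
  have "((\<lambda>x. inverse (G x)) has_derivative (\<lambda>h. - (inverse (G x) * D h * inverse (G x)))) (at x)"
    using assms x D by (intro Deriv.has_derivative_inverse) auto
  then show "\<exists>D. ((\<lambda>x. inverse (G x)) has_derivative D) (at x) \<and> (\<forall>c v. D (c *s v) = c * D v)"
    using D(2) by (intro exI[of _ "\<lambda>h. - (inverse (G x) * D h * inverse (G x))"]) (simp add: algebra_simps)
qed

lemma open_nonzero_set:
  assumes "holomorphic_Cn G B" "open B"
  shows "open {x \<in> B. G x \<noteq> 0}"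
proof -
  have "continuous_on B G"
    using assms(1) unfolding holomorphic_Cn_def
    by (meson continuous_at_imp_continuous_on has_derivative_continuous)
  then have "open (B \<inter> G -` (- {0}))"
    using assms(2) by (intro continuous_open_preimage) auto
  moreover have "B \<inter> G -` (- {0}) = {x \<in> B. G x \<noteq> 0}" by auto
  ultimately show ?thesis by simp
qed

lemma holE:
  assumes "g \<in> hol U" "v \<in> pcone U"
  obtains B G where "open B" "v \<in> B" "holomorphic_Cn G B" "\<And>w. w \<in> B \<Longrightarrow> w \<in> pcone U \<Longrightarrow> g (cline w) = G w"
  using assms by (force simp: hol_def)

lemma hol_outside: "g \<in> hol U \<Longrightarrow> p \<notin> U \<Longrightarrow> g p = 0"
  by (auto simp: hol_def)

lemma holI:
  assumes "\<And>p. p \<notin> U \<Longrightarrow> g p = 0"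
    and "\<And>v. v \<in> pcone U \<Longrightarrow> \<exists>B G. open B \<and> v \<in> B \<and> holomorphic_Cn G B \<and> (\<forall>w\<in>B \<inter> pcone U. g (cline w) = G w)"
  shows "g \<in> hol U"
  using assms by (auto simp: hol_def)

lemma hol_add:
  assumes "g \<in> hol U" "h \<in> hol U"
  shows "(\<lambda>p. g p + h p) \<in> hol U"
proof (rule holI)
  fix v assume v: "v \<in> pcone U"
  obtain B G where 1: "open B" "v \<in> B" "holomorphic_Cn G B" "\<And>w. w \<in> B \<Longrightarrow> w \<in> pcone U \<Longrightarrow> g (cline w) = G w"
    using holE[OF assms(1) v] by metis
  obtain C H where 2: "open C" "v \<in> C" "holomorphic_Cn H C" "\<And>w. w \<in> C \<Longrightarrow> w \<in> pcone U \<Longrightarrow> h (cline w) = H w"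
    using holE[OF assms(2) v] by metis
  show "\<exists>B F. open B \<and> v \<in> B \<and> holomorphic_Cn F B \<and> (\<forall>w\<in>B \<inter> pcone U. g (cline w) + h (cline w) = F w)"
    using 1 2 holomorphic_Cn_subset[of G B "B \<inter> C"] holomorphic_Cn_subset[of H C "B \<inter> C"]
    by (intro exI[of _ "B \<inter> C"] exI[of _ "\<lambda>w. G w + H w"]) (auto intro: holomorphic_Cn_add)
qed (use assms in \<open>auto simp: hol_outside\<close>)

lemma hol_mult:
  assumes "g \<in> hol U" "h \<in> hol U"
  shows "(\<lambda>p. g p * h p) \<in> hol U"
proof (rule holI)
  fix v assume v: "v \<in> pcone U"
  obtain B G where 1: "open B" "v \<in> B" "holomorphic_Cn G B" "\<And>w. w \<in> B \<Longrightarrow> w \<in> pcone U \<Longrightarrow> g (cline w) = G w"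
    using holE[OF assms(1) v] by metis
  obtain C H where 2: "open C" "v \<in> C" "holomorphic_Cn H C" "\<And>w. w \<in> C \<Longrightarrow> w \<in> pcone U \<Longrightarrow> h (cline w) = H w"
    using holE[OF assms(2) v] by metis
  show "\<exists>B F. open B \<and> v \<in> B \<and> holomorphic_Cn F B \<and> (\<forall>w\<in>B \<inter> pcone U. g (cline w) * h (cline w) = F w)"
    using 1 2 holomorphic_Cn_subset[of G B "B \<inter> C"] holomorphic_Cn_subset[of H C "B \<inter> C"]
    by (intro exI[of _ "B \<inter> C"] exI[of _ "\<lambda>w. G w * H w"]) (auto intro: holomorphic_Cn_mult)
qed (use assms in \<open>auto simp: hol_outside\<close>)

lemma pcone_cline: "U \<subseteq> proj_space \<Longrightarrow> v \<in> pcone U \<Longrightarrow> cline v \<in> U"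
  by (simp add: pcone_iff)

lemma hol_const:
  assumes "U \<subseteq> proj_space"
  shows "restr U (\<lambda>_. c) \<in> hol U"
  using pcone_cline[OF assms]
  by (intro holI) (auto simp: restr_def intro!: exI[of _ UNIV] exI[of _ "\<lambda>_. c"] holomorphic_Cn_const)

lemma hol_restr:
  assumes "g \<in> hol U" "W \<subseteq> U" "U \<subseteq> proj_space"
  shows "restr W g \<in> hol W"
proof (rule holI)
  fix v assume v: "v \<in> pcone W"
  then have "v \<in> pcone U" using pcone_mono assms by blast
  from holE[OF assms(1) this] obtain B G where
    "open B" "v \<in> B" "holomorphic_Cn G B" "\<And>w. w \<in> B \<Longrightarrow> w \<in> pcone U \<Longrightarrow> g (cline w) = G w" by metis
  then show "\<exists>B G. open B \<and> v \<in> B \<and> holomorphic_Cn G B \<and> (\<forall>w\<in>B \<inter> pcone W. restr W g (cline w) = G w)"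
    using assms pcone_mono[OF assms(2)] pcone_cline[of W]
    by (intro exI[of _ B] exI[of _ G]) (auto simp: restr_def)
qed (auto simp: restr_def)

lemma hol_inverse:
  assumes "g \<in> hol U" "\<And>p. p \<in> U \<Longrightarrow> g p \<noteq> 0" "U \<subseteq> proj_space"
  shows "(\<lambda>p. inverse (g p)) \<in> hol U"
proof (rule holI)
  fix v assume v: "v \<in> pcone U"
  obtain B G where 1: "open B" "v \<in> B" "holomorphic_Cn G B" "\<And>w. w \<in> B \<Longrightarrow> w \<in> pcone U \<Longrightarrow> g (cline w) = G w"
    using holE[OF assms(1) v] by metis
  let ?B = "{x\<in>B. G x \<noteq> 0}"
  have "G v \<noteq> 0" using 1 v assms pcone_cline by metis
  moreover have "holomorphic_Cn (\<lambda>x. inverse (G x)) ?B"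
    using 1 by (intro holomorphic_Cn_inverse) (auto intro: holomorphic_Cn_subset)
  ultimately show "\<exists>B G. open B \<and> v \<in> B \<and> holomorphic_Cn G B \<and> (\<forall>w\<in>B \<inter> pcone U. inverse (g (cline w)) = G w)"
    using 1 open_nonzero_set[OF 1(3,1)]
    by (intro exI[of _ ?B] exI[of _ "\<lambda>x. inverse (G x)"]) auto
qed (use assms in \<open>auto simp: hol_outside\<close>)

lemma hol_glue:
  assumes X: "X \<subseteq> proj_space" and "U \<subseteq> X" "\<And>p. p \<notin> U \<Longrightarrow> g p = 0"
    and loc: "\<And>p. p \<in> U \<Longrightarrow> \<exists>W. open_in X W \<and> p \<in> W \<and> restr (W \<inter> U) g \<in> hol (W \<inter> U)"
  shows "g \<in> hol U"
proof (rule holI)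
  fix v assume v: "v \<in> pcone U"
  have U: "U \<subseteq> proj_space" using assms by blast
  obtain W where W: "open_in X W" "cline v \<in> W" "restr (W \<inter> U) g \<in> hol (W \<inter> U)"
    using loc pcone_cline[OF U v] by blast
  obtain T where T: "T \<subseteq> proj_space" "open (pcone T)" "W = T \<inter> X" using W by (auto simp: open_in_iff)
  have eq: "pcone (W \<inter> U) = pcone T \<inter> pcone U"
  proof -
    have "W \<inter> U \<subseteq> proj_space" using U by blast
    then show ?thesis using T U assms(2) by (auto simp: pcone_iff)
  qed
  have "v \<in> pcone (W \<inter> U)" unfolding eq using v W T U by (auto simp: pcone_iff)
  from holE[OF W(3) this] obtain B G where B:
    "open B" "v \<in> B" "holomorphic_Cn G B" "\<And>w. w \<in> B \<Longrightarrow> w \<in> pcone (W \<inter> U) \<Longrightarrow> restr (W \<inter> U) g (cline w) = G w"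
    by metis
  show "\<exists>B G. open B \<and> v \<in> B \<and> holomorphic_Cn G B \<and> (\<forall>w\<in>B \<inter> pcone U. g (cline w) = G w)"
  proof (intro exI[of _ "B \<inter> pcone T"] exI[of _ G] conjI ballI)
    show "v \<in> B \<inter> pcone T" using B \<open>v \<in> pcone (W \<inter> U)\<close> eq by blast
    fix w assume w: "w \<in> B \<inter> pcone T \<inter> pcone U"
    then have "w \<in> pcone (W \<inter> U)" using eq by blast
    then have "cline w \<in> W \<inter> U" using pcone_cline[of "W \<inter> U"] U by blast
    then show "g (cline w) = G w" using B(4)[OF _ \<open>w \<in> pcone (W \<inter> U)\<close>] w by (auto simp: restr_def)
  qed (use B T in \<open>auto intro: holomorphic_Cn_subset\<close>)
qed (use assms in auto)

text \<open>Openness in projective space is tested on cones, whereas the holomorphic functions that induce \<open>f\<close> live on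
open sets that need not be stable under scaling.  The set where they do not vanish is therefore saturated.\<close>

lemma open_in_nonvan:
  assumes X: "X \<subseteq> proj_space" and f: "f \<in> hol X" and U: "open_in X U"
  shows "open_in X (nonvan f U)"
proof -
  obtain T where T: "T \<subseteq> proj_space" "open (pcone T)" "U = T \<inter> X" using U by (auto simp: open_in_iff)
  define \<S> where "\<S> = {S. open S \<and> (\<forall>w\<in>S. w \<in> pcone X \<longrightarrow> f (cline w) \<noteq> 0)}"
  have scale: "(\<lambda>w. c *s w) ` S \<in> \<S>" if S: "S \<in> \<S>" and c: "c \<noteq> 0" for c S
  proof -
    have eq: "(\<lambda>w. c *s w) ` S = (\<lambda>w. inverse c *s w) -` S"
    proof (intro equalityI subsetI)
      fix w assume "w \<in> (\<lambda>w. inverse c *s w) -` S"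
      moreover have "w = c *s (inverse c *s w)" using c by simp
      ultimately show "w \<in> (\<lambda>w. c *s w) ` S" by blast
    qed (use c in auto)
    have "continuous_on UNIV (\<lambda>w. inverse c *s w :: complex^'a)"
      unfolding vector_scalar_mult_def by (intro continuous_intros)
    then have "open ((\<lambda>w. c *s w) ` S)"
      unfolding eq using S by (intro open_vimage) (auto simp: \<S>_def)
    moreover have "f (cline (c *s w)) \<noteq> 0" if w: "w \<in> S" "c *s w \<in> pcone X" for w
    proof -
      have "w \<in> pcone X" using X c w by (simp add: pcone_iff cline_scale)
      then have "f (cline w) \<noteq> 0" using S w unfolding \<S>_def by blast
      then show ?thesis using c by (simp only: cline_scale not_False_eq_True)
    qed
    ultimately show ?thesis by (simp add: \<S>_def)
  qed
  have cover: "\<exists>S\<in>\<S>. v \<in> S" if v: "v \<in> pcone X" "f (cline v) \<noteq> 0" for v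
  proof -
    obtain B G where 1: "open B" "v \<in> B" "holomorphic_Cn G B" "\<And>w. w \<in> B \<Longrightarrow> w \<in> pcone X \<Longrightarrow> f (cline w) = G w"
      using holE[OF f v(1)] by metis
    have "{x\<in>B. G x \<noteq> 0} \<in> \<S>" using 1 open_nonzero_set[OF 1(3,1)] by (auto simp: \<S>_def)
    moreover have "v \<in> {x\<in>B. G x \<noteq> 0}" using 1 v by simp
    ultimately show ?thesis by (rule bexI[rotated])
  qed
  \<comment> \<open>The union of \<open>\<S>\<close> is stable under nonzero scalars by \<open>scale\<close>, so it is recovered from its image among the lines.\<close>
  define T' where "T' = cline ` (\<Union>\<S> \<inter> pcone T)"
  have T': "T' \<subseteq> proj_space" by (auto simp: T'_def proj_space_def pcone_def)
  have "pcone T' = \<Union>\<S> \<inter> pcone T"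
  proof (intro equalityI subsetI)
    fix w assume "w \<in> pcone T'"
    then obtain v S where w: "w \<noteq> 0" and v: "cline w = cline v" "v \<in> S" "S \<in> \<S>" "v \<in> pcone T"
      using T' by (auto simp: pcone_iff T'_def)
    have "w \<in> cline w" unfolding cline_def by (metis rangeI vector_smult_lid)
    then obtain c where c: "w = c *s v" unfolding v by (auto simp: cline_def)
    then have "c \<noteq> 0" using w by auto
    then have "w \<in> \<Union>\<S>" using scale[OF v(3), of c] v c by auto
    then show "w \<in> \<Union>\<S> \<inter> pcone T" using w v T by (auto simp: pcone_iff)
  next
    fix w assume "w \<in> \<Union>\<S> \<inter> pcone T"
    then show "w \<in> pcone T'" using T' by (auto simp: pcone_iff T'_def) (auto simp: pcone_def)
  qed
  moreover have "open (\<Union>\<S> \<inter> pcone T)" using T by (auto simp: \<S>_def)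
  moreover have "nonvan f U = T' \<inter> X"
  proof (intro equalityI subsetI)
    fix p assume "p \<in> nonvan f U"
    then have p: "p \<in> T" "p \<in> X" "f p \<noteq> 0" using T by (auto simp: nonvan_def)
    then obtain v where v: "v \<noteq> 0" "p = cline v" using X by (auto simp: proj_space_def)
    then show "p \<in> T' \<inter> X" using p cover[of v] T X by (auto simp: T'_def pcone_iff)
  next
    fix p assume p: "p \<in> T' \<inter> X"
    then obtain v S where "p = cline v" "S \<in> \<S>" "v \<in> S" "v \<in> pcone T" by (auto simp: T'_def)
    then show "p \<in> nonvan f U" using p T X by (auto simp: nonvan_def \<S>_def pcone_iff)
  qed
  ultimately show ?thesis unfolding open_in_iff using T' by auto
qed

section \<open>The operators \<open>s\<close> and \<open>t\<close> on sequences\<close>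

lemma s_op_eq: "s_op f u j p = of_nat j * u j p - f p * shift u j p"
  by (cases j) (auto simp: s_op_def dt_op_def shift_def t_op_def algebra_simps)

lemma shift_0 [simp]: "shift u 0 p = 0"
  and shift_Suc [simp]: "shift u (Suc j) p = u j p"
  by (auto simp: shift_def)

lemma restr_seq_apply: "restr_seq W u j p = (if p \<in> W then u j p else 0)"
  by (simp add: restr_seq_def restr_def)

lemma restr_seq_restr_seq: "restr_seq W (restr_seq U u) = restr_seq (W \<inter> U) u"
  by (auto simp: restr_seq_apply fun_eq_iff)

lemma shift_restr_seq: "shift (restr_seq W u) = restr_seq W (shift u)"
  by (auto simp: shift_def restr_seq_apply fun_eq_iff)

lemma s_op_restr_seq: "s_op f (restr_seq W u) = restr_seq W (s_op f u)"
  by (auto simp: s_op_eq shift_def restr_seq_apply fun_eq_iff)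

lemma t_op_restr_seq: "t_op f (restr_seq W u) = restr_seq W (t_op f u)"
  by (auto simp: t_op_def restr_seq_apply fun_eq_iff)

lemma s_op_add: "s_op f (\<lambda>j p. u j p + v j p) = (\<lambda>j p. s_op f u j p + s_op f v j p)"
  by (auto simp: s_op_eq shift_def fun_eq_iff algebra_simps)

lemma s_op_scale: "s_op f (\<lambda>j p. g p * u j p) = (\<lambda>j p. g p * s_op f u j p)"
  by (auto simp: s_op_eq shift_def fun_eq_iff algebra_simps)

lemma t_op_add: "t_op f (\<lambda>j p. u j p + v j p) = (\<lambda>j p. t_op f u j p + t_op f v j p)"
  by (auto simp: t_op_def fun_eq_iff algebra_simps)

lemma t_op_scale: "t_op f (\<lambda>j p. g p * u j p) = (\<lambda>j p. g p * t_op f u j p)"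
  by (auto simp: t_op_def fun_eq_iff algebra_simps)

lemma t_op_s_op: "t_op f (s_op f u) = (\<lambda>j p. s_op f (t_op f u) j p + t_op f u j p)"
proof (intro ext)
  fix j p
  show "t_op f (s_op f u) j p = s_op f (t_op f u) j p + t_op f u j p"
    by (cases j) (auto simp: s_op_eq t_op_def algebra_simps)
qed

text \<open>\<open>q(s) u\<close>, evaluated by Horner's rule.\<close>

definition s_act :: "('n point \<Rightarrow> complex) \<Rightarrow> complex poly \<Rightarrow> 'n seq \<Rightarrow> 'n seq" where
  "s_act f q u = fold_coeffs (\<lambda>a w j p. a * u j p + s_op f w j p) q (\<lambda>_ _. 0)"

lemma s_act_0 [simp]: "s_act f 0 u = (\<lambda>_ _. 0)"
  by (simp add: s_act_def)

lemma s_act_pCons: "s_act f (pCons a q) u = (\<lambda>j p. a * u j p + s_op f (s_act f q u) j p)"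
proof (cases "a = 0 \<and> q = 0")
  case True
  then show ?thesis by (auto simp: s_act_def s_op_eq shift_def fun_eq_iff)
qed (auto simp: s_act_def)

lemma s_act_1 [simp]: "s_act f 1 u = u"
  by (auto simp: one_pCons s_act_pCons s_op_eq shift_def fun_eq_iff)

lemma s_act_linear_poly: "s_act f [:a, 1:] u = s_plus f a u"
  by (auto simp: s_act_pCons s_plus_def s_op_eq shift_def fun_eq_iff)

lemma s_act_add: "s_act f (q + r) u = (\<lambda>j p. s_act f q u j p + s_act f r u j p)"
  by (induction q r rule: poly_induct2) (auto simp: s_act_pCons s_op_add algebra_simps)

lemma s_act_smult: "s_act f (Polynomial.smult c q) u = (\<lambda>j p. c * s_act f q u j p)"
  by (induction q) (auto simp: s_act_pCons s_op_scale[of f "\<lambda>_. c"] algebra_simps)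

lemma s_act_mult: "s_act f (q * r) u = s_act f q (s_act f r u)"
  by (induction q) (auto simp: s_act_pCons s_act_add s_act_smult)

lemma s_act_power: "s_act f (q ^ n) u = (s_act f q ^^ n) u"
  by (induction n arbitrary: u) (auto simp: s_act_mult)

lemma s_act_plus_seq: "s_act f q (\<lambda>j p. u j p + v j p) = (\<lambda>j p. s_act f q u j p + s_act f q v j p)"
  by (induction q) (auto simp: s_act_pCons s_op_add algebra_simps)

lemma s_act_scale: "s_act f q (\<lambda>j p. g p * u j p) = (\<lambda>j p. g p * s_act f q u j p)"
  by (induction q) (auto simp: s_act_pCons s_op_scale algebra_simps)

lemma s_act_s_op: "s_act f q (s_op f u) = s_op f (s_act f q u)"
proof -
  have "s_act f [:0, 1:] u = s_op f u" for u :: "'a seq"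
    by (auto simp: s_act_linear_poly s_plus_def)
  then show ?thesis by (metis s_act_mult mult.commute)
qed

lemma s_act_restr_seq: "s_act f q (restr_seq W u) = restr_seq W (s_act f q u)"
proof (induction q)
  case (pCons a q)
  show ?case unfolding s_act_pCons pCons s_op_restr_seq by (auto simp: restr_seq_apply fun_eq_iff)
qed (auto simp: restr_seq_apply fun_eq_iff)

lemma t_op_s_act: "t_op f (s_act f q u) = s_act f (pcompose q [:1, 1:]) (t_op f u)"
proof (induction q)
  case 0
  then show ?case by (auto simp: t_op_def)
next
  case (pCons a q)
  show ?case
    unfolding s_act_pCons t_op_add pcompose_pCons s_act_add s_act_mult s_act_linear_poly
      t_op_scale[of f "\<lambda>_. a"] t_op_s_op pCons.IH
    by (auto simp: s_act_pCons s_plus_def s_op_eq shift_def fun_eq_iff)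
qed

definition bounded_seq :: "'n seq \<Rightarrow> bool" where
  "bounded_seq u \<longleftrightarrow> (\<exists>N. \<forall>j\<ge>N. \<forall>p. u j p = 0)"

lemma bounded_seqI: "(\<And>j p. j \<ge> N \<Longrightarrow> u j p = 0) \<Longrightarrow> bounded_seq u"
  by (auto simp: bounded_seq_def)

lemma bounded_seq_add: "bounded_seq u \<Longrightarrow> bounded_seq v \<Longrightarrow> bounded_seq (\<lambda>j p. u j p + v j p)"
  unfolding bounded_seq_def by (metis add.left_neutral nat_le_linear order_trans)

lemma bounded_seq_scale: "bounded_seq u \<Longrightarrow> bounded_seq (\<lambda>j p. g p * u j p)"
  unfolding bounded_seq_def by auto

lemma bounded_seq_shift: assumes "bounded_seq u" shows "bounded_seq (shift u)"
proof -
  obtain N where "\<forall>j\<ge>N. \<forall>p. u j p = 0" using assms by (auto simp: bounded_seq_def)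
  then show ?thesis by (intro bounded_seqI[of "Suc N"]) (auto simp: shift_def)
qed

lemma bounded_seq_s_op: assumes "bounded_seq u" shows "bounded_seq (s_op f u)"
proof -
  obtain N where "\<forall>j\<ge>N. \<forall>p. u j p = 0" using assms by (auto simp: bounded_seq_def)
  then show ?thesis by (intro bounded_seqI[of "Suc N"]) (auto simp: s_op_eq shift_def)
qed

lemma bounded_seq_s_act: "bounded_seq u \<Longrightarrow> bounded_seq (s_act f q u)"
proof (induction q)
  case (pCons a q)
  then have 1: "bounded_seq (s_op f (s_act f q u))" by (simp add: bounded_seq_s_op)
  show ?case unfolding s_act_pCons
    by (rule bounded_seq_add[OF bounded_seq_scale[OF pCons.prems, of "\<lambda>_. a"] 1])
qed (auto simp: bounded_seq_def)

lemma bounded_seq_restr_seq: "bounded_seq u \<Longrightarrow> bounded_seq (restr_seq W u)"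
  unfolding bounded_seq_def restr_seq_apply by auto

text \<open>Coefficients are compared from the top index downwards.  Without a bound on the index the claim fails:
\<open>\<Sum>j. f\<^sup>j / j! \<otimes> \<partial>\<^sub>t\<^sup>j\<close> is formally killed by \<open>t\<close>.\<close>

lemma t_op_inj:
  assumes "t_op f u = t_op f v" "bounded_seq u" "bounded_seq v"
    and "\<And>j p. f p = 0 \<Longrightarrow> u j p = 0" "\<And>j p. f p = 0 \<Longrightarrow> v j p = 0"
  shows "u = v"
proof -
  obtain N where N: "\<forall>j\<ge>N. \<forall>p. u j p = 0" using assms by (auto simp: bounded_seq_def)
  obtain M where M: "\<forall>j\<ge>M. \<forall>p. v j p = 0" using assms by (auto simp: bounded_seq_def)
  have "u j p = v j p" for j p
  proof (cases "f p = 0")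
    case False
    show ?thesis
    proof (cases "j \<le> N + M")
      case True
      then show ?thesis
      proof (induction rule: inc_induct)
        case (step j)
        have "t_op f u j p = t_op f v j p" using assms(1) by simp
        then show ?case using step.IH False by (simp add: t_op_def)
      qed (use M N in auto)
    qed (use M N in auto)
  qed (use assms in auto)
  then show ?thesis by (intro ext)
qed

section \<open>Algebras of operators and intertwining maps\<close>

lemma generated_algebra_relate:
  assumes "P \<in> generated_algebra G"
    and gen: "\<And>P. P \<in> G \<Longrightarrow> \<exists>P'\<in>generated_algebra H. R P P'"
    and add: "\<And>P P' Q Q'. R P P' \<Longrightarrow> R Q Q' \<Longrightarrow> R (\<lambda>u j p. P u j p + Q u j p) (\<lambda>u j p. P' u j p + Q' u j p)"
    and comp: "\<And>P P' Q Q'. R P P' \<Longrightarrow> R Q Q' \<Longrightarrow> R (P \<circ> Q) (P' \<circ> Q')"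
  shows "\<exists>P'\<in>generated_algebra H. R P P'"
  using assms(1)
proof induction
  case (add P Q)
  then obtain P' Q' where "P' \<in> generated_algebra H" "Q' \<in> generated_algebra H" "R P P'" "R Q Q'" by auto
  moreover from this have "R (\<lambda>u j p. P u j p + Q u j p) (\<lambda>u j p. P' u j p + Q' u j p)" by (intro assms(3))
  ultimately show ?case using generated_algebra.add by (intro bexI)
next
  case (comp P Q)
  then obtain P' Q' where "P' \<in> generated_algebra H" "Q' \<in> generated_algebra H" "R P P'" "R Q Q'" by auto
  moreover from this have "R (P \<circ> Q) (P' \<circ> Q')" by (intro assms(4))
  ultimately show ?case using generated_algebra.comp by (intro bexI)
qed (use gen in blast)

text \<open>An operator and its transform under \<open>\<phi>\<close> can only be compared on sequences for which vector fields obey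
the rules of calculus.  Such a set \<open>S\<close> is carried along in the induction, and the transform is found on
generators.  Here \<open>\<phi>\<close> takes an operator from its source to its target; \<open>generated_algebra_pull\<close> goes in the opposite
direction.\<close>

lemma generated_algebra_push:
  assumes P: "P \<in> generated_algebra G"
    and S: "\<And>u v. u \<in> S \<Longrightarrow> v \<in> S \<Longrightarrow> (\<lambda>j p. u j p + v j p) \<in> S"
    and \<phi>: "\<And>u v. u \<in> S \<Longrightarrow> v \<in> S \<Longrightarrow> \<phi> (\<lambda>j p. u j p + v j p) = (\<lambda>j p. \<phi> u j p + \<phi> v j p)"
    and gen: "\<And>P. P \<in> G \<Longrightarrow> \<exists>P'\<in>generated_algebra H. \<forall>u\<in>S. P u \<in> S \<and> \<phi> (P u) = P' (\<phi> u)"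
  shows "\<exists>P'\<in>generated_algebra H. \<forall>u\<in>S. P u \<in> S \<and> \<phi> (P u) = P' (\<phi> u)"
proof (rule generated_algebra_relate[OF P])
  fix P P' Q Q'
  assume *: "\<forall>u\<in>S. P u \<in> S \<and> \<phi> (P u) = P' (\<phi> u)" "\<forall>u\<in>S. Q u \<in> S \<and> \<phi> (Q u) = Q' (\<phi> u)"
  show "\<forall>u\<in>S. (\<lambda>j p. P u j p + Q u j p) \<in> S \<and> \<phi> (\<lambda>j p. P u j p + Q u j p) = (\<lambda>j p. P' (\<phi> u) j p + Q' (\<phi> u) j p)"
    using * S \<phi> by simp
  show "\<forall>u\<in>S. (P \<circ> Q) u \<in> S \<and> \<phi> ((P \<circ> Q) u) = (P' \<circ> Q') (\<phi> u)"
    using * by simp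
qed (rule gen)

lemma generated_algebra_pull:
  assumes P: "P \<in> generated_algebra G"
    and S: "\<And>u v. u \<in> S \<Longrightarrow> v \<in> S \<Longrightarrow> (\<lambda>j p. u j p + v j p) \<in> S"
    and \<phi>: "\<And>u v. u \<in> S \<Longrightarrow> v \<in> S \<Longrightarrow> \<phi> (\<lambda>j p. u j p + v j p) = (\<lambda>j p. \<phi> u j p + \<phi> v j p)"
    and gen: "\<And>P. P \<in> G \<Longrightarrow> \<exists>P'\<in>generated_algebra H. \<forall>u\<in>S. P' u \<in> S \<and> \<phi> (P' u) = P (\<phi> u)"
  shows "\<exists>P'\<in>generated_algebra H. \<forall>u\<in>S. P' u \<in> S \<and> \<phi> (P' u) = P (\<phi> u)"
proof (rule generated_algebra_relate[OF P])
  fix P P' Q Q'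
  assume *: "\<forall>u\<in>S. P' u \<in> S \<and> \<phi> (P' u) = P (\<phi> u)" "\<forall>u\<in>S. Q' u \<in> S \<and> \<phi> (Q' u) = Q (\<phi> u)"
  show "\<forall>u\<in>S. (\<lambda>j p. P' u j p + Q' u j p) \<in> S \<and> \<phi> (\<lambda>j p. P' u j p + Q' u j p) = (\<lambda>j p. P (\<phi> u) j p + Q (\<phi> u) j p)"
    using * S \<phi> by simp
  show "\<forall>u\<in>S. (P' \<circ> Q') u \<in> S \<and> \<phi> ((P' \<circ> Q') u) = (P \<circ> Q) (\<phi> u)"
    using * by simp
qed (rule gen)

lemma generated_algebra_mono:
  assumes "P \<in> generated_algebra G" "G \<subseteq> generated_algebra H" shows "P \<in> generated_algebra H"
  using assms(1) by induction (use assms(2) in \<open>blast intro: generated_algebra.intros\<close>)+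

section \<open>Vector fields on the locus \<open>f \<noteq> 0\<close>\<close>

locale hypersurface =
  fixes X :: "'n::finite point set" and f :: "'n point \<Rightarrow> complex"
  assumes X_proj: "X \<subseteq> proj_space" and f_hol: "f \<in> hol X"
begin

lemma open_in_proj: "open_in X U \<Longrightarrow> U \<subseteq> proj_space"
  using open_in_subset X_proj by blast

lemma nonvan_subset: "nonvan f U \<subseteq> U"
  by (auto simp: nonvan_def)

lemma open_nonvan: "open_in X U \<Longrightarrow> open_in X (nonvan f U)"
  using open_in_nonvan X_proj f_hol by blast

lemma nonvan_proj: "open_in X U \<Longrightarrow> nonvan f U \<subseteq> proj_space"
  using open_in_proj open_nonvan by blast

lemma f_hol_restr: "open_in X U \<Longrightarrow> restr U f \<in> hol U"
  using hol_restr[OF f_hol] open_in_subset X_proj by blast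

lemma hol_cmult: "open_in X U \<Longrightarrow> g \<in> hol U \<Longrightarrow> (\<lambda>p. c * g p) \<in> hol U"
proof -
  assume U: "open_in X U" and g: "g \<in> hol U"
  have "(\<lambda>p. restr U (\<lambda>_. c) p * g p) = (\<lambda>p. c * g p)"
    using hol_outside[OF g] by (auto simp: restr_def fun_eq_iff)
  then show ?thesis using hol_mult[OF hol_const[OF open_in_proj[OF U], of c] g] by simp
qed

lemma hol_zero: "(\<lambda>_. 0) \<in> hol U"
  by (rule holI) (auto intro!: exI[of _ UNIV] exI[of _ "\<lambda>_. 0"] holomorphic_Cn_const)

lemma hol_restrict_mult:
  assumes "h \<in> hol U" "g \<in> hol W" "W \<subseteq> U" "open_in X U"
  shows "(\<lambda>p. h p * g p) \<in> hol W"
proof -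
  have "(\<lambda>p. restr W h p * g p) = (\<lambda>p. h p * g p)"
    using hol_outside[OF assms(2)] by (auto simp: restr_def fun_eq_iff)
  then show ?thesis using hol_mult[OF hol_restr[OF assms(1,3)] assms(2)] assms open_in_proj by metis
qed

context
  fixes U \<xi> assumes U: "open_in X U" and \<xi>: "\<xi> \<in> vector_fields X U"
begin

lemma vf_hol: "h \<in> hol (nonvan f U) \<Longrightarrow> \<xi> (nonvan f U) h \<in> hol (nonvan f U)"
  and vf_add: "h \<in> hol (nonvan f U) \<Longrightarrow> h' \<in> hol (nonvan f U) \<Longrightarrow>
    \<xi> (nonvan f U) (\<lambda>p. h p + h' p) = (\<lambda>p. \<xi> (nonvan f U) h p + \<xi> (nonvan f U) h' p)"
  and vf_scale: "h \<in> hol (nonvan f U) \<Longrightarrow> \<xi> (nonvan f U) (\<lambda>p. c * h p) = (\<lambda>p. c * \<xi> (nonvan f U) h p)"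
  and vf_mult: "h \<in> hol (nonvan f U) \<Longrightarrow> h' \<in> hol (nonvan f U) \<Longrightarrow>
    \<xi> (nonvan f U) (\<lambda>p. h p * h' p) = (\<lambda>p. \<xi> (nonvan f U) h p * h' p + h p * \<xi> (nonvan f U) h' p)"
  using \<xi> open_nonvan[OF U] nonvan_subset[of U] unfolding vector_fields_def by blast+

lemma vf_hol_U: "h \<in> hol U \<Longrightarrow> \<xi> U h \<in> hol U"
  and vf_mult_U: "h \<in> hol U \<Longrightarrow> h' \<in> hol U \<Longrightarrow>
    \<xi> U (\<lambda>p. h p * h' p) = (\<lambda>p. \<xi> U h p * h' p + h p * \<xi> U h' p)"
  and vf_restr_U: "open_in X W \<Longrightarrow> W \<subseteq> U \<Longrightarrow> h \<in> hol U \<Longrightarrow> \<xi> W (restr W h) = restr W (\<xi> U h)"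
  using \<xi> U unfolding vector_fields_def by blast+

lemma vf_zero: "\<xi> (nonvan f U) (\<lambda>_. 0) = (\<lambda>_. 0)"
  using vf_scale[OF hol_zero, of 0] by simp

lemma vf_restrict: "open_in X W \<Longrightarrow> W \<subseteq> U \<Longrightarrow> h \<in> hol (nonvan f U) \<Longrightarrow>
    \<xi> (nonvan f W) (restr W h) = restr W (\<xi> (nonvan f U) h)"
proof -
  assume W: "open_in X W" "W \<subseteq> U" and h: "h \<in> hol (nonvan f U)"
  have "restr W h' = restr (nonvan f W) h'" if "h' \<in> hol (nonvan f U)" for h'
    using hol_outside[OF that] W by (auto simp: restr_def nonvan_def fun_eq_iff)
  moreover have "\<xi> (nonvan f W) (restr (nonvan f W) h) = restr (nonvan f W) (\<xi> (nonvan f U) h)"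
  proof -
    have "nonvan f W \<subseteq> nonvan f U" using W by (auto simp: nonvan_def)
    then show ?thesis
      using \<xi> open_nonvan[OF U] open_nonvan[OF W(1)] nonvan_subset[of U] h unfolding vector_fields_def
      by blast
  qed
  ultimately show ?thesis using h vf_hol by simp
qed

text \<open>\<open>\<xi>(f)\<close> is computed on all of \<open>U\<close> in the Leibniz rule, so that it is holomorphic across the zeros of \<open>f\<close>.\<close>

lemma vf_f_mult: "h \<in> hol (nonvan f U) \<Longrightarrow>
    \<xi> (nonvan f U) (\<lambda>p. f p * h p) = (\<lambda>p. \<xi> U (restr U f) p * h p + f p * \<xi> (nonvan f U) h p)"
proof -
  assume h: "h \<in> hol (nonvan f U)"
  have 1: "restr (nonvan f U) f \<in> hol (nonvan f U)" using f_hol_restr open_nonvan U by blast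
  have 2: "restr (nonvan f U) (restr U f) = restr (nonvan f U) f"
    by (auto simp: restr_def nonvan_def)
  have 3: "\<xi> (nonvan f U) (restr (nonvan f U) f) = restr (nonvan f U) (\<xi> U (restr U f))"
    using vf_restr_U[OF open_nonvan[OF U] nonvan_subset f_hol_restr[OF U]] by (simp only: 2)
  have "(\<lambda>p. f p * h p) = (\<lambda>p. restr (nonvan f U) f p * h p)"
    using hol_outside[OF h] by (auto simp: restr_def fun_eq_iff)
  then show ?thesis
    using vf_mult[OF 1 h] hol_outside[OF h] hol_outside[OF vf_hol[OF h]]
    by (auto simp: 3) (auto simp: restr_def fun_eq_iff)
qed

lemma vector_fields_restrict: "W \<subseteq> U \<Longrightarrow> \<xi> \<in> vector_fields X W"
  using \<xi> unfolding vector_fields_def by blast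

end

text \<open>The sections of the graph module and those of \<open>\<M>[s] f\<^sup>s\<close> all have entries of this kind, and these entries
are the functions to which vector fields on the nonvanishing locus apply.\<close>

definition nv_seqs :: "'n point set \<Rightarrow> 'n seq set" where
  "nv_seqs U = {u. \<forall>j. u j \<in> hol (nonvan f U)}"

lemma nv_seqsD: "u \<in> nv_seqs U \<Longrightarrow> u j \<in> hol (nonvan f U)"
  by (simp add: nv_seqs_def)

lemma nv_seqs_outside: "u \<in> nv_seqs U \<Longrightarrow> p \<notin> nonvan f U \<Longrightarrow> u j p = 0"
  by (rule hol_outside[OF nv_seqsD])

lemma nv_seqs_add: "u \<in> nv_seqs U \<Longrightarrow> v \<in> nv_seqs U \<Longrightarrow> (\<lambda>j p. u j p + v j p) \<in> nv_seqs U"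
  by (auto simp: nv_seqs_def hol_add)

lemma nv_seqs_scale: "open_in X U \<Longrightarrow> u \<in> nv_seqs U \<Longrightarrow> (\<lambda>j p. c * u j p) \<in> nv_seqs U"
  using hol_cmult[OF open_nonvan] by (auto simp: nv_seqs_def)

lemma nv_seqs_mult: "open_in X U \<Longrightarrow> h \<in> hol U \<Longrightarrow> u \<in> nv_seqs U \<Longrightarrow> (\<lambda>j p. h p * u j p) \<in> nv_seqs U"
  using hol_restrict_mult[OF _ _ nonvan_subset] by (auto simp: nv_seqs_def)

lemma nv_seqs_f: "open_in X U \<Longrightarrow> u \<in> nv_seqs U \<Longrightarrow> (\<lambda>j p. f p * u j p) \<in> nv_seqs U"
  using hol_restrict_mult[OF f_hol _ _ open_in_self[OF X_proj]] open_in_subset[OF open_nonvan]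
  by (auto simp: nv_seqs_def)

lemma nv_seqs_shift: "u \<in> nv_seqs U \<Longrightarrow> shift u \<in> nv_seqs U"
  unfolding nv_seqs_def mem_Collect_eq
proof
  fix j assume "\<forall>j. u j \<in> hol (nonvan f U)"
  then show "shift u j \<in> hol (nonvan f U)"
    by (cases j) (auto simp: shift_def hol_zero)
qed

lemma nv_seqs_t_op:
  assumes U: "open_in X U" and u: "u \<in> nv_seqs U" shows "t_op f u \<in> nv_seqs U"
  unfolding nv_seqs_def mem_Collect_eq
proof
  fix j
  have "(\<lambda>p. f p * u j p + (- of_nat (Suc j)) * u (Suc j) p) \<in> hol (nonvan f U)"
    using nv_seqs_f[OF U u] u hol_cmult[OF open_nonvan[OF U]] by (intro hol_add) (auto simp: nv_seqs_def)
  then show "t_op f u j \<in> hol (nonvan f U)" unfolding t_op_def by (simp del: of_nat_Suc)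
qed

lemma s_op_shift_t_op: "s_op f u = (\<lambda>j p. - 1 * shift (t_op f u) j p)"
  by (simp add: s_op_def dt_op_def)

lemma nv_seqs_s_op:
  assumes U: "open_in X U" and u: "u \<in> nv_seqs U" shows "s_op f u \<in> nv_seqs U"
  unfolding s_op_shift_t_op by (intro nv_seqs_scale nv_seqs_shift nv_seqs_t_op assms)

lemma nv_seqs_s_act:
  assumes U: "open_in X U" and u: "u \<in> nv_seqs U" shows "s_act f q u \<in> nv_seqs U"
proof (induction q)
  case 0
  show ?case by (simp add: nv_seqs_def hol_zero)
next
  case (pCons a q)
  then show ?case unfolding s_act_pCons by (intro nv_seqs_add nv_seqs_scale nv_seqs_s_op assms)
qed

lemma nv_seqs_restr:
  assumes "open_in X U" "open_in X W" "W \<subseteq> U" "u \<in> nv_seqs U" shows "restr_seq W u \<in> nv_seqs W"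
  unfolding nv_seqs_def mem_Collect_eq
proof
  fix j
  have "restr (nonvan f W) (u j) \<in> hol (nonvan f W)"
    using assms nonvan_proj by (intro hol_restr[OF nv_seqsD]) (auto simp: nonvan_def)
  moreover have "restr (nonvan f W) (u j) = restr W (u j)"
    using nv_seqs_outside[OF assms(4)] assms(3) by (auto simp: restr_def nonvan_def fun_eq_iff)
  ultimately show "restr_seq W u j \<in> hol (nonvan f W)" by (simp add: restr_seq_def)
qed

context
  fixes U \<xi> assumes U: "open_in X U" and \<xi>: "\<xi> \<in> vector_fields X U"
begin

lemma vf_graph_nv_seqs: assumes u: "u \<in> nv_seqs U" shows "vf_graph f U \<xi> u \<in> nv_seqs U"
proof -
  have g: "\<xi> U (restr U f) \<in> hol U" by (rule vf_hol_U[OF U \<xi> f_hol_restr[OF U]])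
  have "(\<lambda>j p. \<xi> (nonvan f U) (u j) p + (- 1) * (\<xi> U (restr U f) p * shift u j p)) \<in> nv_seqs U"
    by (intro nv_seqs_add nv_seqs_scale[OF U] nv_seqs_mult U g nv_seqs_shift u)
       (use vf_hol[OF U \<xi>] u in \<open>auto simp: nv_seqs_def\<close>)
  then show ?thesis by (simp add: vf_graph_def)
qed

lemma vf_graph_add: "u \<in> nv_seqs U \<Longrightarrow> v \<in> nv_seqs U \<Longrightarrow>
    vf_graph f U \<xi> (\<lambda>j p. u j p + v j p) = (\<lambda>j p. vf_graph f U \<xi> u j p + vf_graph f U \<xi> v j p)"
  by (auto simp: vf_graph_def shift_def vf_add[OF U \<xi>] nv_seqsD fun_eq_iff algebra_simps)

lemma vf_graph_scale: "u \<in> nv_seqs U \<Longrightarrow>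
    vf_graph f U \<xi> (\<lambda>j p. c * u j p) = (\<lambda>j p. c * vf_graph f U \<xi> u j p)"
  by (auto simp: vf_graph_def shift_def vf_scale[OF U \<xi>] nv_seqsD fun_eq_iff algebra_simps)

lemma vf_graph_shift:
  assumes u: "u \<in> nv_seqs U" shows "vf_graph f U \<xi> (shift u) = shift (vf_graph f U \<xi> u)"
proof (intro ext)
  fix j p
  have "shift u 0 = (\<lambda>_. 0)" "shift u (Suc j) = u j" for j by (auto simp: shift_def)
  then show "vf_graph f U \<xi> (shift u) j p = shift (vf_graph f U \<xi> u) j p"
    by (cases j) (auto simp: vf_graph_def vf_zero[OF U \<xi>])
qed

text \<open>\<open>\<xi>\<close> acts as \<open>\<xi> - \<xi>(f) \<partial>\<^sub>t\<close> on coefficients.  Its first part contributes \<open>\<xi>(f)\<close> to the commutator with \<open>t\<close>, by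
differentiating the \<open>f\<close> in \<open>t\<close>, and its second part contributes \<open>- \<xi>(f) [\<partial>\<^sub>t, t] = - \<xi>(f)\<close>.\<close>

lemma vf_graph_t_op:
  assumes u: "u \<in> nv_seqs U" shows "vf_graph f U \<xi> (t_op f u) = t_op f (vf_graph f U \<xi> u)"
proof (intro ext)
  fix j p
  have "\<xi> (nonvan f U) (\<lambda>p. f p * u j p + c * u (Suc j) p)
     = (\<lambda>p. \<xi> U (restr U f) p * u j p + f p * \<xi> (nonvan f U) (u j) p + c * \<xi> (nonvan f U) (u (Suc j)) p)" for c
    by (simp only: vf_add[OF U \<xi>] vf_f_mult[OF U \<xi>] vf_scale[OF U \<xi>] nv_seqsD[OF u]
      nv_seqsD[OF nv_seqs_f[OF U u]] hol_cmult[OF open_nonvan[OF U]])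
  from this[of "- of_nat (Suc j)"] show "vf_graph f U \<xi> (t_op f u) j p = t_op f (vf_graph f U \<xi> u) j p"
    by (cases j) (auto simp: vf_graph_def t_op_def algebra_simps)
qed

lemma vf_graph_s_op:
  assumes u: "u \<in> nv_seqs U" shows "vf_graph f U \<xi> (s_op f u) = s_op f (vf_graph f U \<xi> u)"
  unfolding s_op_shift_t_op
  by (simp only: vf_graph_scale nv_seqs_shift nv_seqs_t_op U u vf_graph_shift vf_graph_t_op)

lemma vf_graph_restr:
  assumes W: "open_in X W" "W \<subseteq> U" and u: "u \<in> nv_seqs U"
  shows "vf_graph f W \<xi> (restr_seq W u) = restr_seq W (vf_graph f U \<xi> u)"
proof (intro ext)
  fix j p
  have "restr W (restr U f) = restr W f" using W by (auto simp: restr_def fun_eq_iff)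
  then have "\<xi> W (restr W f) = restr W (\<xi> U (restr U f))"
    using vf_restr_U[OF U \<xi> W f_hol_restr[OF U]] by simp
  then show "vf_graph f W \<xi> (restr_seq W u) j p = restr_seq W (vf_graph f U \<xi> u) j p"
    using vf_restrict[OF U \<xi> W nv_seqsD[OF u]]
    unfolding vf_graph_def shift_restr_seq by (simp add: restr_seq_def) (simp add: restr_def)
qed

lemma vf_graph_bounded:
  assumes "u \<in> nv_seqs U" "bounded_seq u" shows "bounded_seq (vf_graph f U \<xi> u)"
proof -
  obtain N where N: "\<forall>j\<ge>N. \<forall>p. u j p = 0" using assms by (auto simp: bounded_seq_def)
  then have "u j = (\<lambda>_. 0)" if "j \<ge> N" for j using that by auto
  then show ?thesis using N
    by (intro bounded_seqI[of "Suc N"]) (auto simp: vf_graph_def shift_def vf_zero[OF U \<xi>])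
qed

end

section \<open>\<open>\<D>\<^sub>X[s]\<close> as operators on the graph module\<close>

text \<open>The algebra \<open>V\<^sup>0\<D>\<close> without \<open>t\<close>.  Since \<open>t f\<^sup>s\<^sup>+\<^sup>i = f f\<^sup>s\<^sup>+\<^sup>i\<close>, it generates the same submodule from \<open>f\<^sup>s\<^sup>+\<^sup>i\<close> as
\<open>V\<^sup>0\<D>\<close>.\<close>

definition graph_D_s :: "'n point set \<Rightarrow> ('n seq \<Rightarrow> 'n seq) set" where
  "graph_D_s U = generated_algebra (mult_op ` hol U \<union> vf_graph f U ` vector_fields X U \<union> {s_op f})"

lemma graph_D_s_mult: "h \<in> hol U \<Longrightarrow> mult_op h \<in> graph_D_s U"
  and graph_D_s_vf: "\<xi> \<in> vector_fields X U \<Longrightarrow> vf_graph f U \<xi> \<in> graph_D_s U"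
  and graph_D_s_s_op: "s_op f \<in> graph_D_s U"
  and graph_D_s_add: "P \<in> graph_D_s U \<Longrightarrow> Q \<in> graph_D_s U \<Longrightarrow> (\<lambda>u j p. P u j p + Q u j p) \<in> graph_D_s U"
  and graph_D_s_comp: "P \<in> graph_D_s U \<Longrightarrow> Q \<in> graph_D_s U \<Longrightarrow> P \<circ> Q \<in> graph_D_s U"
  unfolding graph_D_s_def by (auto intro: generated_algebra.intros)

lemma graph_D_s_const: "open_in X U \<Longrightarrow> mult_op (restr U (\<lambda>_. c)) \<in> graph_D_s U"
  by (intro graph_D_s_mult hol_const open_in_proj)

lemma mult_op_const: "u \<in> nv_seqs U \<Longrightarrow> mult_op (restr U (\<lambda>_. c)) u = (\<lambda>j p. c * u j p)"
  using nv_seqs_outside by (fastforce simp: mult_op_def restr_def nonvan_def fun_eq_iff)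

lemma mult_op_const_restr: "mult_op (restr U (\<lambda>_. c)) (restr_seq U u) = (\<lambda>j p. c * restr_seq U u j p)"
  by (auto simp: mult_op_def restr_def restr_seq_apply fun_eq_iff)

lemma graph_D_s_subset_V0_D: "P \<in> graph_D_s U \<Longrightarrow> P \<in> V0_D X f U"
  unfolding graph_D_s_def V0_D_def by (erule generated_algebra_mono) (auto intro: generated_algebra.gen)

definition fin_seqs :: "'n point set \<Rightarrow> 'n seq set" where
  "fin_seqs U = {u \<in> nv_seqs U. bounded_seq u}"

lemma fin_seqs_add: "u \<in> fin_seqs U \<Longrightarrow> v \<in> fin_seqs U \<Longrightarrow> (\<lambda>j p. u j p + v j p) \<in> fin_seqs U"
  by (auto simp: fin_seqs_def nv_seqs_add bounded_seq_add)

lemma fin_seqs_mult: "open_in X U \<Longrightarrow> h \<in> hol U \<Longrightarrow> u \<in> fin_seqs U \<Longrightarrow> mult_op h u \<in> fin_seqs U"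
  by (auto simp: fin_seqs_def mult_op_def nv_seqs_mult bounded_seq_scale)

lemma fin_seqs_s_op: "open_in X U \<Longrightarrow> u \<in> fin_seqs U \<Longrightarrow> s_op f u \<in> fin_seqs U"
  by (auto simp: fin_seqs_def nv_seqs_s_op bounded_seq_s_op)

lemma fin_seqs_s_act: "open_in X U \<Longrightarrow> u \<in> fin_seqs U \<Longrightarrow> s_act f q u \<in> fin_seqs U"
  by (auto simp: fin_seqs_def nv_seqs_s_act bounded_seq_s_act)

lemma fin_seqs_vf_graph: "open_in X U \<Longrightarrow> \<xi> \<in> vector_fields X U \<Longrightarrow> u \<in> fin_seqs U \<Longrightarrow> vf_graph f U \<xi> u \<in> fin_seqs U"
  by (auto simp: fin_seqs_def vf_graph_nv_seqs vf_graph_bounded)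

lemma fin_seqs_restr:
  "open_in X U \<Longrightarrow> open_in X W \<Longrightarrow> W \<subseteq> U \<Longrightarrow> u \<in> fin_seqs U \<Longrightarrow> restr_seq W u \<in> fin_seqs W"
  by (auto simp: fin_seqs_def nv_seqs_restr bounded_seq_restr_seq)

lemma fin_seqs_t_op_inj: "t_op f u = t_op f v \<Longrightarrow> u \<in> fin_seqs U \<Longrightarrow> v \<in> fin_seqs U \<Longrightarrow> u = v"
  by (rule t_op_inj) (auto simp: fin_seqs_def intro: nv_seqs_outside simp: nonvan_def)

lemma graph_D_s_generator_cases:
  assumes "P \<in> mult_op ` hol U \<union> vf_graph f U ` vector_fields X U \<union> {s_op f}"
  obtains (mult) h where "h \<in> hol U" "P = mult_op h"
  | (vf) \<xi> where "\<xi> \<in> vector_fields X U" "P = vf_graph f U \<xi>"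
  | (s) "P = s_op f"
  using assms by blast

lemma nv_seqs_mult_op: "open_in X U \<Longrightarrow> h \<in> hol U \<Longrightarrow> u \<in> nv_seqs U \<Longrightarrow> mult_op h u \<in> nv_seqs U"
  unfolding mult_op_def by (rule nv_seqs_mult)

lemma restr_seq_mult_op: "restr_seq W (mult_op h u) = mult_op (restr W h) (restr_seq W u)"
  by (auto simp: mult_op_def restr_seq_apply restr_def fun_eq_iff)

lemma graph_D_s_push:
  assumes "P \<in> graph_D_s U"
    and "\<And>u v. u \<in> S \<Longrightarrow> v \<in> S \<Longrightarrow> (\<lambda>j p. u j p + v j p) \<in> S"
    and "\<And>u v. u \<in> S \<Longrightarrow> v \<in> S \<Longrightarrow> \<phi> (\<lambda>j p. u j p + v j p) = (\<lambda>j p. \<phi> u j p + \<phi> v j p)"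
    and "\<And>P. P \<in> mult_op ` hol U \<union> vf_graph f U ` vector_fields X U \<union> {s_op f} \<Longrightarrow>
      \<exists>P'\<in>graph_D_s W. \<forall>u\<in>S. P u \<in> S \<and> \<phi> (P u) = P' (\<phi> u)"
  shows "\<exists>P'\<in>graph_D_s W. \<forall>u\<in>S. P u \<in> S \<and> \<phi> (P u) = P' (\<phi> u)"
  using assms unfolding graph_D_s_def by (rule generated_algebra_push)

lemma graph_D_s_pull:
  assumes "P \<in> graph_D_s U"
    and "\<And>u v. u \<in> S \<Longrightarrow> v \<in> S \<Longrightarrow> (\<lambda>j p. u j p + v j p) \<in> S"
    and "\<And>u v. u \<in> S \<Longrightarrow> v \<in> S \<Longrightarrow> \<phi> (\<lambda>j p. u j p + v j p) = (\<lambda>j p. \<phi> u j p + \<phi> v j p)"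
    and "\<And>P. P \<in> mult_op ` hol U \<union> vf_graph f U ` vector_fields X U \<union> {s_op f} \<Longrightarrow>
      \<exists>P'\<in>graph_D_s W. \<forall>u\<in>S. P' u \<in> S \<and> \<phi> (P' u) = P (\<phi> u)"
  shows "\<exists>P'\<in>graph_D_s W. \<forall>u\<in>S. P' u \<in> S \<and> \<phi> (P' u) = P (\<phi> u)"
  using assms unfolding graph_D_s_def by (rule generated_algebra_pull)

lemma graph_D_s_restrict:
  assumes U: "open_in X U" and W: "open_in X W" "W \<subseteq> U" and P: "P \<in> graph_D_s U"
  shows "\<exists>P'\<in>graph_D_s W. \<forall>u\<in>nv_seqs U. P u \<in> nv_seqs U \<and> restr_seq W (P u) = P' (restr_seq W u)"
proof (rule graph_D_s_push[OF P], goal_cases)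
  case (3 P)
  then show ?case
  proof (cases rule: graph_D_s_generator_cases)
    case (mult h)
    then show ?thesis
      by (intro bexI[OF _ graph_D_s_mult[OF hol_restr[OF mult(1) W(2) open_in_proj[OF U]]]])
        (auto simp: nv_seqs_mult_op U restr_seq_mult_op)
  next
    case (vf \<xi>)
    have "\<xi> \<in> vector_fields X W" using vf vector_fields_restrict[OF U _ W(2)] by blast
    then show ?thesis
      using vf_graph_nv_seqs[OF U vf(1)] vf_graph_restr[OF U vf(1) W] vf(2)
      by (intro bexI[OF _ graph_D_s_vf]) auto
  next
    case s
    then show ?thesis
      by (intro bexI[OF _ graph_D_s_s_op]) (auto simp: nv_seqs_s_op U s_op_restr_seq)
  qed
qed (auto simp: nv_seqs_add restr_seq_apply fun_eq_iff)

lemma t_op_mult_op: "t_op f (mult_op h u) = mult_op h (t_op f u)"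
  unfolding mult_op_def by (rule t_op_scale)

lemma s_act_mult_op: "s_act f q (mult_op h u) = mult_op h (s_act f q u)"
  unfolding mult_op_def by (rule s_act_scale)

text \<open>Conjugation by \<open>t\<close> fixes functions and vector fields and replaces \<open>s\<close> by \<open>s + 1\<close>.\<close>

lemma graph_D_s_t_push:
  assumes U: "open_in X U" and P: "P \<in> graph_D_s U"
  shows "\<exists>P'\<in>graph_D_s U. \<forall>u\<in>nv_seqs U. P u \<in> nv_seqs U \<and> t_op f (P u) = P' (t_op f u)"
proof (rule graph_D_s_push[OF P], goal_cases)
  case (3 P)
  then show ?case
  proof (cases rule: graph_D_s_generator_cases)
    case (mult h)
    then show ?thesis
      by (intro bexI[OF _ graph_D_s_mult[OF mult(1)]]) (auto simp: nv_seqs_mult_op U t_op_mult_op)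
  next
    case (vf \<xi>)
    then show ?thesis
      by (intro bexI[OF _ graph_D_s_vf[OF vf(1)]]) (auto simp: vf_graph_nv_seqs U vf_graph_t_op)
  next
    case s
    have "(\<lambda>u j p. s_op f u j p + mult_op (restr U (\<lambda>_. 1)) u j p) \<in> graph_D_s U"
      by (intro graph_D_s_add graph_D_s_s_op graph_D_s_const U)
    then show ?thesis
      by (rule rev_bexI) (simp add: s nv_seqs_s_op U t_op_s_op mult_op_const nv_seqs_t_op)
  qed
qed (auto simp: nv_seqs_add t_op_add)

text \<open>The inverse conjugation, replacing \<open>s\<close> by \<open>s - 1\<close>.  Bounded sequences are kept because \<open>t\<close> has to be
cancelled later.\<close>

lemma graph_D_s_t_pull:
  assumes U: "open_in X U" and P: "P \<in> graph_D_s U"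
  shows "\<exists>P'\<in>graph_D_s U. \<forall>u\<in>fin_seqs U. P' u \<in> fin_seqs U \<and> t_op f (P' u) = P (t_op f u)"
proof (rule graph_D_s_pull[OF P], goal_cases)
  case (3 P)
  then show ?case
  proof (cases rule: graph_D_s_generator_cases)
    case (mult h)
    then show ?thesis
      by (intro bexI[OF _ graph_D_s_mult[OF mult(1)]]) (auto simp: fin_seqs_mult U t_op_mult_op)
  next
    case (vf \<xi>)
    then show ?thesis
      using fin_seqs_vf_graph[OF U vf(1)]
      by (intro bexI[OF _ graph_D_s_vf[OF vf(1)]]) (auto simp: vf_graph_t_op U fin_seqs_def)
  next
    case s
    let ?P' = "\<lambda>u j p. s_op f u j p + mult_op (restr U (\<lambda>_. - 1)) u j p"
    have "?P' \<in> graph_D_s U"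
      by (intro graph_D_s_add graph_D_s_s_op graph_D_s_const U)
    moreover have "?P' u \<in> fin_seqs U \<and> t_op f (?P' u) = s_op f (t_op f u)" if u: "u \<in> fin_seqs U" for u
    proof
      show "?P' u \<in> fin_seqs U"
        by (intro fin_seqs_add fin_seqs_s_op fin_seqs_mult hol_const open_in_proj U u)
      show "t_op f (?P' u) = s_op f (t_op f u)"
        using u unfolding t_op_add
        by (simp add: fin_seqs_def mult_op_const t_op_s_op t_op_scale[of f "\<lambda>_. - 1", simplified])
    qed
    ultimately show ?thesis unfolding s by (intro bexI[of _ ?P'] ballI)
  qed
qed (auto simp: fin_seqs_add t_op_add)

lemma vf_graph_s_act:
  assumes U: "open_in X U" and \<xi>: "\<xi> \<in> vector_fields X U" and u: "u \<in> nv_seqs U"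
  shows "vf_graph f U \<xi> (s_act f q u) = s_act f q (vf_graph f U \<xi> u)"
proof (induction q)
  case 0
  show ?case
    using vf_graph_scale[OF U \<xi> u, of 0] by simp
next
  case (pCons a q)
  then show ?case
    by (simp add: s_act_pCons vf_graph_add[OF U \<xi>] nv_seqs_scale nv_seqs_s_op nv_seqs_s_act U u
      vf_graph_scale[OF U \<xi>] vf_graph_s_op[OF U \<xi>])
qed

lemma graph_D_s_s_act_push:
  assumes U: "open_in X U" and P: "P \<in> graph_D_s U"
  shows "\<exists>P'\<in>graph_D_s U. \<forall>u\<in>nv_seqs U. P u \<in> nv_seqs U \<and> s_act f q (P u) = P' (s_act f q u)"
proof (rule graph_D_s_push[OF P], goal_cases)
  case (3 P)
  then show ?case
  proof (cases rule: graph_D_s_generator_cases)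
    case (mult h)
    then show ?thesis
      by (intro bexI[OF _ graph_D_s_mult[OF mult(1)]]) (auto simp: nv_seqs_mult_op U s_act_mult_op)
  next
    case (vf \<xi>)
    then show ?thesis
      using vf_graph_nv_seqs[OF U vf(1)] vf_graph_s_act[OF U vf(1)]
      by (intro bexI[OF _ graph_D_s_vf[OF vf(1)]]) auto
  next
    case s
    then show ?thesis
      by (intro bexI[OF _ graph_D_s_s_op]) (auto simp: nv_seqs_s_op U s_act_s_op)
  qed
qed (auto simp: nv_seqs_add s_act_plus_seq)

lemma graph_D_s_nv_seqs: "open_in X U \<Longrightarrow> P \<in> graph_D_s U \<Longrightarrow> u \<in> nv_seqs U \<Longrightarrow> P u \<in> nv_seqs U"
  using graph_D_s_t_push by blast

lemma s_act_in_graph_D_s: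
  assumes U: "open_in X U"
  shows "\<exists>P\<in>graph_D_s U. \<forall>u\<in>nv_seqs U. P u = s_act f q u"
proof (induction q)
  case 0
  show ?case by (intro bexI[OF _ graph_D_s_const[OF U, of 0]]) (auto simp: mult_op_const)
next
  case (pCons a q)
  then obtain P where P: "P \<in> graph_D_s U" "\<forall>u\<in>nv_seqs U. P u = s_act f q u" by auto
  have "(\<lambda>u j p. mult_op (restr U (\<lambda>_. a)) u j p + (s_op f \<circ> P) u j p) \<in> graph_D_s U"
    by (intro graph_D_s_add graph_D_s_comp graph_D_s_s_op graph_D_s_const P U)
  then show ?case by (rule rev_bexI) (simp add: P mult_op_const s_act_pCons)
qed

section \<open>The modules generated by \<open>f\<^sup>s\<^sup>+\<^sup>i\<close>\<close>

text \<open>\<open>f\<^sup>i \<otimes> 1\<close>, which corresponds to \<open>f\<^sup>s\<^sup>+\<^sup>i\<close>.\<close>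

definition fpow :: "int \<Rightarrow> 'n seq" where
  "fpow i = (\<lambda>j p. if j = 0 \<and> f p \<noteq> 0 then f p powi i else 0)"

lemma fpow_add: "fpow (i + int m) = (\<lambda>j p. f p ^ m * fpow i j p)"
  by (auto simp: fpow_def fun_eq_iff power_int_add)

lemma fpow_Suc: "fpow (i + 1) = (\<lambda>j p. f p * fpow i j p)"
  using fpow_add[of i 1] by simp

lemma t_op_fpow: "t_op f (fpow i) = fpow (i + 1)"
  by (auto simp: t_op_def fpow_def fun_eq_iff power_int_add)

lemma fpow_fin_seqs:
  assumes U: "open_in X U" shows "restr_seq U (fpow i) \<in> fin_seqs U"
proof -
  let ?O = "nonvan f U"
  have O: "?O \<subseteq> proj_space" using nonvan_proj[OF U] .
  have f: "restr ?O f \<in> hol ?O" using f_hol_restr open_nonvan U by blast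
  have pow: "restr ?O (\<lambda>p. g p ^ m) \<in> hol ?O" if "restr ?O g \<in> hol ?O" for g m
  proof (induction m)
    case (Suc m)
    then have "(\<lambda>p. restr ?O g p * restr ?O (\<lambda>p. g p ^ m) p) \<in> hol ?O" using that hol_mult by blast
    moreover have "(\<lambda>p. restr ?O g p * restr ?O (\<lambda>p. g p ^ m) p) = restr ?O (\<lambda>p. g p ^ Suc m)"
      by (auto simp: restr_def)
    ultimately show ?case by simp
  qed (use hol_const[OF O, of 1] in simp)
  have inv: "restr ?O (\<lambda>p. inverse (f p)) \<in> hol ?O"
  proof -
    have "(\<lambda>p. inverse (restr ?O f p)) \<in> hol ?O"
      by (intro hol_inverse f O) (auto simp: restr_def nonvan_def)
    moreover have "(\<lambda>p. inverse (restr ?O f p)) = restr ?O (\<lambda>p. inverse (f p))"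
      by (auto simp: restr_def)
    ultimately show ?thesis by simp
  qed
  have "restr ?O (\<lambda>p. f p powi i) \<in> hol ?O"
    using pow[OF f] pow[OF inv] by (cases "i \<ge> 0") (auto simp: power_int_def)
  moreover have "restr_seq U (fpow i) 0 = restr ?O (\<lambda>p. f p powi i)"
    by (auto simp: restr_seq_apply fpow_def restr_def nonvan_def fun_eq_iff)
  moreover have "restr_seq U (fpow i) (Suc j) = (\<lambda>_. 0)" for j
    by (auto simp: restr_seq_apply fpow_def fun_eq_iff)
  ultimately have "restr_seq U (fpow i) j \<in> hol ?O" for j
    by (cases j) (auto simp: hol_zero)
  then show ?thesis
    by (auto simp: fin_seqs_def nv_seqs_def restr_seq_apply fpow_def intro!: bounded_seqI[of 1])
qed

lemma fpow_nv_seqs: "open_in X U \<Longrightarrow> restr_seq U (fpow i) \<in> nv_seqs U"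
  using fpow_fin_seqs by (simp add: fin_seqs_def)

text \<open>Membership in the stalk at \<open>p\<close> of \<open>N\<^sub>i = \<D>\<^sub>X[s] f\<^sup>s\<^sup>+\<^sup>i\<close>; away from \<open>p\<close> the sequence is arbitrary.\<close>

definition N_germ :: "'n point \<Rightarrow> int \<Rightarrow> 'n seq \<Rightarrow> bool" where
  "N_germ p i u \<longleftrightarrow> (\<exists>W. open_in X W \<and> p \<in> W \<and> (\<exists>P\<in>graph_D_s W. restr_seq W u = P (restr_seq W (fpow i))))"

text \<open>Operators restrict to smaller open sets, so the relation to \<open>f\<^sup>s\<^sup>+\<^sup>i\<close> is available on every smaller
neighbourhood.\<close>

lemma N_germE:
  assumes "N_germ p i u"
  obtains W where "open_in X W" "p \<in> W"
    "\<And>W'. open_in X W' \<Longrightarrow> W' \<subseteq> W \<Longrightarrow> \<exists>P\<in>graph_D_s W'. restr_seq W' u = P (restr_seq W' (fpow i))"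
proof -
  obtain W P where W: "open_in X W" "p \<in> W" "P \<in> graph_D_s W" "restr_seq W u = P (restr_seq W (fpow i))"
    using assms by (auto simp: N_germ_def)
  have "\<exists>P\<in>graph_D_s W'. restr_seq W' u = P (restr_seq W' (fpow i))" if W': "open_in X W'" "W' \<subseteq> W" for W'
  proof -
    obtain P' where P': "P' \<in> graph_D_s W'" "\<forall>u\<in>nv_seqs W. P u \<in> nv_seqs W \<and> restr_seq W' (P u) = P' (restr_seq W' u)"
      using graph_D_s_restrict[OF W(1) W' W(3)] by blast
    have "restr_seq W' (restr_seq W v) = restr_seq W' v" for v
      using W' by (simp add: restr_seq_restr_seq Int_absorb2)
    then show ?thesis using P' W fpow_nv_seqs[OF W(1)] by metis
  qed
  then show ?thesis using that W by blast
qed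

lemma N_germ_local:
  assumes "N_germ p i u" "open_in X W" "p \<in> W" "restr_seq W v = restr_seq W u" shows "N_germ p i v"
proof -
  obtain W1 where W1: "open_in X W1" "p \<in> W1"
    "\<And>W'. open_in X W' \<Longrightarrow> W' \<subseteq> W1 \<Longrightarrow> \<exists>P\<in>graph_D_s W'. restr_seq W' u = P (restr_seq W' (fpow i))"
    using N_germE[OF assms(1)] by blast
  have "restr_seq (W1 \<inter> W) v = restr_seq W1 (restr_seq W v)"
    by (auto simp: restr_seq_restr_seq)
  also have "\<dots> = restr_seq (W1 \<inter> W) u"
    unfolding assms(4) by (auto simp: restr_seq_restr_seq)
  finally show ?thesis
    unfolding N_germ_def using W1(3)[of "W1 \<inter> W"] open_in_Int[OF W1(1) assms(2)] W1(2) assms(3) by force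
qed

lemma N_germ_self:
  assumes "p \<in> X" shows "N_germ p i (fpow i)"
proof -
  have X: "open_in X X" using open_in_self[OF X_proj] .
  have "restr_seq X (fpow i) = mult_op (restr X (\<lambda>_. 1)) (restr_seq X (fpow i))"
    unfolding mult_op_const_restr by simp
  then show ?thesis unfolding N_germ_def using X assms graph_D_s_const[OF X] by blast
qed

lemma N_germ_add:
  assumes "N_germ p i u" "N_germ p i v" shows "N_germ p i (\<lambda>j p. u j p + v j p)"
proof -
  obtain W1 where W1: "open_in X W1" "p \<in> W1"
    "\<And>W'. open_in X W' \<Longrightarrow> W' \<subseteq> W1 \<Longrightarrow> \<exists>P\<in>graph_D_s W'. restr_seq W' u = P (restr_seq W' (fpow i))"
    using N_germE[OF assms(1)] by blast
  obtain W2 where W2: "open_in X W2" "p \<in> W2"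
    "\<And>W'. open_in X W' \<Longrightarrow> W' \<subseteq> W2 \<Longrightarrow> \<exists>P\<in>graph_D_s W'. restr_seq W' v = P (restr_seq W' (fpow i))"
    using N_germE[OF assms(2)] by blast
  let ?W = "W1 \<inter> W2"
  have W: "open_in X ?W" "p \<in> ?W" using open_in_Int W1 W2 by auto
  obtain P Q where "P \<in> graph_D_s ?W" "restr_seq ?W u = P (restr_seq ?W (fpow i))"
    "Q \<in> graph_D_s ?W" "restr_seq ?W v = Q (restr_seq ?W (fpow i))"
    using W1(3)[of ?W] W2(3)[of ?W] W by blast
  moreover have "restr_seq ?W (\<lambda>j p. u j p + v j p) = (\<lambda>j p. restr_seq ?W u j p + restr_seq ?W v j p)"
    by (auto simp: restr_seq_apply fun_eq_iff)
  ultimately show ?thesis unfolding N_germ_def using W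
    by (intro exI[of _ ?W] conjI bexI[OF _ graph_D_s_add[of P _ Q]]) auto
qed

lemma N_germ_graph_D_s:
  assumes u: "N_germ p i u" and U: "open_in X U" "p \<in> U" and uU: "restr_seq U u \<in> nv_seqs U" and P: "P \<in> graph_D_s U"
    and v: "restr_seq U v = P (restr_seq U u)"
  shows "N_germ p i v"
proof -
  obtain W1 where W1: "open_in X W1" "p \<in> W1"
    "\<And>W'. open_in X W' \<Longrightarrow> W' \<subseteq> W1 \<Longrightarrow> \<exists>P\<in>graph_D_s W'. restr_seq W' u = P (restr_seq W' (fpow i))"
    using N_germE[OF u] by blast
  let ?W = "W1 \<inter> U"
  have W: "open_in X ?W" "p \<in> ?W" "?W \<subseteq> U" using open_in_Int W1 U by auto
  obtain Q where Q: "Q \<in> graph_D_s ?W" "restr_seq ?W u = Q (restr_seq ?W (fpow i))"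
    using W1(3)[of ?W] W by blast
  obtain P' where P': "P' \<in> graph_D_s ?W" "\<forall>u\<in>nv_seqs U. P u \<in> nv_seqs U \<and> restr_seq ?W (P u) = P' (restr_seq ?W u)"
    using graph_D_s_restrict[OF U(1) W(1,3) P] by blast
  have r: "restr_seq ?W (restr_seq U w) = restr_seq ?W w" for w
    by (simp add: restr_seq_restr_seq)
  have "restr_seq ?W v = restr_seq ?W (P (restr_seq U u))" by (metis v r)
  also have "\<dots> = (P' \<circ> Q) (restr_seq ?W (fpow i))" using P'(2) uU Q(2) by (simp add: r)
  finally show ?thesis unfolding N_germ_def using W graph_D_s_comp[OF P'(1) Q(1)] by blast
qed

lemma N_germ_nv_seqs:
  assumes "N_germ p i u"
  obtains W where "open_in X W" "p \<in> W" "restr_seq W u \<in> nv_seqs W"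
proof -
  obtain W P where W: "open_in X W" "p \<in> W" "P \<in> graph_D_s W" "restr_seq W u = P (restr_seq W (fpow i))"
    using assms by (auto simp: N_germ_def)
  then show ?thesis using that graph_D_s_nv_seqs[OF W(1,3) fpow_nv_seqs[OF W(1)]] by metis
qed

lemma N_germ_s_act:
  assumes "N_germ p i u" shows "N_germ p i (s_act f q u)"
proof -
  obtain W where W: "open_in X W" "p \<in> W" "restr_seq W u \<in> nv_seqs W" using N_germ_nv_seqs[OF assms] .
  obtain P where P: "P \<in> graph_D_s W" "\<forall>u\<in>nv_seqs W. P u = s_act f q u" using s_act_in_graph_D_s[OF W(1)] by blast
  then show ?thesis using W by (intro N_germ_graph_D_s[OF assms W P(1)]) (auto simp: s_act_restr_seq)
qed

lemma N_germ_mult: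
  assumes "N_germ p i u" "open_in X U" "p \<in> U" "h \<in> hol U" shows "N_germ p i (\<lambda>j p. h p * u j p)"
proof -
  obtain W where W: "open_in X W" "p \<in> W" "restr_seq W u \<in> nv_seqs W" using N_germ_nv_seqs[OF assms(1)] .
  let ?W = "W \<inter> U"
  have W': "open_in X ?W" "p \<in> ?W" using W assms open_in_Int by auto
  have "restr_seq ?W (restr_seq W u) \<in> nv_seqs ?W" using nv_seqs_restr[OF W(1) W'(1)] W by blast
  then have "restr_seq ?W u \<in> nv_seqs ?W" by (simp add: restr_seq_restr_seq Int_ac)
  moreover have "restr ?W h \<in> hol ?W" using hol_restr[OF assms(4)] open_in_proj[OF assms(2)] by blast
  ultimately show ?thesis
    by (intro N_germ_graph_D_s[OF assms(1) W' _ graph_D_s_mult]) (auto simp: mult_op_def restr_seq_apply restr_def fun_eq_iff)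
qed

lemma N_germ_zero: "p \<in> X \<Longrightarrow> N_germ p i (\<lambda>_ _. 0)"
  using N_germ_s_act[OF N_germ_self, of p i 0] by simp

text \<open>Polynomials in \<open>s\<close> are central in \<open>\<D>\<^sub>X[s]\<close>, so it is enough to know where \<open>q(s)\<close> carries the generator.\<close>

lemma N_germ_poly:
  assumes u: "N_germ p i u" and q: "N_germ p k (s_act f q (fpow i))"
  shows "N_germ p k (s_act f q u)"
proof -
  obtain W P where W: "open_in X W" "p \<in> W" "P \<in> graph_D_s W" "restr_seq W u = P (restr_seq W (fpow i))"
    using u by (auto simp: N_germ_def)
  obtain P' where P': "P' \<in> graph_D_s W" "\<forall>u\<in>nv_seqs W. P u \<in> nv_seqs W \<and> s_act f q (P u) = P' (s_act f q u)"
    using graph_D_s_s_act_push[OF W(1,3)] by blast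
  have "restr_seq W (s_act f q u) = P' (restr_seq W (s_act f q (fpow i)))"
    using P' W(4) fpow_nv_seqs[OF W(1)] by (simp flip: s_act_restr_seq)
  moreover have "restr_seq W (s_act f q (fpow i)) \<in> nv_seqs W"
    using nv_seqs_s_act[OF W(1) fpow_nv_seqs[OF W(1)]] by (simp flip: s_act_restr_seq)
  ultimately show ?thesis using N_germ_graph_D_s[OF q W(1,2) _ P'(1)] by simp
qed

lemma N_germ_lower:
  assumes u: "N_germ p i u" and "k \<le> i" and p: "p \<in> X" shows "N_germ p k u"
proof -
  have "N_germ p k (fpow i)" using \<open>k \<le> i\<close>
  proof (induction i rule: int_ge_induct)
    case base
    show ?case using p by (rule N_germ_self)
  next
    case (step i)
    then show ?case unfolding fpow_Suc
      by (intro N_germ_mult[OF _ open_in_self[OF X_proj] p f_hol])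
  qed
  then show ?thesis using N_germ_poly[OF u, of k 1] by simp
qed

lemma N_germ_t_op:
  assumes u: "N_germ p i u" shows "N_germ p (i + 1) (t_op f u)"
proof -
  obtain W P where W: "open_in X W" "p \<in> W" "P \<in> graph_D_s W" "restr_seq W u = P (restr_seq W (fpow i))"
    using u by (auto simp: N_germ_def)
  obtain P' where P': "P' \<in> graph_D_s W" "\<forall>u\<in>nv_seqs W. P u \<in> nv_seqs W \<and> t_op f (P u) = P' (t_op f u)"
    using graph_D_s_t_push[OF W(1,3)] by blast
  have "restr_seq W (t_op f u) = P' (restr_seq W (fpow (i + 1)))"
    using P' W(4) fpow_nv_seqs[OF W(1)] by (simp flip: t_op_restr_seq t_op_fpow)
  then show ?thesis unfolding N_germ_def using W P' by blast
qed

text \<open>If \<open>t u = P f\<^sup>s\<^sup>+\<^sup>i\<^sup>+\<^sup>1 = P t f\<^sup>s\<^sup>+\<^sup>i\<close>, then moving \<open>P\<close> past \<open>t\<close> and cancelling \<open>t\<close> expresses \<open>u\<close> by \<open>f\<^sup>s\<^sup>+\<^sup>i\<close>.\<close>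

lemma N_germ_t_op_cancel:
  assumes u: "N_germ p (i + 1) (t_op f u)" and U: "open_in X U" "p \<in> U" "restr_seq U u \<in> fin_seqs U"
  shows "N_germ p i u"
proof -
  obtain W1 where W1: "open_in X W1" "p \<in> W1"
    "\<And>W'. open_in X W' \<Longrightarrow> W' \<subseteq> W1 \<Longrightarrow> \<exists>P\<in>graph_D_s W'. restr_seq W' (t_op f u) = P (restr_seq W' (fpow (i + 1)))"
    using N_germE[OF u] by blast
  let ?W = "W1 \<inter> U"
  have W: "open_in X ?W" "p \<in> ?W" using open_in_Int W1 U by auto
  obtain P where P: "P \<in> graph_D_s ?W" "restr_seq ?W (t_op f u) = P (restr_seq ?W (fpow (i + 1)))"
    using W1(3)[of ?W] W by blast
  obtain P' where P': "P' \<in> graph_D_s ?W" "\<forall>u\<in>fin_seqs ?W. P' u \<in> fin_seqs ?W \<and> t_op f (P' u) = P (t_op f u)"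
    using graph_D_s_t_pull[OF W(1) P(1)] by blast
  have "restr_seq ?W (restr_seq U u) \<in> fin_seqs ?W" using fin_seqs_restr[OF U(1) W(1)] U by blast
  then have "restr_seq ?W u \<in> fin_seqs ?W" by (simp add: restr_seq_restr_seq Int_ac)
  moreover have "t_op f (restr_seq ?W u) = t_op f (P' (restr_seq ?W (fpow i)))"
    using P P' fpow_fin_seqs[OF W(1)] by (simp add: t_op_restr_seq t_op_fpow)
  ultimately have "restr_seq ?W u = P' (restr_seq ?W (fpow i))"
    using P' fpow_fin_seqs[OF W(1)] fin_seqs_t_op_inj by blast
  then show ?thesis unfolding N_germ_def using W P' by blast
qed

lemma N_germ_shift_up:
  assumes "N_germ p k (s_act f q (fpow i))"
  shows "N_germ p (k + int l) (s_act f (pcompose q [:of_nat l, 1:]) (fpow (i + int l)))"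
proof (induction l)
  case 0
  show ?case using assms by (simp add: pcompose_idR)
next
  case (Suc l)
  have "N_germ p (k + int l + 1) (s_act f (pcompose (pcompose q [:of_nat l, 1:]) [:1, 1:]) (fpow (i + int l + 1)))"
    using N_germ_t_op[OF Suc] unfolding t_op_s_act t_op_fpow .
  moreover have "pcompose (pcompose q [:of_nat l, 1:]) [:1, 1:] = pcompose q [:of_nat (Suc l), 1:]"
    unfolding pcompose_assoc[symmetric] by (simp add: pcompose_pCons add.commute)
  ultimately show ?case by (simp add: algebra_simps)
qed

lemma N_germ_shift_down:
  assumes "N_germ p k (s_act f q (fpow i))" and p: "p \<in> X"
  shows "N_germ p (k - int l) (s_act f (pcompose q [:- of_nat l, 1:]) (fpow (i - int l)))"
proof (induction l)
  case 0
  show ?case using assms by (simp add: pcompose_idR)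
next
  case (Suc l)
  let ?q = "pcompose (pcompose q [:- of_nat l, 1:]) [:-1, 1:]"
  have q: "pcompose ?q [:1, 1:] = pcompose q [:- of_nat l, 1:]"
    unfolding pcompose_assoc[symmetric] by (simp add: pcompose_pCons pcompose_idR)
  have q': "?q = pcompose q [:- of_nat (Suc l), 1:]"
    unfolding pcompose_assoc[symmetric] by (simp add: pcompose_pCons add.commute)
  let ?u = "s_act f ?q (fpow (i - int l - 1))"
  have "t_op f ?u = s_act f (pcompose q [:- of_nat l, 1:]) (fpow (i - int l))"
    unfolding t_op_s_act t_op_fpow q by simp
  moreover have X: "open_in X X" using open_in_self[OF X_proj] .
  moreover have "restr_seq X ?u \<in> fin_seqs X"
    using fin_seqs_s_act[OF X fpow_fin_seqs[OF X]] by (simp flip: s_act_restr_seq)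
  ultimately have "N_germ p (k - int l - 1) ?u"
    using Suc p N_germ_t_op_cancel[of p "k - int l - 1" ?u X] by simp
  then show ?case unfolding q' by (simp add: algebra_simps)
qed

text \<open>Conjugation by \<open>t\<^sup>l\<close> for \<open>l \<in> \<int>\<close>; for negative \<open>l\<close> this uses that \<open>t\<close> can be cancelled.\<close>

lemma N_germ_shift:
  assumes "N_germ p k (s_act f q (fpow i))" and p: "p \<in> X"
  shows "N_germ p (k + l) (s_act f (pcompose q [:of_int l, 1:]) (fpow (i + l)))"
proof (cases "l \<ge> 0")
  case True
  then show ?thesis using N_germ_shift_up[OF assms(1), of "nat l"] by simp
next
  case False
  then show ?thesis using N_germ_shift_down[OF assms, of "nat (- l)"] by simp
qed

text \<open>The \<open>N\<^sub>i\<close> are stable under \<open>t\<close> as well, since they decrease.  This is what makes a coherent \<open>V\<^sup>0\<D>\<close>-module lie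
in \<open>N\<^sub>i\<close> once its generators do.\<close>

lemma N_germ_V0_D:
  assumes "P \<in> V0_D X f U" and U: "open_in X U" "p \<in> U"
  shows "u \<in> nv_seqs U \<Longrightarrow> N_germ p i u \<Longrightarrow> P u \<in> nv_seqs U \<and> N_germ p i (P u)"
  using assms(1) unfolding V0_D_def
proof (induction arbitrary: u)
  case (gen P)
  have p: "p \<in> X" using open_in_subset U by blast
  show ?case
  proof (cases "P = t_op f")
    case True
    then show ?thesis
      using N_germ_lower[OF N_germ_t_op[OF gen(3)], of i] p nv_seqs_t_op[OF U(1) gen(2)] by simp
  next
    case False
    then have P: "P \<in> graph_D_s U" using gen(1) by (auto intro: graph_D_s_mult graph_D_s_vf graph_D_s_s_op)
    have Pu: "P u \<in> nv_seqs U" using graph_D_s_nv_seqs[OF U(1) P gen(2)] .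
    have r: "restr_seq U v = v" if "v \<in> nv_seqs U" for v
      using nv_seqs_outside[OF that] by (auto simp: restr_seq_apply fun_eq_iff nonvan_def)
    show ?thesis using N_germ_graph_D_s[OF gen(3) U _ P, of "P u"] gen(2) Pu by (simp add: r)
  qed
next
  case (add P Q)
  then show ?case by (simp add: nv_seqs_add N_germ_add)
next
  case (comp P Q)
  then show ?case by simp
qed

end

section \<open>Bernstein-Sato polynomials and the graph module\<close>

text \<open>The hypotheses say that the polynomials admitting a functional equation form a nonzero ideal of the
principal ideal domain \<open>\<complex>[s]\<close>; the Bernstein-Sato polynomial is its monic generator.\<close>

lemma bernstein_sato_generates:
  assumes add: "\<And>b c. bs_equation X g b \<Longrightarrow> bs_equation X g c \<Longrightarrow> bs_equation X g (b + c)"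
    and mult: "\<And>b q. bs_equation X g b \<Longrightarrow> bs_equation X g (q * b)"
    and nz: "bs_equation X g c0" "c0 \<noteq> 0"
  shows "lead_coeff (bernstein_sato X g) = 1" "bs_equation X g (bernstein_sato X g)"
    and "\<And>c. bs_equation X g c \<Longrightarrow> bernstein_sato X g dvd c"
proof -
  define S where "S = {b. bs_equation X g b \<and> b \<noteq> 0}"
  obtain m0 where m0: "m0 \<in> S" "\<And>c. c \<in> S \<Longrightarrow> degree m0 \<le> degree c"
    using ex_has_least_nat[of "\<lambda>b. b \<in> S" c0 degree] nz by (auto simp: S_def)
  define m where "m = Polynomial.smult (inverse (lead_coeff m0)) m0"
  have m: "bs_equation X g m" "lead_coeff m = 1" "degree m = degree m0" "m \<noteq> 0"
    using m0(1) mult[of m0 "[:inverse (lead_coeff m0):]"] by (auto simp: m_def S_def)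
  have dvd: "m dvd c" if "bs_equation X g c" for c
  proof -
    have eq: "c mod m = c + (- (c div m)) * m" by (simp add: minus_div_mult_eq_mod[symmetric])
    have "bs_equation X g (c mod m)" unfolding eq by (rule add[OF that mult[OF m(1)]])
    moreover have "c mod m = 0 \<or> degree (c mod m) < degree m" using degree_mod_less[OF m(4)] .
    ultimately have "c mod m = 0" using m0(2)[of "c mod m"] m(3) by (force simp: S_def)
    then show ?thesis by auto
  qed
  have "degree m \<le> degree c" if "lead_coeff c = 1" "bs_equation X g c" for c
    using dvd[OF that(2)] that(1) by (intro dvd_imp_degree_le) auto
  then have is_m: "is_bernstein_sato X g m" using m by (simp add: is_bernstein_sato_def)
  have "b = m" if b: "is_bernstein_sato X g b" for b
  proof -
    have bm: "lead_coeff b = 1" "bs_equation X g b" "degree b \<le> degree m"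
      using b m(1,2) unfolding is_bernstein_sato_def by auto
    obtain r where r: "b = m * r" using dvd[OF bm(2)] by auto
    have "b \<noteq> 0" using bm(1) by auto
    then have "degree b = degree m + degree r" using r by (auto simp: degree_mult_eq)
    then have "degree r = 0" using bm(3) by simp
    then obtain a where a: "r = [:a:]" by (rule degree_eq_zeroE)
    have "lead_coeff b = lead_coeff m * lead_coeff r" unfolding r by (rule lead_coeff_mult)
    then have "lead_coeff r = 1" using bm(1) m(2) by simp
    then show ?thesis using a r by simp
  qed
  then have "(THE b. is_bernstein_sato X g b) = m" by (intro the_equality is_m)
  moreover have "\<exists>b. is_bernstein_sato X g b" using is_m ..
  ultimately have eq: "bernstein_sato X g = m" unfolding bernstein_sato_def by (simp only: if_True)
  show "lead_coeff (bernstein_sato X g) = 1" unfolding eq by (rule m(2))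
  show "bs_equation X g (bernstein_sato X g)" unfolding eq by (rule m(1))
  show "bernstein_sato X g dvd c" if "bs_equation X g c" for c unfolding eq using that by (rule dvd)
qed

lemma s_op_sum:
  "s_op f (\<lambda>i p. \<Sum>j<(N::nat). c j p * E j i p) = (\<lambda>i p. \<Sum>j<N. c j p * s_op f (E j) i p)"
  by (induction N) (auto simp: s_op_add s_op_scale s_op_eq shift_def fun_eq_iff)

lemma s_act_eq_sum:
  assumes "degree q < N"
  shows "s_act f q u i p = (\<Sum>j<N. coeff q j * (s_op f ^^ j) u i p)"
  using assms
proof (induction q arbitrary: i p N)
  case 0
  show ?case by simp
next
  case (pCons a q)
  have N: "N = Suc (N - 1)" using pCons.prems by simp
  show ?case
  proof (cases "q = 0")
    case True
    then have "s_act f (pCons a q) u i p = a * u i p"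
      by (simp add: s_act_pCons s_op_eq shift_def)
    moreover have "(\<Sum>j<Suc (N-1). coeff (pCons a q) j * (s_op f ^^ j) u i p) = a * u i p"
      unfolding sum.lessThan_Suc_shift using True by simp
    ultimately show ?thesis using N by simp
  next
    case False
    then have "degree q < N - 1" using pCons.prems by simp
    then have "s_act f q u = (\<lambda>i p. \<Sum>j<N - 1. coeff q j * (s_op f ^^ j) u i p)"
      using pCons.IH by (intro ext) blast
    then have "s_act f (pCons a q) u i p = a * u i p + (\<Sum>j<N - 1. coeff q j * (s_op f ^^ Suc j) u i p)"
      by (simp add: s_act_pCons s_op_sum)
    also have "\<dots> = (\<Sum>j<Suc (N-1). coeff (pCons a q) j * (s_op f ^^ j) u i p)"
      unfolding sum.lessThan_Suc_shift by simp
    finally show ?thesis using N by simp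
  qed
qed

context hypersurface begin

text \<open>\<open>s\<^sup>j f\<^sup>s\<close> in the graph module.\<close>

definition spow :: "nat \<Rightarrow> 'n seq" where
  "spow j = (s_op f ^^ j) (fpow 0)"

lemma spow_0: "spow 0 = fpow 0" and spow_Suc: "spow (Suc j) = s_op f (spow j)"
  by (simp_all add: spow_def)

lemma spow_above: "i > j \<Longrightarrow> spow j i p = 0"
proof (induction j arbitrary: i)
  case 0
  then show ?case by (simp add: spow_0 fpow_def)
next
  case (Suc j)
  then show ?case by (cases i) (auto simp: spow_Suc s_op_eq)
qed

lemma spow_diag: "f p \<noteq> 0 \<Longrightarrow> spow j j p = (- f p) ^ j"
  by (induction j) (auto simp: spow_0 fpow_def spow_Suc s_op_eq spow_above)

lemma spow_fin_seqs: "open_in X U \<Longrightarrow> restr_seq U (spow j) \<in> fin_seqs U"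
  by (induction j) (auto simp: spow_0 fpow_fin_seqs spow_Suc fin_seqs_s_op simp flip: s_op_restr_seq)

lemma spow_nv_seqs: "open_in X U \<Longrightarrow> restr_seq U (spow j) \<in> nv_seqs U"
  using spow_fin_seqs by (simp add: fin_seqs_def)

text \<open>The map \<open>\<M>[s] (f\<^sup>k)\<^sup>s \<rightarrow> \<iota>\<^sub>+\<M>\<close> sending \<open>m s\<^sup>j (f\<^sup>k)\<^sup>s\<close> to \<open>m (s / k)\<^sup>j f\<^sup>s\<close>: the formal symbol \<open>(f\<^sup>k)\<^sup>s\<close> is \<open>f\<^sup>k\<^sup>s\<close>, so \<open>s\<close>
on the left is \<open>1 / k\<close> times the operator \<open>s\<close> on the right.\<close>

definition transfer :: "nat \<Rightarrow> 'n seq \<Rightarrow> 'n seq" where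
  "transfer k u = (\<lambda>i p. \<Sum>j | u j p \<noteq> 0. u j p / of_nat k ^ j * spow j i p)"

lemma transfer_eq:
  assumes "\<And>j. j \<ge> N \<Longrightarrow> u j p = 0"
  shows "transfer k u i p = (\<Sum>j<N. u j p / of_nat k ^ j * spow j i p)"
  unfolding transfer_def using assms by (intro sum.mono_neutral_left) (auto simp: not_le[symmetric])

lemma bounded_seq_common:
  assumes "bounded_seq u" "bounded_seq v"
  obtains N where "\<And>j p. j \<ge> N \<Longrightarrow> u j p = 0" "\<And>j p. j \<ge> N \<Longrightarrow> v j p = 0"
proof -
  obtain N M where "\<forall>j\<ge>N. \<forall>p. u j p = 0" "\<forall>j\<ge>M. \<forall>p. v j p = 0"
    using assms by (auto simp: bounded_seq_def)
  then show ?thesis using that[of "max N M"] by simp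
qed

lemma transfer_add:
  assumes "u \<in> fin_seqs U" "v \<in> fin_seqs U"
  shows "transfer k (\<lambda>j p. u j p + v j p) = (\<lambda>i p. transfer k u i p + transfer k v i p)"
proof (intro ext)
  fix i p
  obtain N where N: "\<And>j p. j \<ge> N \<Longrightarrow> u j p = 0" "\<And>j p. j \<ge> N \<Longrightarrow> v j p = 0"
    using bounded_seq_common[of u v] assms by (auto simp: fin_seqs_def)
  show "transfer k (\<lambda>j p. u j p + v j p) i p = transfer k u i p + transfer k v i p"
    using N by (subst (1 2 3) transfer_eq[where N = N])
      (auto simp: sum.distrib[symmetric] algebra_simps add_divide_distrib)
qed

text \<open>\<open>s\<^sup>j f\<^sup>s\<close> has order \<open>j\<close> in \<open>\<partial>\<^sub>t\<close> with leading coefficient \<open>(- f)\<^sup>j\<close>, which is invertible where \<open>f \<noteq> 0\<close>.  So the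
highest index at which two sequences differ is visible in their images.\<close>

lemma transfer_inj:
  assumes k: "k > 0" and u: "u \<in> fin_seqs U" and v: "v \<in> fin_seqs U"
    and eq: "transfer k u = transfer k v"
  shows "u = v"
proof (rule ccontr)
  assume "u \<noteq> v"
  then obtain l p where l: "u l p \<noteq> v l p" by (auto simp: fun_eq_iff)
  then have "p \<in> nonvan f U" using nv_seqs_outside[of u U p l] nv_seqs_outside[of v U p l] u v
    by (cases "p \<in> nonvan f U") (auto simp: fin_seqs_def)
  then have fp: "f p \<noteq> 0" by (simp add: nonvan_def)
  obtain N where N: "\<And>j p. j \<ge> N \<Longrightarrow> u j p = 0" "\<And>j p. j \<ge> N \<Longrightarrow> v j p = 0"
    using bounded_seq_common[of u v] u v by (auto simp: fin_seqs_def)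
  define A where "A = {j. u j p \<noteq> v j p}"
  have A: "finite A" "A \<noteq> {}"
  proof -
    have "A \<subseteq> {..<N}" using N by (force simp: A_def not_le[symmetric])
    then show "finite A" by (rule finite_subset) simp
  qed (use l in \<open>auto simp: A_def\<close>)
  \<comment> \<open>The highest index of difference at the point \<open>p\<close>.\<close>
  define m where "m = Max A"
  have m: "m \<in> A" "\<And>j. j > m \<Longrightarrow> u j p = v j p"
    using Max_in[OF A] Max_ge[OF A(1)] by (auto simp: m_def A_def not_le[symmetric])
  have mN: "m < N" using m(1) N by (force simp: A_def not_le[symmetric])
  have "0 = transfer k u m p - transfer k v m p" using eq by simp
  also have "\<dots> = (\<Sum>j<N. (u j p - v j p) / of_nat k ^ j * spow j m p)"
    using N by (subst (1 2) transfer_eq[where N = N])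
      (auto simp: sum_subtractf[symmetric] algebra_simps diff_divide_distrib)
  also have "\<dots> = (\<Sum>j\<in>{m}. (u j p - v j p) / of_nat k ^ j * spow j m p)"
  proof (rule sum.mono_neutral_right)
    show "\<forall>j\<in>{..<N} - {m}. (u j p - v j p) / of_nat k ^ j * spow j m p = 0"
    proof
      fix j assume "j \<in> {..<N} - {m}"
      then consider "j < m" | "j > m" by fastforce
      then show "(u j p - v j p) / of_nat k ^ j * spow j m p = 0"
        by cases (simp_all add: spow_above m(2))
    qed
  qed (use mN in auto)
  finally show False using m(1) k fp by (auto simp: A_def spow_diag)
qed

lemma transfer_mult_op:
  assumes "u \<in> fin_seqs U"
  shows "transfer k (mult_op h u) = mult_op h (transfer k u)"
proof (intro ext)
  fix i p
  obtain N where N: "\<And>j p. j \<ge> N \<Longrightarrow> u j p = 0"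
    using assms by (auto simp: fin_seqs_def bounded_seq_def)
  show "transfer k (mult_op h u) i p = mult_op h (transfer k u) i p"
    using N transfer_eq[of N u p k i] transfer_eq[of N "mult_op h u" p k i]
    by (simp add: mult_op_def sum_distrib_left algebra_simps)
qed

lemma transfer_shift:
  assumes "u \<in> fin_seqs U"
  shows "transfer k (shift u) = (\<lambda>i p. 1 / of_nat k * s_op f (transfer k u) i p)"
proof (intro ext)
  fix i p
  obtain N where N: "\<And>j p. j \<ge> N \<Longrightarrow> u j p = 0"
    using assms by (auto simp: fin_seqs_def bounded_seq_def)
  have "transfer k (shift u) i p = (\<Sum>j<Suc N. shift u j p / of_nat k ^ j * spow j i p)"
    using N by (intro transfer_eq) (simp add: shift_def)
  also have "\<dots> = (\<Sum>j<N. u j p / of_nat k ^ Suc j * spow (Suc j) i p)"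
    unfolding sum.lessThan_Suc_shift by simp
  finally have 1: "transfer k (shift u) i p = (\<Sum>j<N. u j p / of_nat k ^ Suc j * spow (Suc j) i p)" .
  have 2: "transfer k u = (\<lambda>i p. \<Sum>j<N. u j p / of_nat k ^ j * spow j i p)"
    using N by (intro ext transfer_eq) auto
  have "s_op f (transfer k u) = (\<lambda>i p. \<Sum>j<N. u j p / of_nat k ^ j * spow (Suc j) i p)"
    unfolding 2 spow_Suc by (rule s_op_sum)
  then show "transfer k (shift u) i p = 1 / of_nat k * s_op f (transfer k u) i p"
    unfolding 1 by (simp add: sum_distrib_left algebra_simps)
qed

context
  fixes U \<xi> assumes U: "open_in X U" and \<xi>: "\<xi> \<in> vector_fields X U"
begin

lemma vf_graph_mult:
  assumes h: "h \<in> hol (nonvan f U)" and u: "u \<in> nv_seqs U"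
  shows "vf_graph f U \<xi> (\<lambda>j p. h p * u j p) = (\<lambda>j p. \<xi> (nonvan f U) h p * u j p + h p * vf_graph f U \<xi> u j p)"
  by (auto simp: vf_graph_def shift_def vf_mult[OF U \<xi> h nv_seqsD[OF u]] fun_eq_iff algebra_simps)

lemma vf_graph_sum:
  assumes c: "\<And>j. c j \<in> hol (nonvan f U)" and E: "\<And>j. E j \<in> nv_seqs U"
  shows "(\<lambda>i p. \<Sum>j<(N::nat). c j p * E j i p) \<in> nv_seqs U \<and>
    vf_graph f U \<xi> (\<lambda>i p. \<Sum>j<N. c j p * E j i p) =
    (\<lambda>i p. \<Sum>j<N. \<xi> (nonvan f U) (c j) p * E j i p + c j p * vf_graph f U \<xi> (E j) i p)"
proof (induction N)
  case 0
  have "vf_graph f U \<xi> (\<lambda>_ _. 0) = (\<lambda>_ _. 0)"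
    by (auto simp: vf_graph_def shift_def vf_zero[OF U \<xi>] fun_eq_iff)
  then show ?case by (simp add: nv_seqs_def hol_zero)
next
  case (Suc N)
  have "(\<lambda>i p. c N p * E N i p) \<in> nv_seqs U"
    using c E by (auto simp: nv_seqs_def intro: hol_mult)
  then show ?case using Suc by (simp add: nv_seqs_add vf_graph_add[OF U \<xi>] vf_graph_mult c E)
qed

text \<open>\<open>\<xi>(s\<^sup>j f\<^sup>s) = \<xi>(f) / f s\<^sup>j\<^sup>+\<^sup>1 f\<^sup>s\<close>: the case \<open>j = 0\<close> holds because \<open>\<xi>\<close> kills constants and \<open>s f\<^sup>s = - f \<otimes> \<partial>\<^sub>t\<close>, and \<open>\<xi>\<close>
commutes with \<open>s\<close>.\<close>

lemma vf_graph_spow: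
  "vf_graph f U \<xi> (restr_seq U (spow j)) =
    (\<lambda>i p. \<xi> U (restr U f) p * (fpow (-1) 0 p * restr_seq U (spow (Suc j)) i p))"
proof (induction j)
  case 0
  have one: "restr (nonvan f U) (\<lambda>_. 1) \<in> hol (nonvan f U)" using hol_const nonvan_proj U by blast
  have "\<xi> (nonvan f U) (restr (nonvan f U) (\<lambda>_. 1)) = (\<lambda>_. 0)"
  proof (intro ext)
    fix p
    let ?e = "restr (nonvan f U) (\<lambda>_. 1)" and ?D = "\<xi> (nonvan f U) (restr (nonvan f U) (\<lambda>_. 1))"
    have "(\<lambda>p. ?e p * ?e p) = ?e" by (auto simp: restr_def)
    then have "?D p = ?D p * ?e p + ?e p * ?D p" using vf_mult[OF U \<xi> one one] by metis
    then show "?D p = 0" using hol_outside[OF vf_hol[OF U \<xi> one], of p]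
      by (cases "p \<in> nonvan f U") (auto simp: restr_def)
  qed
  moreover have "restr_seq U (spow 0) 0 = restr (nonvan f U) (\<lambda>_. 1)"
    "restr_seq U (spow 0) (Suc j) = (\<lambda>_. 0)" for j
    by (auto simp: restr_seq_apply spow_0 fpow_def restr_def nonvan_def fun_eq_iff)
  ultimately have D0: "\<xi> (nonvan f U) (restr_seq U (spow 0) i) = (\<lambda>_. 0)" for i
    by (cases i) (simp_all add: vf_zero[OF U \<xi>])
  show ?case unfolding vf_graph_def D0
    by (auto simp: fun_eq_iff spow_Suc s_op_eq restr_seq_apply shift_def spow_0 fpow_def)
next
  case (Suc j)
  have "vf_graph f U \<xi> (restr_seq U (spow (Suc j))) = s_op f (vf_graph f U \<xi> (restr_seq U (spow j)))"
    unfolding spow_Suc[of j] s_op_restr_seq[symmetric] by (rule vf_graph_s_op[OF U \<xi> spow_nv_seqs[OF U]])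
  also have "\<dots> = s_op f (\<lambda>i p. (\<xi> U (restr U f) p * fpow (-1) 0 p) * restr_seq U (spow (Suc j)) i p)"
    unfolding Suc by (simp add: mult.assoc)
  also have "\<dots> = (\<lambda>i p. \<xi> U (restr U f) p * (fpow (-1) 0 p * restr_seq U (spow (Suc (Suc j))) i p))"
    unfolding s_op_scale by (simp add: mult.assoc spow_Suc s_op_restr_seq)
  finally show ?case .
qed

text \<open>The logarithmic derivative of \<open>f\<^sup>k\<close> is \<open>k\<close> times that of \<open>f\<close>.  The function \<open>fpow (-1) 0\<close> is \<open>1 / f\<close>, extended
by \<open>0\<close>.\<close>

lemma vf_fs_power_eq:
  assumes k: "k > 0" and u: "u \<in> nv_seqs U"
  shows "vf_fs (\<lambda>p. f p ^ k) U \<xi> u = (\<lambda>j p. \<xi> (nonvan f U) (u j) p +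
      of_nat k * (\<xi> U (restr U f) p * (fpow (-1) 0 p * shift u j p)))"
proof (intro ext)
  fix j p
  have nv: "nonvan (\<lambda>p. f p ^ k) U = nonvan f U" using k by (simp add: nonvan_def)
  let ?F = "restr U f"
  note F = f_hol_restr[OF U]
  have pw: "\<xi> U (\<lambda>p. ?F p ^ Suc m) = (\<lambda>p. of_nat (Suc m) * ?F p ^ m * \<xi> U ?F p)
      \<and> (\<lambda>p. ?F p ^ Suc m) \<in> hol U" for m
  proof (induction m)
    case 0
    then show ?case using F by simp
  next
    case (Suc m)
    have "\<xi> U (\<lambda>p. ?F p * ?F p ^ Suc m) = (\<lambda>p. of_nat (Suc (Suc m)) * ?F p ^ Suc m * \<xi> U ?F p)"
      unfolding vf_mult_U[OF U \<xi> F conjunct2[OF Suc]] conjunct1[OF Suc] by (auto simp: algebra_simps)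
    then show ?case using hol_mult[OF F conjunct2[OF Suc]] by (simp only: power_Suc simp_thms)
  qed
  have F_pow: "restr U (\<lambda>p. f p ^ Suc m) = (\<lambda>p. ?F p ^ Suc m)" for m
    by (auto simp: restr_def)
  have "\<xi> U (restr U (\<lambda>p. f p ^ k)) p / f p ^ k * shift u j p
     = of_nat k * (\<xi> U (restr U f) p * (fpow (-1) 0 p * shift u j p))"
  proof (cases "p \<in> nonvan f U")
    case True
    obtain m where m: "k = Suc m" using k gr0_conv_Suc by blast
    have "?F p = f p" "f p \<noteq> 0" using True by (auto simp: restr_def nonvan_def)
    then show ?thesis unfolding m F_pow conjunct1[OF pw]
      by (auto simp: fpow_def power_int_minus field_simps)
  next
    case False
    then show ?thesis using nv_seqs_outside[OF nv_seqs_shift[OF u]] by simp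
  qed
  then show "vf_fs (\<lambda>p. f p ^ k) U \<xi> u j p = \<xi> (nonvan f U) (u j) p +
      of_nat k * (\<xi> U (restr U f) p * (fpow (-1) 0 p * shift u j p))"
    by (simp add: vf_fs_def nv)
qed

text \<open>In \<open>\<xi>(m s\<^sup>j (f\<^sup>k)\<^sup>s) = \<xi>(m) s\<^sup>j (f\<^sup>k)\<^sup>s + m \<xi>(f\<^sup>k) / f\<^sup>k s\<^sup>j\<^sup>+\<^sup>1 (f\<^sup>k)\<^sup>s\<close> the factor \<open>k\<close> of the logarithmic derivative
makes up for the extra \<open>1 / k\<close> by which \<open>s\<^sup>j\<^sup>+\<^sup>1\<close> is scaled.\<close>

lemma transfer_vf:
  assumes k: "k > 0" and u: "u \<in> fin_seqs U"
  shows "vf_fs (\<lambda>p. f p ^ k) U \<xi> u \<in> fin_seqs U"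
    and "transfer k (vf_fs (\<lambda>p. f p ^ k) U \<xi> u) = vf_graph f U \<xi> (transfer k u)"
proof -
  let ?O = "nonvan f U" and ?g = "\<xi> U (restr U f)" and ?v = "vf_fs (\<lambda>p. f p ^ k) U \<xi> u"
  have u': "u \<in> nv_seqs U" using u by (simp add: fin_seqs_def)
  note v = vf_fs_power_eq[OF k u']
  obtain N where N: "\<And>j p. j \<ge> N \<Longrightarrow> u j p = 0"
    using u by (auto simp: fin_seqs_def bounded_seq_def)
  then have N': "u j = (\<lambda>_. 0)" if "j \<ge> N" for j using that by auto
  have vN: "?v j p = 0" if "j \<ge> Suc N" for j p
    using that N N'[of j] unfolding v by (auto simp: shift_def vf_zero[OF U \<xi>])
  have inv: "restr U (fpow (-1) 0) \<in> hol ?O"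
    using nv_seqsD[OF fpow_nv_seqs[OF U], of "-1" 0] by (simp add: restr_seq_def)
  have "(\<lambda>j p. \<xi> ?O (u j) p) \<in> nv_seqs U" using vf_hol[OF U \<xi>] u' by (auto simp: nv_seqs_def)
  moreover have "(\<lambda>j p. of_nat k * (?g p * (restr U (fpow (-1) 0) p * shift u j p))) \<in> nv_seqs U"
    by (intro nv_seqs_scale[OF U] nv_seqs_mult[OF U vf_hol_U[OF U \<xi> f_hol_restr[OF U]]])
      (use hol_mult[OF inv] nv_seqs_shift[OF u'] in \<open>auto simp: nv_seqs_def\<close>)
  moreover have "restr U (fpow (-1) 0) p * shift u j p = fpow (-1) 0 p * shift u j p" for j p
    using nv_seqs_outside[OF nv_seqs_shift[OF u'], of p j] by (auto simp: restr_def nonvan_def)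
  ultimately have "?v \<in> nv_seqs U" unfolding v using nv_seqs_add by fastforce
  then show vS: "?v \<in> fin_seqs U" using vN bounded_seqI by (auto simp: fin_seqs_def)
  define c where "c = (\<lambda>j p. 1 / of_nat k ^ j * u j p)"
  have c: "c j \<in> hol ?O" for j unfolding c_def by (intro hol_cmult open_nonvan U nv_seqsD[OF u'])
  have "transfer k u = (\<lambda>i p. \<Sum>j<N. c j p * restr_seq U (spow j) i p)"
  proof (intro ext)
    fix i p
    have "transfer k u i p = (\<Sum>j<N. u j p / of_nat k ^ j * spow j i p)"
      using N by (intro transfer_eq) auto
    also have "\<dots> = (\<Sum>j<N. c j p * restr_seq U (spow j) i p)"
      using nv_seqs_outside[OF u', of p] by (intro sum.cong) (auto simp: c_def restr_seq_apply nonvan_def)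
    finally show "transfer k u i p = (\<Sum>j<N. c j p * restr_seq U (spow j) i p)" .
  qed
  then have R: "vf_graph f U \<xi> (transfer k u) = (\<lambda>i p. \<Sum>j<N. \<xi> ?O (c j) p * restr_seq U (spow j) i p +
      c j p * vf_graph f U \<xi> (restr_seq U (spow j)) i p)"
    using vf_graph_sum[OF c spow_nv_seqs[OF U]] by simp
  show "transfer k ?v = vf_graph f U \<xi> (transfer k u)"
  proof (intro ext)
    fix i p
    have D0: "\<xi> ?O (u N) p = 0" using N'[of N] vf_zero[OF U \<xi>] by simp
    have out: "u j p = 0" if "p \<notin> U" for j using that nv_seqs_outside[OF u', of p j] by (auto simp: nonvan_def)
    have out': "\<xi> ?O (u j) p = 0" if "p \<notin> U" for j
      using that hol_outside[OF vf_hol[OF U \<xi> nv_seqsD[OF u']], of p j] by (auto simp: nonvan_def)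
    have "transfer k ?v i p = (\<Sum>j<Suc N. ?v j p / of_nat k ^ j * spow j i p)"
      using vN by (intro transfer_eq) auto
    also have "\<dots> = (\<Sum>j<Suc N. \<xi> ?O (u j) p / of_nat k ^ j * spow j i p)
        + (\<Sum>j<Suc N. of_nat k * (?g p * (fpow (-1) 0 p * shift u j p)) / of_nat k ^ j * spow j i p)"
      unfolding v by (simp add: sum.distrib[symmetric] add_divide_distrib distrib_right)
    also have "(\<Sum>j<Suc N. \<xi> ?O (u j) p / of_nat k ^ j * spow j i p)
        = (\<Sum>j<N. \<xi> ?O (u j) p / of_nat k ^ j * spow j i p)"
      using D0 by simp
    also have "(\<Sum>j<Suc N. of_nat k * (?g p * (fpow (-1) 0 p * shift u j p)) / of_nat k ^ j * spow j i p)
        = (\<Sum>j<N. ?g p * (fpow (-1) 0 p * u j p) / of_nat k ^ j * spow (Suc j) i p)"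
      unfolding sum.lessThan_Suc_shift using k by simp
    finally have L: "transfer k ?v i p = (\<Sum>j<N. \<xi> ?O (u j) p / of_nat k ^ j * spow j i p
        + ?g p * (fpow (-1) 0 p * u j p) / of_nat k ^ j * spow (Suc j) i p)"
      by (simp add: sum.distrib)
    show "transfer k ?v i p = vf_graph f U \<xi> (transfer k u) i p"
      unfolding L R vf_graph_spow
    proof (rule sum.cong)
      fix j
      have 1: "\<xi> ?O (c j) p = 1 / of_nat k ^ j * \<xi> ?O (u j) p"
        unfolding c_def by (simp only: vf_scale[OF U \<xi> nv_seqsD[OF u']])
      show "\<xi> ?O (u j) p / of_nat k ^ j * spow j i p + ?g p * (fpow (-1) 0 p * u j p) / of_nat k ^ j * spow (Suc j) i p
        = \<xi> ?O (c j) p * restr_seq U (spow j) i p + c j p * (?g p * (fpow (-1) 0 p * restr_seq U (spow (Suc j)) i p))"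
        unfolding 1 using out[of j] out'[of j] by (cases "p \<in> U") (auto simp: c_def restr_seq_apply)
    qed simp
  qed
qed

end

lemma transfer_equation_lhs:
  assumes U: "open_in X U" and k: "k > 0"
  shows "poly_fs (\<lambda>p. f p ^ k) U 1 (\<lambda>p. f p ^ k) \<in> fin_seqs U"
    and "transfer k (poly_fs (\<lambda>p. f p ^ k) U 1 (\<lambda>p. f p ^ k)) = restr_seq U (fpow (int k))"
proof -
  let ?u = "poly_fs (\<lambda>p. f p ^ k) U 1 (\<lambda>p. f p ^ k)"
  have u: "?u = restr_seq U (fpow (int k))"
    using k by (auto simp: poly_fs_def restr_seq_def restr_def fpow_def nonvan_def coeff_1 fun_eq_iff)
  then show "?u \<in> fin_seqs U" using fpow_fin_seqs[OF U] by simp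
  show "transfer k ?u = restr_seq U (fpow (int k))"
  proof (intro ext)
    fix i p
    have "transfer k ?u i p = (\<Sum>j<1. ?u j p / of_nat k ^ j * spow j i p)"
      unfolding u by (intro transfer_eq) (auto simp: restr_seq_apply fpow_def)
    then show "transfer k ?u i p = restr_seq U (fpow (int k)) i p"
      unfolding u by (auto simp: restr_seq_apply fpow_def spow_0)
  qed
qed

lemma transfer_equation_rhs:
  assumes U: "open_in X U" and k: "k > 0"
  shows "poly_fs (\<lambda>p. f p ^ k) U b (\<lambda>_. 1) \<in> fin_seqs U"
    and "transfer k (poly_fs (\<lambda>p. f p ^ k) U b (\<lambda>_. 1)) =
      restr_seq U (s_act f (pcompose b [:0, 1 / of_nat k:]) (fpow 0))"
proof -
  let ?u = "poly_fs (\<lambda>p. f p ^ k) U b (\<lambda>_. 1)"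
  have nv: "nonvan (\<lambda>p. f p ^ k) U = nonvan f U" using k by (simp add: nonvan_def)
  have u: "?u j p = (if p \<in> nonvan f U then coeff b j else 0)" for j p
    by (simp add: poly_fs_def restr_def nv)
  have "?u j \<in> hol (nonvan f U)" for j
    using hol_const[OF nonvan_proj[OF U], of "coeff b j"] by (simp add: poly_fs_def nv)
  moreover have "bounded_seq ?u" by (intro bounded_seqI[of "Suc (degree b)"]) (simp add: u coeff_eq_0)
  ultimately show "?u \<in> fin_seqs U" by (simp add: fin_seqs_def nv_seqs_def)
  show "transfer k ?u = restr_seq U (s_act f (pcompose b [:0, 1 / of_nat k:]) (fpow 0))"
  proof (intro ext)
    fix i p
    let ?q = "pcompose b [:0, 1 / of_nat k:]"
    have deg: "degree ?q < Suc (degree b)" using k by (simp add: degree_pcompose)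
    have "transfer k ?u i p = (\<Sum>j<Suc (degree b). ?u j p / of_nat k ^ j * spow j i p)"
      by (intro transfer_eq) (simp add: u coeff_eq_0)
    moreover have "s_act f ?q (fpow 0) i p = (\<Sum>j<Suc (degree b). coeff b j / of_nat k ^ j * spow j i p)"
      unfolding s_act_eq_sum[OF deg] by (simp add: coeff_pcompose_linear spow_def power_one_over power_inverse divide_inverse mult_ac)
    moreover have "spow j i p = 0" if "f p = 0" for j
    proof -
      have "restr_seq X (spow j) i p = 0"
        using nv_seqs_outside[OF spow_nv_seqs[OF open_in_self[OF X_proj]], of p] that by (simp add: nonvan_def)
      moreover have "\<forall>p. p \<notin> X \<longrightarrow> spow j i p = 0"
        using hol_outside[OF f_hol]
        by (induction j arbitrary: i) (auto simp: spow_0 fpow_def spow_Suc s_op_eq shift_def)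
      ultimately show ?thesis by (auto simp: restr_seq_apply split: if_splits)
    qed
    ultimately show "transfer k ?u i p = restr_seq U (s_act f ?q (fpow 0)) i p"
      by (auto simp: restr_seq_apply u nonvan_def)
  qed
qed

lemma transfer_shift_op:
  assumes U: "open_in X U" and u: "u \<in> fin_seqs U"
  shows "shift u \<in> fin_seqs U"
    and "transfer k (shift u) = (mult_op (restr U (\<lambda>_. 1 / of_nat k)) \<circ> s_op f) (transfer k u)"
proof -
  show "shift u \<in> fin_seqs U" using u by (simp add: fin_seqs_def nv_seqs_shift bounded_seq_shift)
  have u0: "u j p = 0" if "p \<notin> U" for j p
    using nv_seqs_outside[of u U p] u that by (auto simp: fin_seqs_def nonvan_def)
  then have "transfer k u i p = 0" if "p \<notin> U" for i p using that by (simp add: transfer_def)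
  then have "s_op f (transfer k u) i p = 0" if "p \<notin> U" for i p
    using that by (simp add: s_op_eq shift_def)
  then show "transfer k (shift u) = (mult_op (restr U (\<lambda>_. 1 / of_nat k)) \<circ> s_op f) (transfer k u)"
    unfolding transfer_shift[OF u] by (auto simp: mult_op_def restr_def fun_eq_iff)
qed

lemma transfer_D_s:
  assumes U: "open_in X U" and k: "k > 0" and P: "P \<in> D_s X (\<lambda>p. f p ^ k) U"
  shows "\<exists>P'\<in>graph_D_s U. \<forall>u\<in>fin_seqs U. P u \<in> fin_seqs U \<and> transfer k (P u) = P' (transfer k u)"
proof -
  let ?G = "mult_op ` hol U \<union> vf_fs (\<lambda>p. f p ^ k) U ` vector_fields X U \<union> {shift}"
  have "\<exists>P'\<in>graph_D_s U. \<forall>u\<in>fin_seqs U. P u \<in> fin_seqs U \<and> transfer k (P u) = P' (transfer k u)" if P: "P \<in> ?G" for P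
  proof -
    consider h where "h \<in> hol U" "P = mult_op h" | \<xi> where "\<xi> \<in> vector_fields X U" "P = vf_fs (\<lambda>p. f p ^ k) U \<xi>"
      | "P = shift" using P by blast
    then show ?thesis
    proof cases
      case 1
      then show ?thesis
        by (intro bexI[OF _ graph_D_s_mult[OF 1(1)]]) (auto simp: fin_seqs_mult U transfer_mult_op)
    next
      case 2
      then show ?thesis
        by (intro bexI[OF _ graph_D_s_vf[OF 2(1)]]) (auto simp: transfer_vf[OF U 2(1) k])
    next
      case 3
      then show ?thesis
        by (intro bexI[OF _ graph_D_s_comp[OF graph_D_s_const[OF U] graph_D_s_s_op]]) (use transfer_shift_op[OF U] in auto)
    qed
  qed
  then show ?thesis
    using P unfolding graph_D_s_def D_s_def
    by (intro generated_algebra_push[where P = P and G = ?G]) (auto simp: fin_seqs_add transfer_add)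
qed

lemma transfer_graph_D_s:
  assumes U: "open_in X U" and k: "k > 0" and P: "P \<in> graph_D_s U"
  shows "\<exists>P'\<in>D_s X (\<lambda>p. f p ^ k) U. \<forall>u\<in>fin_seqs U. P' u \<in> fin_seqs U \<and> transfer k (P' u) = P (transfer k u)"
proof -
  let ?G = "mult_op ` hol U \<union> vf_fs (\<lambda>p. f p ^ k) U ` vector_fields X U \<union> {shift}"
  have D: "mult_op h \<in> D_s X (\<lambda>p. f p ^ k) U" if "h \<in> hol U" for h
    unfolding D_s_def using that by (intro generated_algebra.gen) auto
  have gen: "\<exists>P'\<in>D_s X (\<lambda>p. f p ^ k) U. \<forall>u\<in>fin_seqs U. P' u \<in> fin_seqs U \<and> transfer k (P' u) = P (transfer k u)"
    if "P \<in> mult_op ` hol U \<union> vf_graph f U ` vector_fields X U \<union> {s_op f}" for P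
    using that
  proof (cases rule: graph_D_s_generator_cases)
    case (mult h)
    then show ?thesis
      by (intro bexI[OF _ D[OF mult(1)]]) (auto simp: fin_seqs_mult U transfer_mult_op)
  next
    case (vf \<xi>)
    have "vf_fs (\<lambda>p. f p ^ k) U \<xi> \<in> D_s X (\<lambda>p. f p ^ k) U"
      unfolding D_s_def using vf by (intro generated_algebra.gen) auto
    then show ?thesis
      by (rule rev_bexI) (auto simp: transfer_vf[OF U vf(1) k] vf(2))
  next
    case s
    let ?c = "restr U (\<lambda>_. of_nat k :: complex)"
    have c: "?c \<in> hol U" by (intro hol_const open_in_proj U)
    have "shift \<in> D_s X (\<lambda>p. f p ^ k) U" unfolding D_s_def by (intro generated_algebra.gen) auto
    then have "mult_op ?c \<circ> shift \<in> D_s X (\<lambda>p. f p ^ k) U"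
      using D[OF c] unfolding D_s_def by (intro generated_algebra.comp)
    moreover have "(mult_op ?c \<circ> shift) u \<in> fin_seqs U \<and> transfer k ((mult_op ?c \<circ> shift) u) = s_op f (transfer k u)"
      if u: "u \<in> fin_seqs U" for u
    proof -
      note sh = transfer_shift_op[OF U u]
      have "(mult_op ?c (shift u)) = (\<lambda>j p. of_nat k * shift u j p)"
        using sh(1) by (intro mult_op_const) (simp add: fin_seqs_def)
      also have "\<dots> = mult_op (\<lambda>_. of_nat k) (shift u)" by (simp add: mult_op_def)
      finally have "transfer k (mult_op ?c (shift u)) = mult_op (\<lambda>_. of_nat k) (transfer k (shift u))"
        using transfer_mult_op[OF sh(1)] by metis
      also have "\<dots> = s_op f (transfer k u)"
        unfolding transfer_shift[OF u] using k by (simp add: mult_op_def)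
      finally show ?thesis using fin_seqs_mult[OF U c sh(1)] by simp
    qed
    ultimately show ?thesis unfolding s by (intro bexI[of _ "mult_op ?c \<circ> shift"] ballI)
  qed
  show ?thesis
    using P gen unfolding graph_D_s_def D_s_def
    by (intro generated_algebra_pull[where P = P and H = ?G]) (auto simp: fin_seqs_add transfer_add)
qed

text \<open>The transfer map turns \<open>P(s) (f\<^sup>k)\<^sup>s\<^sup>+\<^sup>1 = b(s) (f\<^sup>k)\<^sup>s\<close> into an equation \<open>P' f\<^sup>s\<^sup>+\<^sup>k = b(s / k) f\<^sup>s\<close> in the graph module.
Injectivity of the map gives the converse.\<close>

theorem bs_equation_iff_N_germ:
  assumes k: "k > 0"
  shows "bs_equation X (\<lambda>p. f p ^ k) b \<longleftrightarrow>
    (\<forall>p\<in>X. N_germ p (int k) (s_act f (pcompose b [:0, 1 / of_nat k:]) (fpow 0)))"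
proof -
  let ?g = "\<lambda>p. f p ^ k"
  have *: "(\<exists>P\<in>D_s X ?g U. P (poly_fs ?g U 1 ?g) = poly_fs ?g U b (\<lambda>_. 1)) \<longleftrightarrow>
    (\<exists>P\<in>graph_D_s U. restr_seq U (s_act f (pcompose b [:0, 1 / of_nat k:]) (fpow 0)) = P (restr_seq U (fpow (int k))))"
    (is "?L \<longleftrightarrow> ?R") if U: "open_in X U" for U
  proof
    note L = transfer_equation_lhs[OF U k] and R = transfer_equation_rhs[OF U k, of b]
    show ?R if ?L
    proof -
      obtain P where P: "P \<in> D_s X ?g U" "P (poly_fs ?g U 1 ?g) = poly_fs ?g U b (\<lambda>_. 1)" using \<open>?L\<close> by blast
      obtain P' where P': "P' \<in> graph_D_s U" "\<forall>u\<in>fin_seqs U. P u \<in> fin_seqs U \<and> transfer k (P u) = P' (transfer k u)"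
        using transfer_D_s[OF U k P(1)] by blast
      have "transfer k (P (poly_fs ?g U 1 ?g)) = P' (transfer k (poly_fs ?g U 1 ?g))" using P'(2) L(1) by blast
      then show ?R unfolding P(2) L(2) R(2) using P'(1) by blast
    qed
    show ?L if ?R
    proof -
      obtain P where P: "P \<in> graph_D_s U"
        "restr_seq U (s_act f (pcompose b [:0, 1 / of_nat k:]) (fpow 0)) = P (restr_seq U (fpow (int k)))"
        using \<open>?R\<close> by blast
      obtain P' where P': "P' \<in> D_s X ?g U" "\<forall>u\<in>fin_seqs U. P' u \<in> fin_seqs U \<and> transfer k (P' u) = P (transfer k u)"
        using transfer_graph_D_s[OF U k P(1)] by blast
      have "transfer k (P' (poly_fs ?g U 1 ?g)) = transfer k (poly_fs ?g U b (\<lambda>_. 1))"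
        unfolding R(2) P(2) using P'(2) L by auto
      then have "P' (poly_fs ?g U 1 ?g) = poly_fs ?g U b (\<lambda>_. 1)"
        using transfer_inj[OF k _ R(1)] P'(2) L(1) by blast
      then show ?L using P'(1) by blast
    qed
  qed
  show ?thesis unfolding bs_equation_def N_germ_def by (simp only: * cong: conj_cong)
qed

end

section \<open>Polynomial ideals and multiplicities\<close>

lemma order_pcompose_linear:
  fixes p :: "complex poly"
  assumes "a \<noteq> 0" "p \<noteq> 0"
  shows "order x (pcompose p [:c, a:]) = order (c + a * x) p"
proof -
  let ?y = "c + a * x" and ?l = "[:c, a:]"
  obtain q where q: "p = [:- ?y, 1:] ^ order ?y p * q" "\<not> [:- ?y, 1:] dvd q"
    using order_decomp[OF assms(2)] by blast
  have pow: "pcompose (r ^ n) ?l = pcompose r ?l ^ n" for r n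
    by (induction n) (auto simp: pcompose_mult pcompose_1)
  have lin: "pcompose [:- ?y, 1:] ?l = Polynomial.smult a [:- x, 1:]"
    by (simp add: pcompose_pCons)
  have eq: "pcompose p ?l = Polynomial.smult (a ^ order ?y p) ([:- x, 1:] ^ order ?y p * pcompose q ?l)"
    by (subst q(1)) (simp only: pcompose_mult pow lin smult_power mult_smult_left)
  have "poly (pcompose q ?l) x \<noteq> 0" using q(2) by (simp add: poly_pcompose poly_eq_0_iff_dvd mult.commute)
  then have "order x (pcompose q ?l) = 0" "pcompose q ?l \<noteq> 0" by (auto simp: order_root)
  then show ?thesis unfolding eq using assms by (simp add: order_smult order_mult order_power_n_n)
qed

text \<open>\<open>c\<close> is a unit modulo every power of \<open>s + a\<close>.\<close>

lemma ideal_cancel_coprime: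
  fixes I :: "complex poly set"
  assumes add: "\<And>p q. p \<in> I \<Longrightarrow> q \<in> I \<Longrightarrow> p + q \<in> I" and mult: "\<And>p q. p \<in> I \<Longrightarrow> q * p \<in> I"
    and "[:a, 1:] ^ n * q \<in> I" "c * q \<in> I" "poly c (- a) \<noteq> 0"
  shows "q \<in> I"
  using assms(3,4)
proof (induction n arbitrary: q)
  case (Suc n)
  have 1: "[:a, 1:] * q \<in> I"
  proof (rule Suc.IH)
    show "[:a, 1:] ^ n * ([:a, 1:] * q) \<in> I"
      using Suc.prems(1) by (simp only: power_Suc2 mult.assoc)
    show "c * ([:a, 1:] * q) \<in> I"
      using mult[OF Suc.prems(2), of "[:a, 1:]"] by (simp only: mult.left_commute)
  qed
  obtain r where "c - [:poly c (- a):] = [:a, 1:] * r"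
    using poly_eq_0_iff_dvd[of "c - [:poly c (- a):]" "- a"] by auto
  then have r: "c = [:poly c (- a):] + [:a, 1:] * r" by (simp add: algebra_simps)
  have "c * q + (- r) * ([:a, 1:] * q) \<in> I" by (rule add[OF Suc.prems(2) mult[OF 1]])
  also have "c * q + (- r) * ([:a, 1:] * q) = [:poly c (- a):] * q"
    by (subst r) (simp add: algebra_simps del: mult_pCons_left mult_pCons_right)
  finally have "[:inverse (poly c (- a)):] * ([:poly c (- a):] * q) \<in> I" by (rule mult)
  then show ?case using assms(5) by simp
qed simp

context hypersurface begin

section \<open>Clearing poles\<close>

lemma localization_subset: assumes U: "open_in X U" and h: "h \<in> localization X f U" shows "h \<in> hol (nonvan f U)"
proof (rule hol_glue[OF X_proj])
  show "nonvan f U \<subseteq> X" using nonvan_subset open_in_subset[OF U] by blast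
  show "h p = 0" if "p \<notin> nonvan f U" for p using h that by (auto simp: localization_def)
  fix p assume p: "p \<in> nonvan f U"
  then have "p \<in> U" by (simp add: nonvan_def)
  then obtain W m g where W: "g \<in> hol W" "open_in X W" "p \<in> W" "W \<subseteq> U" "\<forall>q\<in>nonvan f W. h q = g q / f q ^ m"
    using h unfolding localization_def by blast
  have eq: "W \<inter> nonvan f U = nonvan f W" using W(4) by (auto simp: nonvan_def)
  have "restr (nonvan f W) g \<in> hol (nonvan f W)"
    by (intro hol_restr[OF W(1) nonvan_subset] open_in_proj W)
  moreover have "restr_seq W (fpow (- int m)) 0 \<in> hol (nonvan f W)"
    by (rule nv_seqsD[OF fpow_nv_seqs[OF W(2)]])
  ultimately have "(\<lambda>q. restr (nonvan f W) g q * restr_seq W (fpow (- int m)) 0 q) \<in> hol (nonvan f W)"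
    by (rule hol_mult)
  moreover have "(\<lambda>q. restr (nonvan f W) g q * restr_seq W (fpow (- int m)) 0 q) = restr (nonvan f W) h"
    using W(5) by (auto simp: restr_def restr_seq_apply fpow_def nonvan_def fun_eq_iff power_int_minus divide_inverse)
  ultimately show "\<exists>W. open_in X W \<and> p \<in> W \<and> restr (W \<inter> nonvan f U) h \<in> hol (W \<inter> nonvan f U)"
    using W eq by (intro exI[of _ W]) simp
qed

lemma graph_module_nv_seqs: "open_in X U \<Longrightarrow> u \<in> graph_module X f U \<Longrightarrow> u \<in> nv_seqs U"
  by (auto simp: graph_module_def nv_seqs_def localization_subset)

lemma fpow_graph_module: "fpow i \<in> graph_module X f X"
proof -
  have X: "open_in X X" using open_in_self[OF X_proj] .
  have pw: "(\<lambda>p. restr X (\<lambda>_. 1) p * f p ^ m) \<in> hol X" for m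
  proof (induction m)
    case (Suc m)
    show ?case using hol_mult[OF f_hol Suc] by (simp add: mult_ac)
  qed (use hol_const[OF X_proj, of 1] in simp)
  have "\<exists>m. \<exists>g\<in>hol X. \<forall>q\<in>nonvan f X. fpow i 0 q = g q / f q ^ m"
  proof (cases "i \<ge> 0")
    case True
    then show ?thesis
      by (intro exI[of _ 0] bexI[OF _ pw[of "nat i"]]) (auto simp: fpow_def nonvan_def restr_def power_int_def)
  next
    case False
    then show ?thesis
      by (intro exI[of _ "nat (- i)"] bexI[OF _ pw[of 0]])
        (auto simp: fpow_def nonvan_def restr_def power_int_def divide_inverse power_inverse)
  qed
  then have "fpow i 0 \<in> localization X f X"
    using X hol_outside[OF f_hol] unfolding localization_def by (auto simp: fpow_def nonvan_def)
  moreover have "fpow i (Suc j) \<in> localization X f X" for j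
    using X hol_zero[of X] unfolding localization_def by (auto simp: fpow_def nonvan_def intro!: exI[of _ X] bexI[of _ "\<lambda>_. 0"])
  ultimately have "fpow i j \<in> localization X f X" for j by (cases j) auto
  moreover have "\<forall>j\<ge>1. \<forall>q\<in>X. fpow i j q = 0" by (simp add: fpow_def)
  ultimately show ?thesis using X unfolding graph_module_def by blast
qed

text \<open>\<open>(s - j) (m \<otimes> \<partial>\<^sub>t\<^sup>j) = - f m \<otimes> \<partial>\<^sub>t\<^sup>j\<^sup>+\<^sup>1\<close>, so powers of \<open>\<partial>\<^sub>t\<close> are generated from \<open>f\<^sup>s\<^sup>+\<^sup>l\<close> by polynomials in \<open>s\<close> at the
expense of powers of \<open>f\<close>.\<close>

lemma N_germ_single_fpow:
  assumes p: "p \<in> X"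
  shows "N_germ p l (\<lambda>i q. if i = j then fpow (l + int j) 0 q else 0)"
proof (induction j)
  case 0
  have "(\<lambda>i q. if i = 0 then fpow (l + int 0) 0 q else 0) = fpow l"
    by (auto simp: fpow_def fun_eq_iff)
  then show ?case using N_germ_self[OF p, of l] by simp
next
  case (Suc j)
  let ?u = "\<lambda>j i q. if i = j then fpow (l + int j) 0 q else 0"
  have "s_act f (Polynomial.smult (- 1) [:- of_nat j, 1:]) (?u j) = ?u (Suc j)"
  proof (intro ext)
    fix i q
    have "fpow (l + int (Suc j)) 0 q = f q * fpow (l + int j) 0 q"
      using fpow_Suc[of "l + int j"] by (metis (no_types) add.assoc add.commute of_nat_Suc)
    then show "s_act f (Polynomial.smult (- 1) [:- of_nat j, 1:]) (?u j) i q = ?u (Suc j) i q"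
      unfolding s_act_smult s_act_linear_poly s_plus_def s_op_eq
      by (cases i) auto
  qed
  then show ?case using N_germ_s_act[OF Suc.IH, of "Polynomial.smult (- 1) [:- of_nat j, 1:]"] by simp
qed

lemma N_germ_single:
  assumes U: "open_in X U" "p \<in> U" and h: "h \<in> localization X f U"
  shows "\<exists>J::nat. N_germ p (- int J) (\<lambda>i q. if i = j then h q else 0)"
proof -
  have p: "p \<in> X" using U open_in_subset by blast
  obtain W m g where W: "g \<in> hol W" "open_in X W" "p \<in> W" "W \<subseteq> U" "\<forall>q\<in>nonvan f W. h q = g q / f q ^ m"
    using h U(2) unfolding localization_def by blast
  let ?l = "- int (m + j)"
  have "N_germ p ?l (\<lambda>i q. g q * (if i = j then fpow (?l + int j) 0 q else 0))"
    using N_germ_mult[OF N_germ_single_fpow[OF p] W(2,3,1)] .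
  moreover have "restr_seq W (\<lambda>i q. if i = j then h q else 0)
      = restr_seq W (\<lambda>i q. g q * (if i = j then fpow (?l + int j) 0 q else 0))"
  proof (intro ext)
    fix i q
    have "h q = 0" if "f q = 0" using h that by (auto simp: localization_def nonvan_def)
    then have "h q = g q * fpow (- int m) 0 q" if "q \<in> W"
      using W(5) that by (cases "f q = 0") (auto simp: nonvan_def fpow_def power_int_minus divide_inverse)
    then show "restr_seq W (\<lambda>i q. if i = j then h q else 0) i q
      = restr_seq W (\<lambda>i q. g q * (if i = j then fpow (?l + int j) 0 q else 0)) i q"
      by (auto simp: restr_seq_apply)
  qed
  ultimately show ?thesis using N_germ_local[OF _ W(2,3)] by blast
qed

text \<open>A section is locally a finite sum of terms \<open>g / f\<^sup>m \<otimes> \<partial>\<^sub>t\<^sup>j\<close>, and such a term lies in \<open>N\<^sub>l\<close> for \<open>l = - (m + j)\<close>.\<close>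

lemma N_germ_exhausts:
  assumes U: "open_in X U" "p \<in> U" and u: "u \<in> graph_module X f U"
  shows "\<exists>J::nat. N_germ p (- int J) u"
proof -
  have p: "p \<in> X" using U open_in_subset by blast
  obtain W N where W: "open_in X W" "p \<in> W" "\<forall>j\<ge>N. \<forall>q\<in>W. u j q = 0"
    using u U(2) by (auto simp: graph_module_def)
  have "\<exists>J::nat. N_germ p (- int J) (\<lambda>i q. if i < n then u i q else 0)" for n
  proof (induction n)
    case 0
    show ?case using N_germ_zero[OF p] by simp
  next
    case (Suc n)
    obtain J where J: "N_germ p (- int J) (\<lambda>i q. if i < n then u i q else 0)" using Suc by blast
    obtain J' where J': "N_germ p (- int J') (\<lambda>i q. if i = n then u n q else 0)"
      using N_germ_single[OF U, of "u n" n] u by (auto simp: graph_module_def)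
    have eq: "(\<lambda>i q. if i < Suc n then u i q else 0)
      = (\<lambda>i q. (if i < n then u i q else 0) + (if i = n then u n q else 0))"
      by (auto simp: fun_eq_iff less_Suc_eq)
    show ?case unfolding eq
      using N_germ_lower[OF J, of "- int (max J J')"] N_germ_lower[OF J', of "- int (max J J')"] p
      by (intro exI[of _ "max J J'"] N_germ_add) auto
  qed
  then obtain J where "N_germ p (- int J) (\<lambda>i q. if i < N then u i q else 0)" by blast
  moreover have "restr_seq W u = restr_seq W (\<lambda>i q. if i < N then u i q else 0)"
    using W(3) by (auto simp: restr_seq_apply fun_eq_iff)
  ultimately show ?thesis using N_germ_local[OF _ W(1,2)] by blast
qed

end

section \<open>Germs of the V-filtration\<close>

locale km_filtration = hypersurface +
  fixes V :: "rat \<Rightarrow> 'a::finite point set \<Rightarrow> 'a seq set"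
  assumes km: "kashiwara_malgrange X f V"
begin

lemmas km_conjuncts =
  km[unfolded kashiwara_malgrange_def, THEN conjunct1]
  km[unfolded kashiwara_malgrange_def, THEN conjunct2, THEN conjunct1]
  km[unfolded kashiwara_malgrange_def, THEN conjunct2, THEN conjunct2, THEN conjunct1]
  km[unfolded kashiwara_malgrange_def, THEN conjunct2, THEN conjunct2, THEN conjunct2, THEN conjunct1]
  km[unfolded kashiwara_malgrange_def, THEN conjunct2, THEN conjunct2, THEN conjunct2, THEN conjunct2, THEN conjunct1]
  km[unfolded kashiwara_malgrange_def, THEN conjunct2, THEN conjunct2, THEN conjunct2, THEN conjunct2, THEN conjunct2, THEN conjunct1]
  km[unfolded kashiwara_malgrange_def, THEN conjunct2, THEN conjunct2, THEN conjunct2, THEN conjunct2, THEN conjunct2, THEN conjunct2, THEN conjunct2]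

lemma V_submodule: "V0_submodule X f (V a)" and V_coh: "V0_coherent X f (V a)"
  using km_conjuncts(1) by blast+

lemma V_graph: "open_in X U \<Longrightarrow> u \<in> V a U \<Longrightarrow> u \<in> graph_module X f U"
  and V_add: "open_in X U \<Longrightarrow> u \<in> V a U \<Longrightarrow> v \<in> V a U \<Longrightarrow> (\<lambda>j p. u j p + v j p) \<in> V a U"
  and V_op: "open_in X U \<Longrightarrow> P \<in> V0_D X f U \<Longrightarrow> u \<in> V a U \<Longrightarrow> P u \<in> V a U"
  and V_restr: "open_in X U \<Longrightarrow> open_in X W \<Longrightarrow> W \<subseteq> U \<Longrightarrow> u \<in> V a U \<Longrightarrow> restr_seq W u \<in> V a W"
proof -
  note * = V_submodule[of a, unfolded V0_submodule_def, rule_format]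
  show "open_in X U \<Longrightarrow> u \<in> V a U \<Longrightarrow> u \<in> graph_module X f U"
    using * by (meson subsetD)
  show "open_in X U \<Longrightarrow> u \<in> V a U \<Longrightarrow> v \<in> V a U \<Longrightarrow> (\<lambda>j p. u j p + v j p) \<in> V a U"
    using *[of U] by simp
  show "open_in X U \<Longrightarrow> P \<in> V0_D X f U \<Longrightarrow> u \<in> V a U \<Longrightarrow> P u \<in> V a U"
    using *[of U] by meson
  show "open_in X U \<Longrightarrow> open_in X W \<Longrightarrow> W \<subseteq> U \<Longrightarrow> u \<in> V a U \<Longrightarrow> restr_seq W u \<in> V a W"
    using *[of U] by meson
qed

lemma V_mono: "a \<le> b \<Longrightarrow> open_in X U \<Longrightarrow> u \<in> V b U \<Longrightarrow> u \<in> V a U"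
  using km_conjuncts(2) by blast

lemma V_exhausts: "open_in X U \<Longrightarrow> u \<in> graph_module X f U \<Longrightarrow> p \<in> U \<Longrightarrow>
    \<exists>W a. open_in X W \<and> p \<in> W \<and> W \<subseteq> U \<and> restr_seq W u \<in> V a W"
  using km_conjuncts(3) by blast

lemma V_discrete: "p \<in> X \<Longrightarrow> \<exists>W. \<exists>r::nat. open_in X W \<and> p \<in> W \<and> r > 0 \<and>
        (\<forall>i::int. \<forall>a U. of_int i / of_nat r < a \<and> a \<le> of_int (i + 1) / of_nat r \<and>
           open_in X U \<and> U \<subseteq> W \<longrightarrow> V a U = V (of_int (i + 1) / of_nat r) U)"
  using km_conjuncts(4) by blast

lemma V_t: "open_in X U \<Longrightarrow> u \<in> V a U \<Longrightarrow> t_op f u \<in> V (a + 1) U"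
  and V_t_surj: "a > 0 \<Longrightarrow> open_in X U \<Longrightarrow> u \<in> V (a + 1) U \<Longrightarrow> \<exists>v\<in>V a U. u = t_op f v"
  using km_conjuncts(5,6) by blast+

lemma V_nilpotent: "p \<in> X \<Longrightarrow> \<exists>W n. open_in X W \<and> p \<in> W \<and>
        (\<forall>U. open_in X U \<and> U \<subseteq> W \<longrightarrow>
           (\<forall>u\<in>V a U. (s_plus f (of_rat a) ^^ n) u \<in> V_greater X V a U))"
  using km_conjuncts(7) by blast

lemma V_s_act: assumes "open_in X U" "u \<in> V a U" shows "s_act f q u \<in> V a U"
proof -
  obtain P where P: "P \<in> graph_D_s U" "\<forall>u\<in>nv_seqs U. P u = s_act f q u" using s_act_in_graph_D_s[OF assms(1)] by blast
  have "u \<in> nv_seqs U" using graph_module_nv_seqs V_graph assms by blast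
  then show ?thesis using V_op[OF assms(1) graph_D_s_subset_V0_D[OF P(1)] assms(2)] P(2) by simp
qed

text \<open>Membership in the stalk of \<open>V\<^sup>a\<close> at \<open>p\<close>; away from \<open>p\<close> the sequence is arbitrary.\<close>

definition V_germ :: "rat \<Rightarrow> 'a point \<Rightarrow> 'a seq \<Rightarrow> bool" where
  "V_germ a p u \<longleftrightarrow> (\<exists>W. open_in X W \<and> p \<in> W \<and> restr_seq W u \<in> V a W)"

lemma V_germ_restrict:
  assumes "open_in X W" "p \<in> W" "restr_seq W u \<in> V a W" "open_in X W'" "W' \<subseteq> W"
  shows "restr_seq W' u \<in> V a W'"
proof -
  have "restr_seq W' (restr_seq W u) = restr_seq W' u"
    using assms by (simp add: restr_seq_restr_seq Int_absorb2)
  then show ?thesis using V_restr[OF assms(1,4,5,3)] by simp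
qed

lemma V_germ_mono: "V_germ b p u \<Longrightarrow> a \<le> b \<Longrightarrow> V_germ a p u"
  unfolding V_germ_def using V_mono by blast

lemma V_germ_s_act: "V_germ a p u \<Longrightarrow> V_germ a p (s_act f q u)"
  unfolding V_germ_def using V_s_act by (metis s_act_restr_seq)

lemma V_germ_add:
  assumes "V_germ a p u" "V_germ a p v" shows "V_germ a p (\<lambda>j q. u j q + v j q)"
proof -
  obtain W W' where W: "open_in X W" "p \<in> W" "restr_seq W u \<in> V a W"
    and W': "open_in X W'" "p \<in> W'" "restr_seq W' v \<in> V a W'" using assms by (auto simp: V_germ_def)
  have O: "open_in X (W \<inter> W')" using W W' open_in_Int by blast
  have "(\<lambda>j q. restr_seq (W \<inter> W') u j q + restr_seq (W \<inter> W') v j q) \<in> V a (W \<inter> W')"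
    using V_germ_restrict[OF W O] V_germ_restrict[OF W' O] by (intro V_add O) auto
  also have "(\<lambda>j q. restr_seq (W \<inter> W') u j q + restr_seq (W \<inter> W') v j q) = restr_seq (W \<inter> W') (\<lambda>j q. u j q + v j q)"
    by (auto simp: restr_seq_apply fun_eq_iff)
  finally show ?thesis unfolding V_germ_def using O W W' by blast
qed

lemma V_germ_t_op: "V_germ a p u \<Longrightarrow> V_germ (a + 1) p (t_op f u)"
  unfolding V_germ_def using V_t by (metis t_op_restr_seq)

lemma V_germ_fpow: "V_germ c p (fpow i) \<Longrightarrow> V_germ (c + of_nat l) p (fpow (i + int l))"
proof (induction l)
  case (Suc l)
  have "V_germ (c + of_nat l + 1) p (fpow (i + int l + 1))"
    using V_germ_t_op[OF Suc.IH[OF Suc.prems]] unfolding t_op_fpow .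
  then show ?case by (simp add: algebra_simps)
qed simp

lemma V_germ_fpow_exists: assumes "p \<in> X" shows "\<exists>c. V_germ c p (fpow i)"
  using V_exhausts[OF open_in_self[OF X_proj] fpow_graph_module assms, of i] unfolding V_germ_def by blast

lemma V_germ_N_germ:
  assumes u: "N_germ p i u" and F: "V_germ c p (fpow i)" shows "V_germ c p u"
proof -
  obtain W1 where W1: "open_in X W1" "p \<in> W1"
    "\<And>W'. open_in X W' \<Longrightarrow> W' \<subseteq> W1 \<Longrightarrow> \<exists>P\<in>graph_D_s W'. restr_seq W' u = P (restr_seq W' (fpow i))"
    using N_germE[OF u] by blast
  obtain W where W: "open_in X W" "p \<in> W" "restr_seq W (fpow i) \<in> V c W" using F by (auto simp: V_germ_def)
  have O: "open_in X (W1 \<inter> W)" using W1 W open_in_Int by blast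
  obtain P where P: "P \<in> graph_D_s (W1 \<inter> W)" "restr_seq (W1 \<inter> W) u = P (restr_seq (W1 \<inter> W) (fpow i))"
    using W1(3)[OF O] by blast
  have "P (restr_seq (W1 \<inter> W) (fpow i)) \<in> V c (W1 \<inter> W)"
    using V_germ_restrict[OF W O] by (intro V_op[OF O graph_D_s_subset_V0_D[OF P(1)]]) auto
  then show ?thesis unfolding V_germ_def using O W W1 P(2) by (intro exI[of _ "W1 \<inter> W"]) auto
qed

lemma V_germ_discrete:
  assumes "p \<in> X"
  obtains r :: nat where "r > 0"
    "\<And>(i::int) a u. of_int i / of_nat r < a \<Longrightarrow> V_germ a p u \<Longrightarrow> V_germ (of_int (i + 1) / of_nat r) p u"
proof -
  obtain W and r :: nat where W: "open_in X W" "p \<in> W" "r > 0"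
    "\<forall>i::int. \<forall>a U. of_int i / of_nat r < a \<and> a \<le> of_int (i + 1) / of_nat r \<and>
           open_in X U \<and> U \<subseteq> W \<longrightarrow> V a U = V (of_int (i + 1) / of_nat r) U"
    using V_discrete[OF assms] by blast
  have "V_germ (of_int (i + 1) / of_nat r) p u" if a: "of_int i / of_nat r < a" and u: "V_germ a p u" for i :: int and a u
  proof (cases "a \<le> of_int (i + 1) / of_nat r")
    case True
    obtain W1 where W1: "open_in X W1" "p \<in> W1" "restr_seq W1 u \<in> V a W1" using u by (auto simp: V_germ_def)
    have O: "open_in X (W \<inter> W1)" using W W1 open_in_Int by blast
    have "restr_seq (W \<inter> W1) u \<in> V a (W \<inter> W1)" using V_germ_restrict[OF W1 O] by simp
    also have "V a (W \<inter> W1) = V (of_int (i + 1) / of_nat r) (W \<inter> W1)" using W(4) a True O by blast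
    finally show ?thesis unfolding V_germ_def using O W W1 by blast
  next
    case False
    then show ?thesis using V_germ_mono[OF u] by simp
  qed
  then show ?thesis using that W(3) by blast
qed

lemma V_greater_germ:
  assumes "open_in X U" "p \<in> U" "restr_seq U u \<in> V_greater X V a U"
  shows "\<exists>b>a. V_germ b p u"
proof -
  obtain W b where W: "open_in X W" "p \<in> W" "W \<subseteq> U" "a < b" "restr_seq W (restr_seq U u) \<in> V b W"
    using assms by (auto simp: V_greater_def)
  then have "restr_seq W u \<in> V b W" by (simp add: restr_seq_restr_seq Int_absorb2)
  then show ?thesis unfolding V_germ_def using W by blast
qed

lemma s_plus_power: "(s_plus f a ^^ n) u = s_act f ([:a, 1:] ^ n) u"
proof -
  have "s_act f [:a, 1:] = s_plus f a" using s_act_linear_poly by blast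
  then show ?thesis by (simp add: s_act_power)
qed

lemma V_germ_nilpotent:
  assumes "p \<in> X"
  obtains n where "\<And>u. V_germ a p u \<Longrightarrow> \<exists>b>a. V_germ b p (s_act f ([:of_rat a, 1:] ^ n) u)"
proof -
  obtain W n where W: "open_in X W" "p \<in> W"
    "\<forall>U. open_in X U \<and> U \<subseteq> W \<longrightarrow> (\<forall>u\<in>V a U. (s_plus f (of_rat a) ^^ n) u \<in> V_greater X V a U)"
    using V_nilpotent[OF assms] by blast
  have "\<exists>b>a. V_germ b p (s_act f ([:of_rat a, 1:] ^ n) u)" if u: "V_germ a p u" for u
  proof -
    obtain W1 where W1: "open_in X W1" "p \<in> W1" "restr_seq W1 u \<in> V a W1" using u by (auto simp: V_germ_def)
    have O: "open_in X (W \<inter> W1)" using W W1 open_in_Int by blast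
    have "restr_seq (W \<inter> W1) u \<in> V a (W \<inter> W1)" using V_germ_restrict[OF W1 O] by simp
    then have "(s_plus f (of_rat a) ^^ n) (restr_seq (W \<inter> W1) u) \<in> V_greater X V a (W \<inter> W1)"
      using W(3) O by blast
    then show ?thesis using V_greater_germ[OF O] W(2) W1(2) by (simp add: s_plus_power s_act_restr_seq)
  qed
  then show ?thesis using that by blast
qed

text \<open>The nilpotency index is the least \<open>n\<close> with this property, which every \<open>n\<close> has if \<open>\<alpha>\<close> is irrational.\<close>

definition annihilates :: "nat \<Rightarrow> complex \<Rightarrow> bool" where
  "annihilates n \<alpha> \<longleftrightarrow> (\<forall>a U. of_rat a = \<alpha> \<and> open_in X U \<longrightarrow>
     (\<forall>u\<in>V a U. (s_plus f \<alpha> ^^ n) u \<in> V_greater X V a U))"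

lemma annihilates_iff:
  "annihilates n \<alpha> \<longleftrightarrow> (\<forall>a p u. of_rat a = \<alpha> \<and> p \<in> X \<and> V_germ a p u \<longrightarrow>
     (\<exists>b>a. V_germ b p (s_act f ([:\<alpha>, 1:] ^ n) u)))" (is "?L \<longleftrightarrow> ?R")
proof
  assume L: ?L
  show ?R
  proof (intro allI impI, elim conjE)
    fix a p u assume a: "of_rat a = \<alpha>" and p: "p \<in> X" and u: "V_germ a p u"
    obtain W where W: "open_in X W" "p \<in> W" "restr_seq W u \<in> V a W" using u by (auto simp: V_germ_def)
    have "(s_plus f \<alpha> ^^ n) (restr_seq W u) \<in> V_greater X V a W" using L a W unfolding annihilates_def by blast
    then show "\<exists>b>a. V_germ b p (s_act f ([:\<alpha>, 1:] ^ n) u)"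
      using V_greater_germ[OF W(1,2)] by (simp add: s_plus_power s_act_restr_seq)
  qed
next
  assume R: ?R
  show ?L unfolding annihilates_def
  proof (intro allI impI ballI, elim conjE)
    fix a U u assume a: "of_rat a = \<alpha>" and U: "open_in X U" and u: "u \<in> V a U"
    let ?v = "s_act f ([:\<alpha>, 1:] ^ n) u"
    have "\<exists>W b. open_in X W \<and> p \<in> W \<and> W \<subseteq> U \<and> a < b \<and> restr_seq W ?v \<in> V b W" if p: "p \<in> U" for p
    proof -
      have "restr_seq U u \<in> V a U" using V_restr[OF U U _ u] by simp
      then have "V_germ a p u" unfolding V_germ_def using U p by blast
      then obtain b W where W: "b > a" "open_in X W" "p \<in> W" "restr_seq W ?v \<in> V b W"
        using R a p open_in_subset[OF U] unfolding V_germ_def by blast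
      have O: "open_in X (W \<inter> U)" using W U open_in_Int by blast
      show ?thesis using V_germ_restrict[OF W(2-4) O] O W p by (intro exI[of _ "W \<inter> U"] exI[of _ b]) auto
    qed
    then show "(s_plus f \<alpha> ^^ n) u \<in> V_greater X V a U"
      unfolding V_greater_def s_plus_power using V_s_act[OF U u] by blast
  qed
qed

section \<open>Deep steps of \<open>V\<close>\<close>

text \<open>\<open>V\<^sup>1\<close> has finitely many generators near \<open>p\<close>, so their poles and \<open>\<partial>\<^sub>t\<close>-degrees are bounded and a single \<open>J\<close> serves
for all of them, hence for all germs of \<open>V\<^sup>1\<close>.\<close>

lemma V_one_in_N:
  assumes p: "p \<in> X"
  shows "\<exists>J::nat. \<forall>u. V_germ 1 p u \<longrightarrow> N_germ p (- int J) u"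
proof -
  obtain W G where W: "open_in X W" "p \<in> W" "finite G" "G \<subseteq> V 1 W"
    "\<forall>U u q. open_in X U \<and> U \<subseteq> W \<and> u \<in> V 1 U \<and> q \<in> U \<longrightarrow>
       (\<exists>U'. open_in X U' \<and> q \<in> U' \<and> U' \<subseteq> U \<and> restr_seq U' u \<in> V0_span X f U' (restr_seq U' ` G))"
    using bspec[OF V_coh[of 1, unfolded V0_coherent_def] p] by (elim exE conjE) (rule that)
  have "\<exists>J::nat. \<forall>g\<in>G. N_germ p (- int J) g" using W(3,4)
  proof (induction rule: finite_induct)
    case (insert g G)
    then obtain J where J: "\<forall>g\<in>G. N_germ p (- int J) g" by auto
    obtain J' where J': "N_germ p (- int J') g"
      using N_germ_exhausts[OF W(1,2) V_graph[OF W(1)]] insert.prems by blast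
    have "N_germ p (- int (max J J')) h" if "h \<in> insert g G" for h
      using that J J' N_germ_lower[of p "- int J" h "- int (max J J')"]
        N_germ_lower[of p "- int J'" h "- int (max J J')"] p by auto
    then show ?case by blast
  qed simp
  then obtain J where J: "\<And>g. g \<in> G \<Longrightarrow> N_germ p (- int J) g" by blast
  have "N_germ p (- int J) u" if u: "V_germ 1 p u" for u
  proof -
    obtain W1 where W1: "open_in X W1" "p \<in> W1" "restr_seq W1 u \<in> V 1 W1" using u by (auto simp: V_germ_def)
    have O: "open_in X (W \<inter> W1)" using W W1 open_in_Int by blast
    have "restr_seq (W \<inter> W1) u \<in> V 1 (W \<inter> W1)" using V_germ_restrict[OF W1 O] by simp
    then obtain U' where U': "open_in X U'" "p \<in> U'" "U' \<subseteq> W \<inter> W1"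
      "restr_seq U' (restr_seq (W \<inter> W1) u) \<in> V0_span X f U' (restr_seq U' ` G)"
      using W(2,5) W1(2) O by blast
    have "N_germ p (- int J) v" if "v \<in> V0_span X f U' (restr_seq U' ` G)" for v using that
    proof induction
      case zero
      show ?case using N_germ_zero[OF p] .
    next
      case (add P g' v)
      then obtain g where g: "g \<in> G" "g' = restr_seq U' g" by auto
      have "N_germ p (- int J) g'"
        by (rule N_germ_local[OF J[OF g(1)] U'(1,2)]) (simp add: g(2) restr_seq_restr_seq)
      moreover have "g' \<in> nv_seqs U'"
      proof -
        have "g' \<in> V 1 U'" unfolding g(2) using W(4) U'(3) g(1) by (intro V_restr[OF W(1) U'(1)]) auto
        then show ?thesis by (rule graph_module_nv_seqs[OF U'(1) V_graph[OF U'(1)]])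
      qed
      ultimately have "N_germ p (- int J) (P g')" using N_germ_V0_D[OF add(1) U'(1,2)] by blast
      then show ?case using add(4) by (rule N_germ_add)
    qed
    from this[OF U'(4)] show ?thesis
      by (rule N_germ_local[OF _ U'(1,2)]) (use U'(3) in \<open>simp add: restr_seq_restr_seq Int_absorb2\<close>)
  qed
  then show ?thesis by blast
qed

text \<open>\<open>V\<^sup>1\<^sup>+\<^sup>M = t\<^sup>M V\<^sup>1\<close>, and \<open>t\<^sup>M\<close> carries \<open>N\<^sub>-\<^sub>J\<close> into \<open>N\<^sub>M\<^sub>-\<^sub>J\<close>.\<close>

lemma V_deep_in_N:
  assumes p: "p \<in> X"
  obtains J :: nat where "\<And>M u. V_germ (1 + of_nat M) p u \<Longrightarrow> N_germ p (int M - int J) u"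
proof -
  obtain J :: nat where J: "\<And>u. V_germ 1 p u \<Longrightarrow> N_germ p (- int J) u" using V_one_in_N[OF p] by blast
  have "N_germ p (int M - int J) u" if "V_germ (1 + of_nat M) p u" for M u using that
  proof (induction M arbitrary: u)
    case 0
    then show ?case using J by simp
  next
    case (Suc M)
    obtain W where W: "open_in X W" "p \<in> W" "restr_seq W u \<in> V (1 + of_nat (Suc M)) W"
      using Suc.prems by (auto simp: V_germ_def)
    then have "restr_seq W u \<in> V ((1 + of_nat M) + 1) W" by (simp add: algebra_simps)
    then obtain y where y: "y \<in> V (1 + of_nat M) W" "restr_seq W u = t_op f y"
      using V_t_surj[OF _ W(1), of "1 + of_nat M"] by force
    have "restr_seq W y \<in> V (1 + of_nat M) W" using V_restr[OF W(1,1) _ y(1)] by simp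
    then have "V_germ (1 + of_nat M) p y" unfolding V_germ_def using W by blast
    then have "N_germ p (int M - int J + 1) (t_op f y)" using Suc.IH N_germ_t_op by blast
    moreover have "restr_seq W u = restr_seq W (t_op f y)"
      using y(2) by (metis restr_seq_restr_seq inf.idem)
    ultimately have "N_germ p (int M - int J + 1) u" using N_germ_local[OF _ W(1,2)] by blast
    then show ?case by (simp add: algebra_simps)
  qed
  then show ?thesis using that by blast
qed

section \<open>Multiplicity and nilpotency\<close>

text \<open>\<open>Q\<close> is the product of \<open>b(s + l)\<close> for \<open>i \<le> l < j\<close>, each factor carrying \<open>N\<^sub>l\<close> into \<open>N\<^sub>l\<^sub>+\<^sub>1\<close>.\<close>

lemma bernstein_sato_chain:
  assumes p: "p \<in> X" and b: "N_germ p 1 (s_act f b (fpow 0))"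
    and "i \<le> j" and "\<And>l. i \<le> l \<Longrightarrow> l < j \<Longrightarrow> poly b (of_int l - \<alpha>) \<noteq> 0"
  shows "\<exists>Q. poly Q (- \<alpha>) \<noteq> 0 \<and> (\<forall>u. N_germ p i u \<longrightarrow> N_germ p j (s_act f Q u))"
  using assms(3,4)
proof (induction j rule: int_ge_induct)
  case base
  show ?case by (intro exI[of _ 1]) simp
next
  case (step j)
  then obtain Q where Q: "poly Q (- \<alpha>) \<noteq> 0" "\<forall>u. N_germ p i u \<longrightarrow> N_germ p j (s_act f Q u)" by force
  let ?b = "pcompose b [:of_int j, 1:]"
  have "N_germ p (1 + j) (s_act f ?b (fpow (0 + j)))" using N_germ_shift[OF b p] .
  then have "N_germ p (j + 1) (s_act f ?b (fpow j))" by (simp add: add.commute)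
  then have "N_germ p (j + 1) (s_act f (?b * Q) u)" if "N_germ p i u" for u
    unfolding s_act_mult using N_germ_poly Q(2) that by blast
  moreover have "poly (?b * Q) (- \<alpha>) \<noteq> 0"
    using Q(1) step.prems[of j] step.hyps by (simp add: poly_pcompose)
  ultimately show ?case by blast
qed

lemma bs_equation_closed:
  assumes k: "k > 0"
  shows "bs_equation X (\<lambda>p. f p ^ k) b \<Longrightarrow> bs_equation X (\<lambda>p. f p ^ k) c \<Longrightarrow> bs_equation X (\<lambda>p. f p ^ k) (b + c)"
    and "bs_equation X (\<lambda>p. f p ^ k) b \<Longrightarrow> bs_equation X (\<lambda>p. f p ^ k) (q * b)"
  unfolding bs_equation_iff_N_germ[OF k]
  by (auto simp: pcompose_add pcompose_mult s_act_add s_act_mult intro: N_germ_add N_germ_s_act)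

lemma bs_equation_rescaled_iff:
  assumes k: "k > 0"
  shows "bs_equation X (\<lambda>p. f p ^ k) (pcompose q [:0, of_nat k:]) \<longleftrightarrow> (\<forall>p\<in>X. N_germ p (int k) (s_act f q (fpow 0)))"
proof -
  have "pcompose [:0, of_nat k:] [:0, 1 / of_nat k:] = [:0, 1::complex:]"
    using k by (simp add: pcompose_pCons)
  then have "pcompose (pcompose q [:0, of_nat k:]) [:0, 1 / of_nat k:] = q"
    by (simp only: pcompose_assoc[symmetric] pcompose_idR)
  then show ?thesis unfolding bs_equation_iff_N_germ[OF k] by simp
qed

end

context km_filtration begin

text \<open>\<open>D\<close> is a product of powers of \<open>s + l / r\<close> with \<open>i \<le> l < j\<close>, one for each possible jump.  Only the factor
with \<open>l / r = \<alpha>\<close>, if there is one, vanishes at \<open>-\<alpha>\<close>, and there the exponent \<open>n\<close> suffices.\<close>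

lemma V_germ_push:
  assumes p: "p \<in> X" and n: "annihilates n \<alpha>"
  obtains r :: nat where "r > 0" "\<And>i j. i \<le> j \<Longrightarrow> \<exists>D. D \<noteq> 0 \<and> order (- \<alpha>) D \<le> n \<and>
    (\<forall>u. V_germ (of_int i / of_nat r) p u \<longrightarrow> V_germ (of_int j / of_nat r) p (s_act f D u))"
proof -
  obtain r :: nat where r: "r > 0"
    "\<And>(i::int) a u. of_int i / of_nat r < a \<Longrightarrow> V_germ a p u \<Longrightarrow> V_germ (of_int (i + 1) / of_nat r) p u"
    using V_germ_discrete[OF p] by blast
  have push: "\<exists>D. D \<noteq> 0 \<and> order (- \<alpha>) D \<le> (if \<exists>l<j. of_rat (of_int l / of_nat r) = \<alpha> then n else 0) \<and>
    (\<forall>u. V_germ (of_int i / of_nat r) p u \<longrightarrow> V_germ (of_int j / of_nat r) p (s_act f D u))" if "i \<le> j" for i j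
    using that
  proof (induction j rule: int_ge_induct)
    case base
    show ?case by (intro exI[of _ 1]) (simp add: order_0I)
  next
    case (step j)
    let ?a = "of_int j / of_nat r :: rat"
    obtain D where D: "D \<noteq> 0" "order (- \<alpha>) D \<le> (if \<exists>l<j. of_rat (of_int l / of_nat r) = \<alpha> then n else 0)"
      "\<And>u. V_germ (of_int i / of_nat r) p u \<Longrightarrow> V_germ ?a p (s_act f D u)"
      using step.IH by blast
    have "\<exists>m. order (- \<alpha>) ([:of_rat ?a, 1:] ^ m) \<le> (if of_rat ?a = \<alpha> then n else 0) \<and>
      (\<forall>u. V_germ ?a p u \<longrightarrow> (\<exists>b>?a. V_germ b p (s_act f ([:of_rat ?a, 1:] ^ m) u)))"
    proof (cases "of_rat ?a = \<alpha>")
      case True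
      have "order (- \<alpha>) ([:\<alpha>, 1:] ^ n) = n" using order_power_n_n[of "- \<alpha>" n] by simp
      then show ?thesis using n p True unfolding annihilates_iff by (intro exI[of _ n]) auto
    next
      case False
      obtain m where "\<And>u. V_germ ?a p u \<Longrightarrow> \<exists>b>?a. V_germ b p (s_act f ([:of_rat ?a, 1:] ^ m) u)"
        using V_germ_nilpotent[OF p] by blast
      moreover have "order (- \<alpha>) ([:of_rat ?a, 1:] ^ m) = 0"
        using False by (intro order_0I) simp
      ultimately show ?thesis by (intro exI[of _ m]) auto
    qed
    then obtain m where m: "order (- \<alpha>) ([:of_rat ?a, 1:] ^ m) \<le> (if of_rat ?a = \<alpha> then n else 0)"
      "\<And>u. V_germ ?a p u \<Longrightarrow> \<exists>b>?a. V_germ b p (s_act f ([:of_rat ?a, 1:] ^ m) u)" by blast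
    let ?D = "[:of_rat ?a, 1:] ^ m * D"
    have nz: "?D \<noteq> 0" using D(1) by simp
    \<comment> \<open>The factor \<open>s + \<alpha>\<close> occurs for one index only, so the bound \<open>n\<close> is not used twice.\<close>
    have not_both: "\<not> (\<exists>l<j. of_rat (of_int l / of_nat r) = \<alpha>)" if "of_rat ?a = \<alpha>"
      using that r(1) by (auto simp: of_rat_divide)
    have "order (- \<alpha>) ?D = order (- \<alpha>) ([:of_rat ?a, 1:] ^ m) + order (- \<alpha>) D" by (rule order_mult[OF nz])
    also have "\<dots> \<le> (if \<exists>l<j + 1. of_rat (of_int l / of_nat r) = \<alpha> then n else 0)"
    proof (cases "of_rat ?a = \<alpha>")
      case True
      then have "\<exists>l<j + 1. of_rat (of_int l / of_nat r) = \<alpha>" by (intro exI[of _ j]) simp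
      then show ?thesis using D(2) m(1) True not_both[OF True] by simp
    next
      case False
      have "\<exists>l<j + 1. of_rat (of_int l / of_nat r) = \<alpha>" if ex: "\<exists>l<j. of_rat (of_int l / of_nat r) = \<alpha>"
      proof -
        obtain l where "l < j" "of_rat (of_int l / of_nat r) = \<alpha>" using ex by blast
        then show ?thesis by (intro exI[of _ l]) simp
      qed
      then show ?thesis using D(2) m(1) False by (cases "\<exists>l<j. of_rat (of_int l / of_nat r) = \<alpha>") auto
    qed
    finally have "order (- \<alpha>) ?D \<le> (if \<exists>l<j + 1. of_rat (of_int l / of_nat r) = \<alpha> then n else 0)" .
    moreover have "V_germ (of_int (j + 1) / of_nat r) p (s_act f ?D u)" if "V_germ (of_int i / of_nat r) p u" for u
      using m(2)[OF D(3)[OF that]] r(2) unfolding s_act_mult by blast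
    ultimately show ?case using nz by blast
  qed
  have "\<exists>D. D \<noteq> 0 \<and> order (- \<alpha>) D \<le> n \<and>
    (\<forall>u. V_germ (of_int i / of_nat r) p u \<longrightarrow> V_germ (of_int j / of_nat r) p (s_act f D u))" if "i \<le> j" for i j
  proof -
    obtain D where D: "D \<noteq> 0" "order (- \<alpha>) D \<le> (if \<exists>l<j. of_rat (of_int l / of_nat r) = \<alpha> then n else 0)"
      "\<forall>u. V_germ (of_int i / of_nat r) p u \<longrightarrow> V_germ (of_int j / of_nat r) p (s_act f D u)"
      using push[OF \<open>i \<le> j\<close>] by blast
    have "order (- \<alpha>) D \<le> n" using D(2) by (simp split: if_splits)
    then show ?thesis using D by blast
  qed
  then show ?thesis using that r(1) by blast
qed

text \<open>The argument runs with \<open>f\<^sup>s\<^sup>+\<^sup>i\<close> instead of \<open>f\<^sup>s\<close>, so that the eigenvalue \<open>-\<beta>\<close> on \<open>N\<^sub>0\<close> is met as \<open>-\<alpha>\<close>, at the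
index where the nilpotency of the graded piece is known.\<close>

lemma annihilates_imp_local_equation:
  assumes p: "p \<in> X" and n: "annihilates n \<alpha>" and \<alpha>: "\<alpha> = \<beta> + of_int i"
  shows "\<exists>D. D \<noteq> 0 \<and> order (- \<beta>) D \<le> n \<and> N_germ p (int k) (s_act f D (fpow 0))"
proof -
  obtain c where c: "V_germ c p (fpow i)" using V_germ_fpow_exists[OF p] by blast
  obtain r :: nat where r: "r > 0" "\<And>i j. i \<le> j \<Longrightarrow> \<exists>D. D \<noteq> 0 \<and> order (- \<alpha>) D \<le> n \<and>
    (\<forall>u. V_germ (of_int i / of_nat r) p u \<longrightarrow> V_germ (of_int j / of_nat r) p (s_act f D u))"
    by (rule V_germ_push[OF p n]) (rule that)
  obtain J :: nat where J: "\<And>M u. V_germ (1 + of_nat M) p u \<Longrightarrow> N_germ p (int M - int J) u"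
    using V_deep_in_N[OF p] by blast
  define i0 where "i0 = \<lfloor>c * of_nat r\<rfloor>"
  have "of_int i0 / of_nat r \<le> c" using r(1) by (simp add: i0_def divide_le_eq)
  then have F: "V_germ (of_int i0 / of_nat r) p (fpow i)" using V_germ_mono[OF c] by blast
  \<comment> \<open>The first summand makes \<open>V\<^sup>1\<^sup>+\<^sup>M\<close> lie in \<open>N\<^sub>i\<^sub>+\<^sub>k\<close>, the second puts \<open>1 + M\<close> above the starting index.\<close>
  define M where "M = nat (i + int k + int J) + nat i0"
  define j0 where "j0 = int r * (1 + int M)"
  have "i0 \<le> int M" by (simp add: M_def)
  also have "\<dots> \<le> 1 * (1 + int M)" by simp
  also have "\<dots> \<le> j0" unfolding j0_def using r(1) by (intro mult_right_mono) auto
  finally obtain D where D: "D \<noteq> 0" "order (- \<alpha>) D \<le> n"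
    "\<And>u. V_germ (of_int i0 / of_nat r) p u \<Longrightarrow> V_germ (of_int j0 / of_nat r) p (s_act f D u)"
    using r(2) by blast
  have "of_int j0 / of_nat r = (1 + of_nat M :: rat)" using r(1) by (simp add: j0_def)
  then have "V_germ (1 + of_nat M) p (s_act f D (fpow i))" using D(3)[OF F] by simp
  then have "N_germ p (int M - int J) (s_act f D (fpow i))" by (rule J)
  then have "N_germ p (int k + i) (s_act f D (fpow i))" by (rule N_germ_lower) (use p in \<open>auto simp: M_def\<close>)
  from N_germ_shift[OF this p, of "- i"]
  have "N_germ p (int k) (s_act f (pcompose D [:of_int (- i), 1:]) (fpow 0))" by simp
  moreover have "order (- \<beta>) (pcompose D [:of_int (- i), 1:]) = order (- \<alpha>) D"
  proof -
    have "- \<alpha> = of_int (- i) + 1 * (- \<beta>)" by (simp add: \<alpha>)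
    then show ?thesis using D(1) order_pcompose_linear[of 1 D "- \<beta>" "of_int (- i)"] by simp
  qed
  moreover have "pcompose D [:of_int (- i), 1:] \<noteq> 0" using D(1) by (simp add: pcompose_eq_0_iff)
  ultimately show ?thesis using D(2) by metis
qed

text \<open>If \<open>B = (s + \<beta>)\<^sup>m c(s)\<close> with \<open>m > n\<close>, then near each point \<open>(s + \<beta>)\<^sup>n c(s)\<close> would carry \<open>N\<^sub>0\<close> into \<open>N\<^sub>k\<close>: a power of
\<open>s + \<beta>\<close> times it is \<open>B\<close>, and a factor prime to \<open>s + \<beta>\<close> times it is a multiple of the local polynomial \<open>D\<close>.\<close>

lemma order_le_annihilates:
  assumes n: "annihilates n \<alpha>" and \<alpha>: "\<alpha> = \<beta> + of_int i" and B: "B \<noteq> 0"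
    and eq: "\<And>p. p \<in> X \<Longrightarrow> N_germ p (int k) (s_act f B (fpow 0))"
    and minimal: "\<And>q. (\<And>p. p \<in> X \<Longrightarrow> N_germ p (int k) (s_act f q (fpow 0))) \<Longrightarrow> B dvd q"
  shows "order (- \<beta>) B \<le> n"
proof (rule ccontr)
  assume "\<not> order (- \<beta>) B \<le> n"
  then obtain d where m: "order (- \<beta>) B = d + n" using nat_le_linear le_Suc_ex by (metis add.commute)
  let ?x = "[:\<beta>, 1:]"
  obtain c where c: "B = ?x ^ (d + n) * c" "\<not> ?x dvd c"
    using order_decomp[OF B, of "- \<beta>"] m by auto
  have "N_germ p (int k) (s_act f (?x ^ n * c) (fpow 0))" if p: "p \<in> X" for p
  proof -
    let ?I = "{q. N_germ p (int k) (s_act f q (fpow 0))}"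
    obtain D where D: "D \<noteq> 0" "order (- \<beta>) D \<le> n" "N_germ p (int k) (s_act f D (fpow 0))"
      using annihilates_imp_local_equation[OF p n \<alpha>] by blast
    obtain D' where D': "D = ?x ^ order (- \<beta>) D * D'" "\<not> ?x dvd D'"
      using order_decomp[OF D(1), of "- \<beta>"] by auto
    have add: "q + r \<in> ?I" if "q \<in> ?I" "r \<in> ?I" for q r using that N_germ_add by (simp add: s_act_add)
    have mult: "r * q \<in> ?I" if "q \<in> ?I" for q r using that N_germ_s_act by (simp add: s_act_mult)
    have "?x ^ n * c \<in> ?I"
    proof (rule ideal_cancel_coprime[OF add mult])
      show "?x ^ d * (?x ^ n * c) \<in> ?I" using eq[OF p] c(1) by (simp only: power_add mult.assoc mem_Collect_eq)
      obtain e where e: "n = e + order (- \<beta>) D" using D(2) le_Suc_ex by (metis add.commute)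
      have "(?x ^ e * c) * D \<in> ?I" using D(3) by (intro mult) simp
      also have "(?x ^ e * c) * D = D' * (?x ^ n * c)"
        by (subst e, subst D'(1)) (simp only: power_add mult_ac)
      finally show "D' * (?x ^ n * c) \<in> ?I" .
      show "poly D' (- \<beta>) \<noteq> 0" using D'(2) by (simp add: poly_eq_0_iff_dvd)
    qed
    then show ?thesis by simp
  qed
  then have dvd: "B dvd ?x ^ n * c" using minimal by blast
  have nz: "?x ^ n * c \<noteq> 0" using c B by auto
  have "order (- \<beta>) B \<le> order (- \<beta>) (?x ^ n * c)" using dvd_imp_order_le[OF nz dvd] .
  also have "\<dots> = n"
  proof -
    have "order (- \<beta>) c = 0" using c(2) by (intro order_0I) (simp add: poly_eq_0_iff_dvd)
    then show ?thesis using order_power_n_n[of "- \<beta>" n] by (simp add: order_mult[OF nz])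
  qed
  finally show False using \<open>\<not> order (- \<beta>) B \<le> n\<close> by simp
qed

text \<open>\<open>u\<close> travels from \<open>N\<^sub>-\<^sub>J\<close> through \<open>N\<^sub>i\<close> and \<open>N\<^sub>i\<^sub>+\<^sub>k\<close> to a part of \<open>N\<close> inside \<open>V\<^sup>>\<^sup>a\<close>; only the middle step uses a
polynomial that may vanish at \<open>-\<alpha>\<close>.\<close>

lemma annihilates_order:
  assumes \<alpha>: "\<alpha> = \<beta> + of_int i" and B: "B \<noteq> 0"
    and b: "\<And>p. p \<in> X \<Longrightarrow> N_germ p 1 (s_act f b (fpow 0))"
    and eq: "\<And>p. p \<in> X \<Longrightarrow> N_germ p (int k) (s_act f B (fpow 0))"
    and low: "\<And>l. l < i \<Longrightarrow> poly b (of_int l - \<alpha>) \<noteq> 0"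
    and high: "\<And>l. i + int k \<le> l \<Longrightarrow> poly b (of_int l - \<alpha>) \<noteq> 0"
  shows "annihilates (order (- \<beta>) B) \<alpha>"
  unfolding annihilates_iff
proof (intro allI impI, elim conjE)
  fix a p u assume a: "of_rat a = \<alpha>" and p: "p \<in> X" and u: "V_germ a p u"
  obtain W where W: "open_in X W" "p \<in> W" "restr_seq W u \<in> V a W" using u by (auto simp: V_germ_def)
  obtain J :: nat where "N_germ p (- int J) (restr_seq W u)"
    using N_germ_exhausts[OF W(1,2) V_graph[OF W(1,3)]] by blast
  then have "N_germ p (- int J) u" by (rule N_germ_local[OF _ W(1,2)]) (simp add: restr_seq_restr_seq)
  then have 1: "N_germ p (min i (- int J)) u" by (rule N_germ_lower) (use p in auto)
  obtain Q where Q: "poly Q (- \<alpha>) \<noteq> 0" "\<And>u. N_germ p (min i (- int J)) u \<Longrightarrow> N_germ p i (s_act f Q u)"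
    using bernstein_sato_chain[OF p b[OF p], of "min i (- int J)" i \<alpha>] low by auto
  define B' where "B' = pcompose B [:of_int i, 1:]"
  have "N_germ p (int k + i) (s_act f B' (fpow i))" using N_germ_shift[OF eq[OF p] p, of i] by (simp add: B'_def)
  then have 2: "N_germ p (i + int k) (s_act f B' (s_act f Q u))" using N_germ_poly[OF Q(2)[OF 1]] by (simp add: add.commute)
  obtain c where c: "V_germ c p (fpow (i + int k))" using V_germ_fpow_exists[OF p] by blast
  obtain L :: nat where L: "a < c + of_nat L" using reals_Archimedean2[of "a - c"] by (auto simp: algebra_simps)
  have F: "V_germ (c + of_nat L) p (fpow (i + int k + int L))" using V_germ_fpow[OF c] .
  obtain Q' where Q': "poly Q' (- \<alpha>) \<noteq> 0" "\<And>u. N_germ p (i + int k) u \<Longrightarrow> N_germ p (i + int k + int L) (s_act f Q' u)"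
    using bernstein_sato_chain[OF p b[OF p], of "i + int k" "i + int k + int L" \<alpha>] high by auto
  have 3: "V_germ (c + of_nat L) p (s_act f (Q' * (B' * Q)) u)"
    unfolding s_act_mult by (rule V_germ_N_germ[OF Q'(2)[OF 2] F])
  have B': "B' \<noteq> 0" "order (- \<alpha>) B' = order (- \<beta>) B"
    using B by (simp_all add: B'_def pcompose_eq_0_iff order_pcompose_linear \<alpha>)
  let ?x = "[:\<alpha>, 1:]" and ?m = "order (- \<beta>) B"
  obtain C where C: "B' = ?x ^ ?m * C" "\<not> ?x dvd C"
    using order_decomp[OF B'(1), of "- \<alpha>"] B'(2) by auto
  obtain n where n: "\<And>u. V_germ a p u \<Longrightarrow> \<exists>b>a. V_germ b p (s_act f ([:of_rat a, 1:] ^ n) u)"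
    using V_germ_nilpotent[OF p] by blast
  \<comment> \<open>The ideal of polynomials carrying \<open>u\<close> into \<open>V\<^sup>>\<^sup>a\<close> contains a power of \<open>s + \<alpha>\<close> and \<open>Q' * (B' * Q)\<close>.\<close>
  let ?I = "{q. \<exists>b>a. V_germ b p (s_act f q u)}"
  have "?x ^ ?m \<in> ?I"
  proof (rule ideal_cancel_coprime)
    fix q r
    show "q + r \<in> ?I" if qr: "q \<in> ?I" "r \<in> ?I"
    proof -
      obtain b b' where "b > a" "V_germ b p (s_act f q u)" "b' > a" "V_germ b' p (s_act f r u)" using qr by auto
      then have "V_germ (min b b') p (s_act f (q + r) u)" "min b b' > a"
        unfolding s_act_add by (auto intro!: V_germ_add intro: V_germ_mono)
      then show ?thesis by blast
    qed
    show "r * q \<in> ?I" if q: "q \<in> ?I"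
    proof -
      obtain b where "b > a" "V_germ b p (s_act f q u)" using q by auto
      then show ?thesis using V_germ_s_act[of b p "s_act f q u" r] by (auto simp: s_act_mult)
    qed
  next
    show "?x ^ n * ?x ^ ?m \<in> ?I"
    proof -
      obtain b where "b > a" and g: "V_germ b p (s_act f (?x ^ n) u)" using n[OF u] a by auto
      have "V_germ b p (s_act f (?x ^ ?m * ?x ^ n) u)" unfolding s_act_mult by (rule V_germ_s_act[OF g])
      then have "?x ^ ?m * ?x ^ n \<in> ?I" using \<open>b > a\<close> by blast
      then show ?thesis by (simp only: mult.commute)
    qed
    have eq: "(Q' * C * Q) * ?x ^ ?m = Q' * (B' * Q)" by (subst C(1)) (simp only: mult_ac)
    show "(Q' * C * Q) * ?x ^ ?m \<in> ?I"
      unfolding eq by (intro CollectI exI[of _ "c + of_nat L"] conjI 3 L)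
    show "poly (Q' * C * Q) (- \<alpha>) \<noteq> 0" using Q(1) Q'(1) C(2) by (simp add: poly_eq_0_iff_dvd)
  qed
  then show "\<exists>b>a. V_germ b p (s_act f (?x ^ ?m) u)" by simp
qed

end

theorem corollary1p9:
  fixes X :: "'n::finite point set"
    and f :: "'n point \<Rightarrow> complex"
    and V :: "rat \<Rightarrow> 'n point set \<Rightarrow> 'n seq set"
    and \<alpha> \<beta> \<gamma> :: complex
    and k :: nat
  assumes "quasi_projective_manifold X"
    and "f \<in> hol X"
    and "\<not> (\<exists>g\<in>hol X. \<forall>p\<in>X. f p * g p = 1)"
    and "\<exists>U. open_in X U \<and> localization X f U \<noteq> {\<lambda>_. 0}"
    and "kashiwara_malgrange X f V"
    and "poly (bernstein_sato X f) (- \<beta>) = 0" and "\<alpha> - \<beta> \<in> \<int>"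
    and "\<forall>\<rho>. poly (bernstein_sato X f) \<rho> = 0 \<and> \<rho> + \<alpha> \<in> \<int> \<longrightarrow> - \<beta> \<le> \<rho>"
    and "poly (bernstein_sato X f) (- \<gamma>) = 0" and "\<alpha> - \<gamma> \<in> \<int>"
    and "\<forall>\<rho>. poly (bernstein_sato X f) \<rho> = 0 \<and> \<rho> + \<alpha> \<in> \<int> \<longrightarrow> \<rho> \<le> - \<gamma>"
    and "of_nat k \<ge> \<beta> - \<gamma> + 1"
  shows "nilpotency_index X f V \<alpha> =
         order (- \<beta> / of_nat k) (bernstein_sato X (\<lambda>p. f p ^ k))"
proof -
  have "X \<subseteq> proj_space"
    using assms(1) by (auto simp: quasi_projective_manifold_def zariski_closed_def)
  then interpret km_filtration X f V
    using assms(2,5) by unfold_locales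
  let ?b = "bernstein_sato X f" and ?bk = "bernstein_sato X (\<lambda>p. f p ^ k)"
  obtain i where i: "\<alpha> = \<beta> + of_int i" using assms(7) by (auto elim!: Ints_cases simp: algebra_simps)
  have "- \<gamma> + \<alpha> \<in> \<int>" using assms(10) by simp
  then have "- \<beta> \<le> - \<gamma>" using assms(8,9) by blast
  then have "Re \<beta> \<ge> Re \<gamma>" by (simp add: less_eq_complex_def)
  moreover have k_ge: "real k \<ge> Re \<beta> - Re \<gamma> + 1" using assms(12) by (simp add: less_eq_complex_def)
  ultimately have k: "k > 0" by (cases k) auto
  have b_nz: "?b \<noteq> 0"
  proof
    assume "?b = 0"
    then have "- \<beta> \<le> - \<beta> - 1" using assms(8) i by simp
    then show False by (simp add: less_eq_complex_def)
  qed
  have f1: "(\<lambda>p. f p ^ 1) = f" by simp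
  have b_eq: "bs_equation X f ?b"
  proof -
    obtain c where "is_bernstein_sato X f c" using b_nz unfolding bernstein_sato_def by (auto split: if_splits)
    then have "bs_equation X f c" "c \<noteq> 0" by (auto simp: is_bernstein_sato_def)
    then show ?thesis
      using bernstein_sato_generates(2)[of X f c] bs_equation_closed[of 1] unfolding f1 by simp
  qed
  then have b: "N_germ p 1 (s_act f ?b (fpow 0))" if "p \<in> X" for p
    using that bs_equation_iff_N_germ[of 1 ?b] unfolding f1 by (simp add: pcompose_idR)
  \<comment> \<open>The product of \<open>b\<^sub>f(s + l)\<close> for \<open>l < k\<close> shows that \<open>f\<^sup>k\<close> has a Bernstein-Sato polynomial.\<close>
  have "\<exists>Q. Q \<noteq> 0 \<and> (\<forall>p\<in>X. N_germ p (int l) (s_act f Q (fpow 0)))" for l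
  proof (induction l)
    case 0
    show ?case by (intro exI[of _ 1]) (simp add: N_germ_self)
  next
    case (Suc l)
    then obtain Q where Q: "Q \<noteq> 0" "\<forall>p\<in>X. N_germ p (int l) (s_act f Q (fpow 0))" by blast
    have "N_germ p (int (Suc l)) (s_act f (pcompose ?b [:of_int (int l), 1:] * Q) (fpow 0))" if p: "p \<in> X" for p
      using N_germ_poly[OF bspec[OF Q(2) p], of "1 + int l"] N_germ_shift[OF b[OF p] p, of "int l"]
      unfolding s_act_mult by simp
    moreover have "pcompose ?b [:of_int (int l), 1:] * Q \<noteq> 0" using Q(1) b_nz by (simp add: pcompose_eq_0_iff)
    ultimately show ?case by blast
  qed
  then obtain Q where Q: "Q \<noteq> 0" "\<forall>p\<in>X. N_germ p (int k) (s_act f Q (fpow 0))" by blast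
  have "pcompose Q [:0, of_nat k:] \<noteq> 0" using Q(1) k by (simp add: pcompose_eq_0_iff)
  note bk = bernstein_sato_generates[OF bs_equation_closed[OF k] iffD2[OF bs_equation_rescaled_iff[OF k] Q(2)] this]
  define B where "B = pcompose ?bk [:0, 1 / of_nat k:]"
  have bk_nz: "?bk \<noteq> 0" using bk(1) by auto
  have B_nz: "B \<noteq> 0" using bk_nz k by (simp add: B_def pcompose_eq_0_iff)
  have B_order: "order (- \<beta>) B = order (- \<beta> / of_nat k) ?bk"
    using bk_nz k by (simp add: B_def order_pcompose_linear)
  have B_eq: "N_germ p (int k) (s_act f B (fpow 0))" if "p \<in> X" for p
    using bk(2) that unfolding bs_equation_iff_N_germ[OF k] B_def by blast
  have B_min: "B dvd q" if "\<And>p. p \<in> X \<Longrightarrow> N_germ p (int k) (s_act f q (fpow 0))" for q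
  proof -
    have "?bk dvd pcompose q [:0, of_nat k:]" using bk(3) bs_equation_rescaled_iff[OF k] that by blast
    then obtain r where "pcompose q [:0, of_nat k:] = ?bk * r" by auto
    then have "pcompose (pcompose q [:0, of_nat k:]) [:0, 1 / of_nat k:] = B * pcompose r [:0, 1 / of_nat k:]"
      by (simp add: B_def pcompose_mult)
    moreover have "pcompose [:0, of_nat k:] [:0, 1 / of_nat k:] = [:0, 1::complex:]"
      using k by (simp add: pcompose_pCons)
    ultimately show ?thesis by (simp add: pcompose_assoc[symmetric] pcompose_idR)
  qed
  have ann: "annihilates (order (- \<beta>) B) \<alpha>"
  proof (rule annihilates_order[OF i B_nz b B_eq])
    show "poly ?b (of_int l - \<alpha>) \<noteq> 0" if "l < i" for l
    proof
      assume "poly ?b (of_int l - \<alpha>) = 0"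
      then have "- \<beta> \<le> of_int l - \<alpha>" using assms(8) by simp
      then have "of_int i \<le> (of_int l :: real)" by (simp add: i less_eq_complex_def)
      then show False using that by simp
    qed
    show "poly ?b (of_int l - \<alpha>) \<noteq> 0" if "i + int k \<le> l" for l
    proof
      assume "poly ?b (of_int l - \<alpha>) = 0"
      then have "of_int l - \<alpha> \<le> - \<gamma>" using assms(11) by simp
      then have "of_int l - of_int i - Re \<beta> \<le> - Re \<gamma>" by (simp add: i less_eq_complex_def)
      moreover have "of_int (i + int k) \<le> (of_int l :: real)" using that by (simp only: of_int_le_iff)
      ultimately show False using k_ge by simp
    qed
  qed
  have "nilpotency_index X f V \<alpha> = (LEAST n. annihilates n \<alpha>)"
    by (simp add: nilpotency_index_def annihilates_def)
  also have "\<dots> = order (- \<beta>) B"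
  proof (rule Least_equality, rule ann)
    show "order (- \<beta>) B \<le> n" if "annihilates n \<alpha>" for n
      by (rule order_le_annihilates[OF that i B_nz]) (fact B_eq, fact B_min)
  qed
  finally show ?thesis using B_order by simp
qed

end
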